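(* Suppose $n\ge2$ is even. The (projective) $\mathrm{SL}(2,\mathbb{Z})$-action on $\mathrm{Hig}(D\mathcal{K}_n)$ decomposes as $\mathbb{C}_{\mathrm{triv}}\oplus N_1$, where $N_1$ is the level $2$ Weil representation. The (projective) $\mathrm{SL}(2,\mathbb{Z})$-action on $Z_\Lambda$ decomposes as $$\bigoplus_{\substack{0\le k\le n\\ k\text{ even}}}\binom{n}{k}2^{n-k}(\mathbb{C}^2_{\mathrm{std}})^{\otimes k},$$ where $(\mathbb{C}^2_{\mathrm{std}})^{\otimes0}:=\mathbb{C}_{\mathrm{triv}}$.
   Context: $H=D\mathcal{K}_n$ (Drinfeld double of the Nichols Hopf algebra $\mathcal{K}_n$) is the $2^{2n+2}$-dimensional complex Hopf algebra with generators $K,\bar K,\xi_i,\bar\xi_i$ ($1\le i\le n$) and relations $K^2=\bar K^2=(K\bar K)^2=1$, $\xi_i^2=\bar\xi_i^2=0$; $K$ and $\bar K$ each anticommute with every $\xi_i$ and $\bar\xi_i$; $\xi_i\xi_j=-\xi_j\xi_i$, $\bar\xi_i\bar\xi_j=-\bar\xi_j\bar\xi_i$; $\xi_i\bar\xi_j=-\bar\xi_j\xi_i$ for $i\ne j$; $\xi_i\bar\xi_i=1-K\bar K-\bar\xi_i\xi_i$; $\Delta(K)=K\otimes K$, $\Delta(\bar K)=\bar K\otimes\bar K$, $\Delta(\xi_i)=K\otimes\xi_i+\xi_i\otimes1$, $\Delta(\bar\xi_i)=\bar K\otimes\bar\xi_i+\bar\xi_i\otimes1$, $S(K)=K$, $S(\bar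 K)=\bar K$, $S(\xi_i)=-K\xi_i$, $S(\bar\xi_i)=-\bar K\bar\xi_i$. Let $W$ be the set of words $w=\xi_{i_1}\cdots\xi_{i_k}$, $i_1<\dots<i_k$, $k\ge0$; $|w|=k$, $\bar w=\bar\xi_{i_1}\cdots\bar\xi_{i_k}$. $R$-matrix: $R=\sum_{w\in W}(-1)^{\lfloor|w|/2\rfloor}(w\otimes\bar w\bar K^{|w|})\cdot\frac12(1\otimes1+K\otimes1+1\otimes\bar K-K\otimes\bar K)$. Ribbon element: $\nu=(1+K-\bar K+K\bar K)\sum_{w\in W}\frac{(-1)^{\lfloor(|w|+1)/2\rfloor}}{2}w\bar w$. Integral: $\Lambda=\frac12(1+K+\bar K+K\bar K)\xi_1\cdots\xi_n\bar\xi_1\cdots\bar\xi_n$; $\lambda\in H^*$ is $2$ times the coefficient functional of $\xi_1\cdots\xi_n\bar\xi_1\cdots\bar\xi_n$ in the basis $\{K^a\bar K^bw\bar w'\}$ ($a,b\in\{0,1\}$, $w,w'\in W$). The projective $\mathrm{SL}(2,\mathbb{Z})$-action on the center $Z(H)$ is $s=\begin{pmatrix}0&-1\\1&0\end{pmatrix}\mapsto S_{LM}$, $t=\begin{pmatrix}1&1\\0&1\end{pmatrix}\mapsto T_{LM}$, where $S_{LM}(x)=(\mathrm{id}\otimes\lambda)(R^{-1}(1\otimes x)R_{21}^{-1})$, $T_{LM}(x)=\nu x$. $\mathrm{Hig}(H)$ is the image of $\tau(x)=\sum S(\Lambda_{(2)})x\Lambda_{(1)}G^{-1}$ with balancing element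 $G=K$, and $Z_\Lambda=\mathrm{span}\{(1+K\bar K)w\bar w':w,w'\in W,\ |w|+|w'|\text{ even}\}$; both are invariant subspaces of $Z(H)$. $\mathbb{C}_{\mathrm{triv}}$ is the trivial representation, $\mathbb{C}^2_{\mathrm{std}}$ the defining representation of $\mathrm{SL}(2,\mathbb{Z})$, and $N_1$ is the $2$-dimensional irreducible representation of $\mathrm{SL}(2,\mathbb{Z})$ factoring through $\mathrm{SL}(2,\mathbb{Z}/2)\cong S_3$. Decompositions are as projective representations (i.e. $s$ and $t$ act as stated up to one overall scalar each on the whole space). *)

theory Defs
  imports "HOL-Analysis.Analysis" "HOL-Library.Poly_Mapping" "HOL-Library.Function_Algebras"
begin

section \<open>Complex vector spaces and complex algebras\<close>

class cvector = ab_group_add +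
  fixes cscale :: "complex \<Rightarrow> 'a \<Rightarrow> 'a" (infixr \<open>*\<^sub>c\<close> 75)
  assumes cscale_add_right: "c *\<^sub>c (x + y) = c *\<^sub>c x + c *\<^sub>c y"
    and cscale_add_left: "(c + d) *\<^sub>c x = c *\<^sub>c x + d *\<^sub>c x"
    and cscale_cscale: "c *\<^sub>c (d *\<^sub>c x) = (c * d) *\<^sub>c x"
    and cscale_one: "1 *\<^sub>c x = x"

global_interpretation cvec: vector_space "cscale :: complex \<Rightarrow> 'a \<Rightarrow> 'a::cvector"
  by unfold_locales (rule cscale_add_right cscale_add_left cscale_cscale cscale_one)+

text \<open>Unital associative complex algebras.  The zero algebra is allowed.\<close>

class calgebra = cvector + ring + monoid_mult +
  assumes cscale_mult_left: "(c *\<^sub>c x) * y = c *\<^sub>c (x * y)"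
    and cscale_mult_right: "x * (c *\<^sub>c y) = c *\<^sub>c (x * y)"

abbreviation clinear :: "('a::cvector \<Rightarrow> 'b::cvector) \<Rightarrow> bool" where
  "clinear \<equiv> Vector_Spaces.linear (*\<^sub>c) (*\<^sub>c)"

lemma clinearI:
  assumes "\<And>x y. f (x + y) = f x + f y" and "\<And>c x. f (c *\<^sub>c x) = c *\<^sub>c f x"
  shows "clinear f"
  by unfold_locales (auto simp: assms cscale_add_right cscale_add_left cscale_cscale cscale_one)

lemma clinear_add: "clinear f \<Longrightarrow> f (x + y) = f x + f y"
  by (simp add: Vector_Spaces.linear_iff)

lemma clinear_scale: "clinear f \<Longrightarrow> f (c *\<^sub>c x) = c *\<^sub>c f x"
  by (simp add: Vector_Spaces.linear_iff)

lemma clinear_0: "clinear f \<Longrightarrow> f 0 = 0"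
  using clinear_add[of f 0 0] by simp

lemma clinear_neg: "clinear f \<Longrightarrow> f (- x) = - f x"
  using clinear_add[of f x "- x"] by (simp add: clinear_0 eq_neg_iff_add_eq_0 add.commute)

lemma clinear_diff: "clinear f \<Longrightarrow> f (x - y) = f x - f y"
  using clinear_add[of f x "- y"] by (simp add: clinear_neg)

definition cbilinear :: "('a::cvector \<Rightarrow> 'b::cvector \<Rightarrow> 'c::cvector) \<Rightarrow> bool" where
  "cbilinear \<beta> \<longleftrightarrow> (\<forall>a. clinear (\<beta> a)) \<and> (\<forall>b. clinear (\<lambda>a. \<beta> a b))"

instantiation complex :: cvector
begin
definition "cscale_complex (c::complex) (z::complex) = c * z"
instance by standard (auto simp: cscale_complex_def algebra_simps)
end

instantiation "fun" :: (type, cvector) cvector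
begin
definition "cscale_fun c f = (\<lambda>x. c *\<^sub>c f x)"
instance
  by standard (auto simp: cscale_fun_def plus_fun_def cscale_add_right cscale_add_left cscale_cscale
      cscale_one fun_eq_iff)
end

instantiation prod :: (cvector, cvector) cvector
begin
definition "cscale_prod c p = (c *\<^sub>c fst p, c *\<^sub>c snd p)"
instance
  by standard (auto simp: cscale_prod_def cscale_add_right cscale_add_left cscale_cscale
      cscale_one prod_eq_iff)
end

instantiation vec :: (cvector, finite) cvector
begin
definition "cscale_vec c v = (\<chi> i. c *\<^sub>c v $ i)"
instance
  by standard (auto simp: cscale_vec_def cscale_add_right cscale_add_left cscale_cscale
      cscale_one vec_eq_iff)
end

instantiation poly_mapping :: (type, cvector) cvector
begin
definition "cscale_poly_mapping c f = Poly_Mapping.map ((*\<^sub>c) c) f"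

lemma lookup_cscale [simp]:
  "Poly_Mapping.lookup (c *\<^sub>c f) k = c *\<^sub>c Poly_Mapping.lookup f k"
  by (auto simp: cscale_poly_mapping_def Poly_Mapping.map.rep_eq when_def)

instance
  by standard (auto intro!: poly_mapping_eqI simp: lookup_add cscale_add_right cscale_add_left
      cscale_cscale cscale_one)
end

definition lin_ext :: "('k \<Rightarrow> 'a::cvector) \<Rightarrow> ('k \<Rightarrow>\<^sub>0 complex) \<Rightarrow> 'a" where
  "lin_ext \<beta> f = (\<Sum>k\<in>Poly_Mapping.keys f. Poly_Mapping.lookup f k *\<^sub>c \<beta> k)"

lemma lin_ext_superset:
  assumes "finite A" "Poly_Mapping.keys f \<subseteq> A"
  shows "lin_ext \<beta> f = (\<Sum>k\<in>A. Poly_Mapping.lookup f k *\<^sub>c \<beta> k)"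
  unfolding lin_ext_def
  by (rule sum.mono_neutral_left) (use assms in \<open>auto simp: in_keys_iff\<close>)

lemma clinear_lin_ext: "clinear (lin_ext \<beta>)"
proof (rule clinearI)
  fix f g :: "'a \<Rightarrow>\<^sub>0 complex"
  let ?A = "Poly_Mapping.keys f \<union> Poly_Mapping.keys g"
  have "lin_ext \<beta> (f + g) = (\<Sum>k\<in>?A. Poly_Mapping.lookup (f + g) k *\<^sub>c \<beta> k)"
    by (rule lin_ext_superset) (auto simp: keys_add)
  also have "\<dots> = lin_ext \<beta> f + lin_ext \<beta> g"
    by (simp add: lookup_add cscale_add_left sum.distrib lin_ext_superset[of ?A])
  finally show "lin_ext \<beta> (f + g) = lin_ext \<beta> f + lin_ext \<beta> g" .
next
  fix c and f :: "'a \<Rightarrow>\<^sub>0 complex"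
  have "lin_ext \<beta> (c *\<^sub>c f) = (\<Sum>k\<in>Poly_Mapping.keys f. Poly_Mapping.lookup (c *\<^sub>c f) k *\<^sub>c \<beta> k)"
    by (rule lin_ext_superset) (auto simp: in_keys_iff cscale_complex_def)
  then show "lin_ext \<beta> (c *\<^sub>c f) = c *\<^sub>c lin_ext \<beta> f"
    by (simp add: lin_ext_def cvec.scale_sum_right cscale_cscale cscale_complex_def)
qed

lemma lin_ext_single [simp]: "lin_ext \<beta> (Poly_Mapping.single k c) = c *\<^sub>c \<beta> k"
  by (cases "c = 0") (auto simp: lin_ext_def)

lemma free_induct [case_names zero single add]:
  assumes "P 0" and "\<And>k c. P (Poly_Mapping.single k (c::'b::ab_group_add))"
    and "\<And>f g. P f \<Longrightarrow> P g \<Longrightarrow> P (f + g)"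
  shows "P f"
proof -
  have *: "f = (\<Sum>k\<in>Poly_Mapping.keys f. Poly_Mapping.single k (Poly_Mapping.lookup f k))"
    by (rule poly_mapping_eqI)
      (auto simp: lookup_sum lookup_single when_def in_keys_iff sum.delta)
  have "P (\<Sum>k\<in>A. Poly_Mapping.single k (Poly_Mapping.lookup f k))" if "finite A" for A
    using that by induction (use assms in auto)
  then show ?thesis by (subst *) auto
qed


section \<open>Tensor products\<close>

text \<open>The free vector space on pairs modulo the span of the bilinearity relations.\<close>

abbreviation pair_gen :: "'a \<Rightarrow> 'b \<Rightarrow> (('a \<times> 'b) \<Rightarrow>\<^sub>0 complex)" where
  "pair_gen a b \<equiv> Poly_Mapping.single (a, b) 1"

inductive_set tensor_rels :: "(('a::cvector \<times> 'b::cvector) \<Rightarrow>\<^sub>0 complex) set" where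
  "pair_gen (a + a') b - pair_gen a b - pair_gen a' b \<in> tensor_rels"
| "pair_gen a (b + b') - pair_gen a b - pair_gen a b' \<in> tensor_rels"
| "pair_gen (c *\<^sub>c a) b - c *\<^sub>c pair_gen a b \<in> tensor_rels"
| "pair_gen a (c *\<^sub>c b) - c *\<^sub>c pair_gen a b \<in> tensor_rels"

definition tensor_eq :: "(('a::cvector \<times> 'b::cvector) \<Rightarrow>\<^sub>0 complex) \<Rightarrow> (('a \<times> 'b) \<Rightarrow>\<^sub>0 complex) \<Rightarrow> bool"
  where "tensor_eq f g \<longleftrightarrow> f - g \<in> cvec.span tensor_rels"

lemma equivp_tensor_eq: "equivp (tensor_eq :: (('a::cvector \<times> 'b::cvector) \<Rightarrow>\<^sub>0 complex) \<Rightarrow> _)"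
proof (rule equivpI)
  show "reflp (tensor_eq :: (('a \<times> 'b) \<Rightarrow>\<^sub>0 complex) \<Rightarrow> _)" by (auto intro!: reflpI simp: tensor_eq_def cvec.span_zero)
  show "symp (tensor_eq :: (('a \<times> 'b) \<Rightarrow>\<^sub>0 complex) \<Rightarrow> _)"
    by (rule sympI) (simp add: tensor_eq_def, subst minus_diff_eq[symmetric], rule cvec.span_neg)
  show "transp (tensor_eq :: (('a \<times> 'b) \<Rightarrow>\<^sub>0 complex) \<Rightarrow> _)"
  proof (rule transpI)
    fix f g h :: "('a \<times> 'b) \<Rightarrow>\<^sub>0 complex"
    assume "tensor_eq f g" "tensor_eq g h"
    then have "(f - g) + (g - h) \<in> cvec.span tensor_rels"
      unfolding tensor_eq_def by (rule cvec.span_add)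
    then show "tensor_eq f h" by (simp add: tensor_eq_def)
  qed
qed

quotient_type (overloaded) ('a, 'b) tensor = "('a::cvector \<times> 'b::cvector) \<Rightarrow>\<^sub>0 complex" / tensor_eq
  by (rule equivp_tensor_eq)

instantiation tensor :: (cvector, cvector) cvector
begin

lift_definition zero_tensor :: "('a, 'b) tensor" is 0 .

lift_definition plus_tensor :: "('a, 'b) tensor \<Rightarrow> ('a, 'b) tensor \<Rightarrow> ('a, 'b) tensor" is "(+)"
proof -
  fix f f' g g' :: "('a \<times> 'b) \<Rightarrow>\<^sub>0 complex"
  assume "tensor_eq f f'" "tensor_eq g g'"
  then have "(f - f') + (g - g') \<in> cvec.span tensor_rels" 
    unfolding tensor_eq_def by (rule cvec.span_add)
  then show "tensor_eq (f + g) (f' + g')" by (simp add: tensor_eq_def algebra_simps)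
qed

lift_definition minus_tensor :: "('a, 'b) tensor \<Rightarrow> ('a, 'b) tensor \<Rightarrow> ('a, 'b) tensor" is "(-)"
proof -
  fix f f' g g' :: "('a \<times> 'b) \<Rightarrow>\<^sub>0 complex"
  assume "tensor_eq f f'" "tensor_eq g g'"
  then have "(f - f') - (g - g') \<in> cvec.span tensor_rels" 
    unfolding tensor_eq_def by (rule cvec.span_diff)
  then show "tensor_eq (f - g) (f' - g')" by (simp add: tensor_eq_def algebra_simps)
qed

lift_definition uminus_tensor :: "('a, 'b) tensor \<Rightarrow> ('a, 'b) tensor" is "uminus"
proof -
  fix f f' :: "('a \<times> 'b) \<Rightarrow>\<^sub>0 complex"
  assume "tensor_eq f f'"
  then have "- (f - f') \<in> cvec.span tensor_rels" 
    unfolding tensor_eq_def by (rule cvec.span_neg)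
  then show "tensor_eq (- f) (- f')" by (simp add: tensor_eq_def algebra_simps)
qed

lift_definition cscale_tensor :: "complex \<Rightarrow> ('a, 'b) tensor \<Rightarrow> ('a, 'b) tensor" is "(*\<^sub>c)"
  unfolding tensor_eq_def by (simp add: cvec.scale_right_diff_distrib[symmetric] cvec.span_scale)

instance
proof
  show "a + b + c = a + (b + c)" "a + b = b + a" "0 + a = a" "- a + a = 0" "a - b = a + - b"
    for a b c :: "('a, 'b) tensor"
    by (transfer; simp add: tensor_eq_def cvec.span_zero algebra_simps)+
  show "c *\<^sub>c (x + y) = c *\<^sub>c x + c *\<^sub>c y" "(c + d) *\<^sub>c x = c *\<^sub>c x + d *\<^sub>c x"
    "c *\<^sub>c d *\<^sub>c x = (c * d) *\<^sub>c x" "1 *\<^sub>c x = x" for c d and x y :: "('a, 'b) tensor"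
    by (transfer; simp add: tensor_eq_def cvec.span_zero cscale_add_right cscale_add_left
        cscale_cscale cscale_one)+
qed

end

lift_definition tens :: "'a::cvector \<Rightarrow> 'b::cvector \<Rightarrow> ('a, 'b) tensor" (infixr \<open>\<otimes>\<^sub>c\<close> 76)
  is pair_gen .

text \<open>The linear map \<open>a \<otimes> b \<mapsto> \<beta> a b\<close> induced by a bilinear map \<open>\<beta>\<close>.  It is computed on a
  representative; by \<open>tlift_tens\<close> the result is the right one whenever \<open>\<beta>\<close> is bilinear.\<close>

definition tlift :: "('a::cvector \<Rightarrow> 'b::cvector \<Rightarrow> 'c::cvector) \<Rightarrow> ('a, 'b) tensor \<Rightarrow> 'c" where
  "tlift \<beta> z = lin_ext (case_prod \<beta>) (rep_tensor z)"

lemma cbilinearD: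
  assumes "cbilinear \<beta>"
  shows "\<beta> (a + a') b = \<beta> a b + \<beta> a' b" "\<beta> a (b + b') = \<beta> a b + \<beta> a b'"
    "\<beta> (c *\<^sub>c a) b = c *\<^sub>c \<beta> a b" "\<beta> a (c *\<^sub>c b) = c *\<^sub>c \<beta> a b"
  using assms clinear_add[of "\<lambda>a. \<beta> a b"] clinear_scale[of "\<lambda>a. \<beta> a b"]
  by (auto simp: cbilinear_def clinear_add clinear_scale)

lemma cbilinearI:
  assumes "\<And>a a' b. \<beta> (a + a') b = \<beta> a b + \<beta> a' b" "\<And>a b b'. \<beta> a (b + b') = \<beta> a b + \<beta> a b'"
    "\<And>c a b. \<beta> (c *\<^sub>c a) b = c *\<^sub>c \<beta> a b" "\<And>c a b. \<beta> a (c *\<^sub>c b) = c *\<^sub>c \<beta> a b"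
  shows "cbilinear \<beta>"
  unfolding cbilinear_def using assms by (auto intro!: clinearI)

lemma lin_ext_tensor_rels:
  assumes "cbilinear \<beta>" "f \<in> cvec.span tensor_rels"
  shows "lin_ext (case_prod \<beta>) f = 0"
  using assms(2)
proof (induction rule: cvec.span_induct_alt)
  case base
  show ?case by (simp add: clinear_0[OF clinear_lin_ext])
next
  case (step c x y)
  have "lin_ext (case_prod \<beta>) x = 0"
    using step(1) by cases (simp_all add: clinear_diff[OF clinear_lin_ext]
        clinear_scale[OF clinear_lin_ext] cscale_one cbilinearD[OF assms(1)])
  then show ?case
    using step by (simp add: clinear_add[OF clinear_lin_ext] clinear_scale[OF clinear_lin_ext])
qed

lemma tlift_abs:
  assumes "cbilinear \<beta>"
  shows "tlift \<beta> (abs_tensor f) = lin_ext (case_prod \<beta>) f"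
proof -
  have "tensor_eq (rep_tensor (abs_tensor f)) f"
    by (rule Quotient3_rep_abs[OF Quotient3_tensor]) (simp add: equivp_reflp[OF equivp_tensor_eq])
  then have "lin_ext (case_prod \<beta>) (rep_tensor (abs_tensor f) - f) = 0"
    by (intro lin_ext_tensor_rels[OF assms]) (simp add: tensor_eq_def)
  then show ?thesis
    by (simp add: tlift_def clinear_diff[OF clinear_lin_ext])
qed

lemma tlift_tens: "cbilinear \<beta> \<Longrightarrow> tlift \<beta> (a \<otimes>\<^sub>c b) = \<beta> a b"
  by (simp add: tens.abs_eq tlift_abs cscale_one)

lemma clinear_tlift:
  assumes "cbilinear \<beta>" shows "clinear (tlift \<beta>)"
proof (rule clinearI)
  fix x y :: "('a, 'b) tensor"
  obtain f g where "x = abs_tensor f" "y = abs_tensor g"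
    by (metis Quotient3_abs_rep[OF Quotient3_tensor])
  then show "tlift \<beta> (x + y) = tlift \<beta> x + tlift \<beta> y"
    by (simp add: plus_tensor.abs_eq tlift_abs[OF assms] clinear_add[OF clinear_lin_ext])
next
  fix c and x :: "('a, 'b) tensor"
  obtain f where "x = abs_tensor f"
    by (metis Quotient3_abs_rep[OF Quotient3_tensor])
  then show "tlift \<beta> (c *\<^sub>c x) = c *\<^sub>c tlift \<beta> x"
    by (simp add: cscale_tensor.abs_eq tlift_abs[OF assms] clinear_scale[OF clinear_lin_ext])
qed

lemma cbilinear_tens: "cbilinear (\<otimes>\<^sub>c)"
proof (rule cbilinearI)
  show "(a + a') \<otimes>\<^sub>c b = a \<otimes>\<^sub>c b + a' \<otimes>\<^sub>c b" for a a' :: 'a and b :: 'b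
    by transfer (auto simp: tensor_eq_def diff_diff_eq[symmetric] intro!: cvec.span_base tensor_rels.intros)
  show "a \<otimes>\<^sub>c (b + b') = a \<otimes>\<^sub>c b + a \<otimes>\<^sub>c b'" for a :: 'a and b b' :: 'b
    by transfer (auto simp: tensor_eq_def diff_diff_eq[symmetric] intro!: cvec.span_base tensor_rels.intros)
  show "(c *\<^sub>c a) \<otimes>\<^sub>c b = c *\<^sub>c (a \<otimes>\<^sub>c b)" for c and a :: 'a and b :: 'b
    by transfer (auto simp: tensor_eq_def intro!: cvec.span_base tensor_rels.intros)
  show "a \<otimes>\<^sub>c (c *\<^sub>c b) = c *\<^sub>c (a \<otimes>\<^sub>c b)" for c and a :: 'a and b :: 'b
    by transfer (auto simp: tensor_eq_def intro!: cvec.span_base tensor_rels.intros)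
qed

lemmas tens_simps = cbilinearD[OF cbilinear_tens]

lemma tens_0 [simp]: "0 \<otimes>\<^sub>c b = 0" "a \<otimes>\<^sub>c 0 = 0"
  using tens_simps(1)[of 0 0 b] tens_simps(2)[of a 0 0] by simp_all

lemma tens_minus: "(- a) \<otimes>\<^sub>c b = - (a \<otimes>\<^sub>c b)" "a \<otimes>\<^sub>c (- b) = - (a \<otimes>\<^sub>c b)"
  using tens_simps(1)[of a "- a" b] tens_simps(2)[of a b "- b"]
  by (simp_all add: eq_neg_iff_add_eq_0 add.commute)

lemma tens_diff: "(a - a') \<otimes>\<^sub>c b = a \<otimes>\<^sub>c b - a' \<otimes>\<^sub>c b" "a \<otimes>\<^sub>c (b - b') = a \<otimes>\<^sub>c b - a \<otimes>\<^sub>c b'"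
  using tens_simps(1)[of a "- a'" b] tens_simps(2)[of a b "- b'"] by (simp_all add: tens_minus)

lemma tensor_induct [case_names tens add]:
  assumes "\<And>a b. P (a \<otimes>\<^sub>c b)" and "\<And>x y. P x \<Longrightarrow> P y \<Longrightarrow> P (x + y)"
  shows "P (z :: ('a::cvector, 'b::cvector) tensor)"
proof (induction z rule: tensor.abs_induct)
  case (1 f)
  show ?case
  proof (induction f rule: free_induct)
    case zero
    have "P (0 \<otimes>\<^sub>c 0)" by (rule assms)
    then show ?case by (simp add: zero_tensor.abs_eq)
  next
    case (single k c)
    obtain a b where k: "k = (a, b)" by force
    have "Poly_Mapping.single k c = c *\<^sub>c pair_gen a b"
      by (rule poly_mapping_eqI) (auto simp: k lookup_single when_def cscale_complex_def)
    then have "abs_tensor (Poly_Mapping.single k c) = (c *\<^sub>c a) \<otimes>\<^sub>c b"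
      by (simp add: cscale_tensor.abs_eq[symmetric] tens.abs_eq[symmetric] tens_simps)
    then show ?case using assms(1) by simp
  next
    case (add f g)
    then show ?case using assms(2) by (simp add: plus_tensor.abs_eq[symmetric])
  qed
qed

instantiation tensor :: (calgebra, calgebra) "{times, one}"
begin

definition "(1 :: ('a, 'b) tensor) = 1 \<otimes>\<^sub>c 1"

definition "(x :: ('a, 'b) tensor) * y = tlift (\<lambda>a b. tlift (\<lambda>c d. (a * c) \<otimes>\<^sub>c (b * d)) y) x"

instance ..

end

lemma cbilinear_times_inner:
  "cbilinear (\<lambda>c d. ((a::'a::calgebra) * c) \<otimes>\<^sub>c ((b::'b::calgebra) * d))"
  by (rule cbilinearI) (simp_all add: distrib_left tens_simps cscale_mult_right)

lemma cbilinear_times_outer: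
  "cbilinear (\<lambda>a b. tlift (\<lambda>c d. ((a::'a::calgebra) * c) \<otimes>\<^sub>c ((b::'b::calgebra) * d)) y)"
proof -
  define M where "M a b = tlift (\<lambda>c d. ((a::'a) * c) \<otimes>\<^sub>c ((b::'b) * d))" for a b
  have M: "M a b (c \<otimes>\<^sub>c d) = (a * c) \<otimes>\<^sub>c (b * d)" "M a b (y + z) = M a b y + M a b z" for a b c d y z
    unfolding M_def
    by (rule tlift_tens[OF cbilinear_times_inner], rule clinear_add[OF clinear_tlift[OF cbilinear_times_inner]])
  note simps = M distrib_right tens_simps cscale_mult_left cscale_add_right
  have "cbilinear (\<lambda>a b. M a b y)"
  proof (rule cbilinearI, goal_cases)
    case (1 a a' b) show ?case by (induction y rule: tensor_induct) (simp_all add: simps add_ac)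
  next
    case (2 a b b') show ?case by (induction y rule: tensor_induct) (simp_all add: simps add_ac)
  next
    case (3 c a b) show ?case by (induction y rule: tensor_induct) (simp_all add: simps)
  next
    case (4 c a b) show ?case by (induction y rule: tensor_induct) (simp_all add: simps)
  qed
  then show ?thesis by (simp add: M_def)
qed

lemma tens_times: "(a \<otimes>\<^sub>c b) * y = tlift (\<lambda>c d. ((a::'a::calgebra) * c) \<otimes>\<^sub>c ((b::'b::calgebra) * d)) y"
  unfolding times_tensor_def by (rule tlift_tens[OF cbilinear_times_outer])

lemma tens_mult_tens [simp]:
  "((a::'a::calgebra) \<otimes>\<^sub>c (b::'b::calgebra)) * (c \<otimes>\<^sub>c d) = (a * c) \<otimes>\<^sub>c (b * d)"
  unfolding tens_times by (rule tlift_tens[OF cbilinear_times_inner])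

lemma tensor_mult_add_left: "(x + y) * z = x * z + y * (z :: ('a::calgebra, 'b::calgebra) tensor)"
  unfolding times_tensor_def by (rule clinear_add[OF clinear_tlift[OF cbilinear_times_outer]])

lemma tensor_mult_scale_left: "(c *\<^sub>c x) * z = c *\<^sub>c (x * (z :: ('a::calgebra, 'b::calgebra) tensor))"
  unfolding times_tensor_def by (rule clinear_scale[OF clinear_tlift[OF cbilinear_times_outer]])

lemma tens_times_linear:
  "((a::'a::calgebra) \<otimes>\<^sub>c (b::'b::calgebra)) * (y + z) = (a \<otimes>\<^sub>c b) * y + (a \<otimes>\<^sub>c b) * z"
  "((a::'a::calgebra) \<otimes>\<^sub>c (b::'b::calgebra)) * (c *\<^sub>c y) = c *\<^sub>c ((a \<otimes>\<^sub>c b) * y)"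
  unfolding tens_times
  by (rule clinear_add[OF clinear_tlift[OF cbilinear_times_inner]],
      rule clinear_scale[OF clinear_tlift[OF cbilinear_times_inner]])

lemma tensor_mult_add_right: "x * (y + z) = x * y + x * (z :: ('a::calgebra, 'b::calgebra) tensor)"
  by (induction x rule: tensor_induct) (simp_all add: tens_times_linear tensor_mult_add_left add_ac)

lemma tensor_mult_scale_right: "x * (c *\<^sub>c y) = c *\<^sub>c (x * (y :: ('a::calgebra, 'b::calgebra) tensor))"
  by (induction x rule: tensor_induct)
    (simp_all add: tens_times_linear tensor_mult_add_left cscale_add_right)

lemma tensor_mult_assoc: "x * y * z = x * (y * (z :: ('a::calgebra, 'b::calgebra) tensor))"
proof (induction x rule: tensor_induct)
  case (tens a b)
  show ?case
  proof (induction y rule: tensor_induct)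
    case (tens c d)
    show ?case by (induction z rule: tensor_induct) (auto simp: tensor_mult_add_right mult.assoc)
  qed (auto simp: tensor_mult_add_left tensor_mult_add_right)
qed (auto simp: tensor_mult_add_left)

instance tensor :: (calgebra, calgebra) calgebra
proof
  show "1 * x = x" "x * 1 = x" for x :: "('a, 'b) tensor"
    unfolding one_tensor_def
    by (induction x rule: tensor_induct) (auto simp: tensor_mult_add_left tensor_mult_add_right)
qed (auto simp: tensor_mult_add_left tensor_mult_add_right tensor_mult_scale_left
    tensor_mult_scale_right tensor_mult_assoc)

definition tflip :: "('a::cvector, 'b::cvector) tensor \<Rightarrow> ('b, 'a) tensor" where
  "tflip = tlift (\<lambda>a b. b \<otimes>\<^sub>c a)"


section \<open>Free algebras and ideals\<close>

text \<open>Words form a monoid under concatenation, so that \<open>'g list \<Rightarrow>\<^sub>0 complex\<close>, with the convolution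
  product of \<^type>\<open>poly_mapping\<close>, is the free associative algebra on \<open>'g\<close>.\<close>

instantiation list :: (type) monoid_add
begin
definition "(0 :: 'a list) = []"
definition "(xs :: 'a list) + ys = xs @ ys"
instance by standard (auto simp: zero_list_def plus_list_def)
end

abbreviation gen :: "'g \<Rightarrow> ('g list \<Rightarrow>\<^sub>0 complex)" where
  "gen g \<equiv> Poly_Mapping.single [g] 1"

definition free_eval :: "('g \<Rightarrow> 'a::calgebra) \<Rightarrow> ('g list \<Rightarrow>\<^sub>0 complex) \<Rightarrow> 'a" where
  "free_eval \<phi> = lin_ext (\<lambda>w. prod_list (map \<phi> w))"

definition free_anti_eval :: "('g \<Rightarrow> 'a::calgebra) \<Rightarrow> ('g list \<Rightarrow>\<^sub>0 complex) \<Rightarrow> 'a" where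
  "free_anti_eval \<phi> = lin_ext (\<lambda>w. prod_list (map \<phi> (rev w)))"

lemma clinear_free_eval: "clinear (free_eval \<phi>)" "clinear (free_anti_eval \<phi>)"
  by (simp_all add: free_eval_def free_anti_eval_def clinear_lin_ext)

lemma free_eval_one: "free_eval \<phi> 1 = 1" "free_anti_eval \<phi> 1 = 1"
  unfolding single_one[symmetric] free_eval_def free_anti_eval_def
  by (simp_all add: zero_list_def cscale_one)

lemma free_eval_gen: "free_eval \<phi> (gen g) = \<phi> g" "free_anti_eval \<phi> (gen g) = \<phi> g"
  by (simp_all add: free_eval_def free_anti_eval_def cscale_one)

lemma free_eval_mult: "free_eval \<phi> (f * g) = free_eval \<phi> f * free_eval \<phi> g"
proof (induction f rule: free_induct)
  case zero show ?case by (simp add: clinear_0[OF clinear_free_eval(1)])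
next
  case (single k c)
  show ?case
  proof (induction g rule: free_induct)
    case zero show ?case by (simp add: clinear_0[OF clinear_free_eval(1)])
  next
    case (single l d)
    show ?case
      by (simp add: free_eval_def mult_single plus_list_def cscale_mult_left cscale_mult_right
          cscale_cscale)
  qed (simp add: distrib_left clinear_add[OF clinear_free_eval(1)])
qed (simp add: distrib_right clinear_add[OF clinear_free_eval(1)])

lemma free_anti_eval_mult: "free_anti_eval \<phi> (f * g) = free_anti_eval \<phi> g * free_anti_eval \<phi> f"
proof (induction f rule: free_induct)
  case zero show ?case by (simp add: clinear_0[OF clinear_free_eval(2)])
next
  case (single k c)
  show ?case
  proof (induction g rule: free_induct)
    case zero show ?case by (simp add: clinear_0[OF clinear_free_eval(2)])
  next
    case (single l d)
    show ?case
      by (simp add: free_anti_eval_def mult_single plus_list_def cscale_mult_left cscale_mult_right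
          cscale_cscale mult.commute)
  qed (simp add: distrib_right distrib_left clinear_add[OF clinear_free_eval(2)])
qed (simp add: distrib_left distrib_right clinear_add[OF clinear_free_eval(2)])

inductive_set ideal_gen :: "'r::ring_1 set \<Rightarrow> 'r set" for X where
  zero: "0 \<in> ideal_gen X"
| incl: "r \<in> X \<Longrightarrow> a * r * b \<in> ideal_gen X"
| add: "x \<in> ideal_gen X \<Longrightarrow> y \<in> ideal_gen X \<Longrightarrow> x + y \<in> ideal_gen X"

lemma ideal_gen_mult_left: "x \<in> ideal_gen X \<Longrightarrow> a * x \<in> ideal_gen X"
proof (induction rule: ideal_gen.induct)
  case (incl r b c)
  then show ?case using ideal_gen.incl[of r X "a * b" c] by (simp add: mult.assoc)
qed (auto intro: ideal_gen.intros simp: distrib_left)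

lemma ideal_gen_mult_right: "x \<in> ideal_gen X \<Longrightarrow> x * a \<in> ideal_gen X"
proof (induction rule: ideal_gen.induct)
  case (incl r b c)
  then show ?case using ideal_gen.incl[of r X b "c * a"] by (simp add: mult.assoc)
qed (auto intro: ideal_gen.intros simp: distrib_right)

lemma ideal_gen_uminus: "x \<in> ideal_gen X \<Longrightarrow> - x \<in> ideal_gen X"
  using ideal_gen_mult_left[of x X "-1"] by simp

lemma ideal_gen_base: "r \<in> X \<Longrightarrow> r \<in> ideal_gen X"
  using ideal_gen.incl[of r X 1 1] by simp

lemma free_scale_eq: "c *\<^sub>c f = Poly_Mapping.single 0 c * (f :: 'g list \<Rightarrow>\<^sub>0 complex)"
proof (induction f rule: free_induct)
  case (single k d)
  show ?case
    by (rule poly_mapping_eqI) (auto simp: mult_single lookup_single when_def cscale_complex_def)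
qed (auto simp: cscale_add_right distrib_left)

lemma free_scale_mult:
  "(c *\<^sub>c f) * g = c *\<^sub>c (f * (g :: 'g list \<Rightarrow>\<^sub>0 complex))"
  "f * (c *\<^sub>c g) = c *\<^sub>c (f * (g :: 'g list \<Rightarrow>\<^sub>0 complex))"
proof -
  show "(c *\<^sub>c f) * g = c *\<^sub>c (f * g)" by (simp add: free_scale_eq mult.assoc)
  have "f * Poly_Mapping.single 0 c = Poly_Mapping.single 0 c * f"
    by (induction f rule: free_induct) (auto simp: mult_single mult.commute distrib_left distrib_right)
  then show "f * (c *\<^sub>c g) = c *\<^sub>c (f * g)" by (simp add: free_scale_eq mult.assoc[symmetric])
qed


section \<open>The Drinfeld double of the Nichols Hopf algebra\<close>

text \<open>The index set \<open>{1,\<dots>,n}\<close> is a finite linearly ordered type \<^typ>\<open>'n\<close> with \<open>CARD('n) = n\<close>.\<close>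

datatype 'n dk_gen = GK | GKb | GX 'n | GXb 'n

inductive_set dk_rels :: "('n dk_gen list \<Rightarrow>\<^sub>0 complex) set" where
  "gen GK * gen GK - 1 \<in> dk_rels"
| "gen GKb * gen GKb - 1 \<in> dk_rels"
| "(gen GK * gen GKb) * (gen GK * gen GKb) - 1 \<in> dk_rels"
| "gen (GX i) * gen (GX i) \<in> dk_rels"
| "gen (GXb i) * gen (GXb i) \<in> dk_rels"
| "gen GK * gen (GX i) + gen (GX i) * gen GK \<in> dk_rels"
| "gen GK * gen (GXb i) + gen (GXb i) * gen GK \<in> dk_rels"
| "gen GKb * gen (GX i) + gen (GX i) * gen GKb \<in> dk_rels"
| "gen GKb * gen (GXb i) + gen (GXb i) * gen GKb \<in> dk_rels"
| "gen (GX i) * gen (GX j) + gen (GX j) * gen (GX i) \<in> dk_rels"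
| "gen (GXb i) * gen (GXb j) + gen (GXb j) * gen (GXb i) \<in> dk_rels"
| "i \<noteq> j \<Longrightarrow> gen (GX i) * gen (GXb j) + gen (GXb j) * gen (GX i) \<in> dk_rels"
| "gen (GX i) * gen (GXb i) - (1 - gen GK * gen GKb - gen (GXb i) * gen (GX i)) \<in> dk_rels"

definition dk_eq :: "('n dk_gen list \<Rightarrow>\<^sub>0 complex) \<Rightarrow> ('n dk_gen list \<Rightarrow>\<^sub>0 complex) \<Rightarrow> bool" where
  "dk_eq f g \<longleftrightarrow> f - g \<in> ideal_gen dk_rels"

lemma equivp_dk_eq: "equivp (dk_eq :: ('n dk_gen list \<Rightarrow>\<^sub>0 complex) \<Rightarrow> _)"
proof (rule equivpI)
  show "reflp (dk_eq :: ('n dk_gen list \<Rightarrow>\<^sub>0 complex) \<Rightarrow> _)" by (auto intro!: reflpI ideal_gen.zero simp: dk_eq_def)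
  show "symp (dk_eq :: ('n dk_gen list \<Rightarrow>\<^sub>0 complex) \<Rightarrow> _)"
    by (rule sympI) (simp add: dk_eq_def, subst minus_diff_eq[symmetric], rule ideal_gen_uminus)
  show "transp (dk_eq :: ('n dk_gen list \<Rightarrow>\<^sub>0 complex) \<Rightarrow> _)"
  proof (rule transpI)
    fix f g h :: "'n dk_gen list \<Rightarrow>\<^sub>0 complex"
    assume "dk_eq f g" "dk_eq g h"
    then have "(f - g) + (g - h) \<in> ideal_gen dk_rels"
      unfolding dk_eq_def by (rule ideal_gen.add)
    then show "dk_eq f h" by (simp add: dk_eq_def)
  qed
qed

quotient_type 'n dk = "'n dk_gen list \<Rightarrow>\<^sub>0 complex" / dk_eq
  by (rule equivp_dk_eq)

instantiation dk :: (type) calgebra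
begin

lift_definition zero_dk :: "'a dk" is 0 .
lift_definition one_dk :: "'a dk" is 1 .

lift_definition plus_dk :: "'a dk \<Rightarrow> 'a dk \<Rightarrow> 'a dk" is "(+)"
proof -
  fix f f' g g' :: "'a dk_gen list \<Rightarrow>\<^sub>0 complex"
  assume "dk_eq f f'" "dk_eq g g'"
  then have "(f - f') + (g - g') \<in> ideal_gen dk_rels" 
    unfolding dk_eq_def by (rule ideal_gen.add)
  then show "dk_eq (f + g) (f' + g')" by (simp add: dk_eq_def algebra_simps)
qed

lift_definition minus_dk :: "'a dk \<Rightarrow> 'a dk \<Rightarrow> 'a dk" is "(-)"
proof -
  fix f f' g g' :: "'a dk_gen list \<Rightarrow>\<^sub>0 complex"
  assume "dk_eq f f'" "dk_eq g g'"
  then have "(f - f') + - (g - g') \<in> ideal_gen dk_rels"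
    unfolding dk_eq_def by (intro ideal_gen.add ideal_gen_uminus)
  then show "dk_eq (f - g) (f' - g')" by (simp add: dk_eq_def algebra_simps)
qed

lift_definition uminus_dk :: "'a dk \<Rightarrow> 'a dk" is "uminus"
proof -
  fix f f' :: "'a dk_gen list \<Rightarrow>\<^sub>0 complex"
  assume "dk_eq f f'"
  then have "- (f - f') \<in> ideal_gen dk_rels" 
    unfolding dk_eq_def by (rule ideal_gen_uminus)
  then show "dk_eq (- f) (- f')" by (simp add: dk_eq_def algebra_simps)
qed

lift_definition times_dk :: "'a dk \<Rightarrow> 'a dk \<Rightarrow> 'a dk" is "(*)"
proof -
  fix f f' g g' :: "'a dk_gen list \<Rightarrow>\<^sub>0 complex"
  assume "dk_eq f f'" "dk_eq g g'"
  then have "(f - f') * g + f' * (g - g') \<in> ideal_gen dk_rels"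
    unfolding dk_eq_def by (intro ideal_gen.add ideal_gen_mult_left ideal_gen_mult_right)
  then show "dk_eq (f * g) (f' * g')" by (simp add: dk_eq_def algebra_simps)
qed

lift_definition cscale_dk :: "complex \<Rightarrow> 'a dk \<Rightarrow> 'a dk" is "(*\<^sub>c)"
  unfolding dk_eq_def free_scale_eq by (simp add: right_diff_distrib[symmetric] ideal_gen_mult_left)

instance
proof
  show "a + b + c = a + (b + c)" "a + b = b + a" "0 + a = a" "- a + a = 0" "a - b = a + - b"
    "a * b * c = a * (b * c)" "(a + b) * c = a * c + b * c" "a * (b + c) = a * b + a * c"
    "1 * a = a" "a * 1 = a"
    for a b c :: "'a dk"
    by (transfer; simp add: dk_eq_def ideal_gen.zero algebra_simps)+
  show "c *\<^sub>c (x + y) = c *\<^sub>c x + c *\<^sub>c y" "(c + d) *\<^sub>c x = c *\<^sub>c x + d *\<^sub>c x"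
    "c *\<^sub>c d *\<^sub>c x = (c * d) *\<^sub>c x" "1 *\<^sub>c x = x"
    "(c *\<^sub>c x) * y = c *\<^sub>c (x * y)" "x * (c *\<^sub>c y) = c *\<^sub>c (x * y)"
    for c d and x y :: "'a dk"
    by (transfer; simp add: dk_eq_def ideal_gen.zero cscale_add_right cscale_add_left
        cscale_cscale cscale_one free_scale_mult)+
qed

end

lift_definition K :: "'n dk" is "gen GK" .
lift_definition Kb :: "'n dk" is "gen GKb" .
lift_definition \<xi> :: "'n \<Rightarrow> 'n dk" is "\<lambda>i. gen (GX i)" .
lift_definition \<xi>b :: "'n \<Rightarrow> 'n dk" is "\<lambda>i. gen (GXb i)" .

lemma dk_eq_relI: "r \<in> dk_rels \<Longrightarrow> f - g = r \<Longrightarrow> dk_eq f g"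
  by (simp add: dk_eq_def ideal_gen_base)

lemma dk_relations:
  "K * K = 1" "Kb * Kb = 1" "(K * Kb) * (K * Kb) = 1"
  "\<xi> i * \<xi> i = 0" "\<xi>b i * \<xi>b i = 0"
  "K * \<xi> i = - (\<xi> i * K)" "K * \<xi>b i = - (\<xi>b i * K)"
  "Kb * \<xi> i = - (\<xi> i * Kb)" "Kb * \<xi>b i = - (\<xi>b i * Kb)"
  "\<xi> i * \<xi> j = - (\<xi> j * \<xi> i)" "\<xi>b i * \<xi>b j = - (\<xi>b j * \<xi>b i)"
  "i \<noteq> j \<Longrightarrow> \<xi> i * \<xi>b j = - (\<xi>b j * \<xi> i)"
  "\<xi> i * \<xi>b i = 1 - K * Kb - \<xi>b i * \<xi> i"
proof -
  show "K * K = 1"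
    by (transfer, rule dk_eq_relI, rule dk_rels.intros(1)) simp
  show "Kb * Kb = 1"
    by (transfer, rule dk_eq_relI, rule dk_rels.intros(2)) simp
  show "(K * Kb) * (K * Kb) = 1"
    by (transfer, rule dk_eq_relI, rule dk_rels.intros(3)) simp
  show "\<xi> i * \<xi> i = 0"
    by (transfer, rule dk_eq_relI, rule dk_rels.intros(4)) simp
  show "\<xi>b i * \<xi>b i = 0"
    by (transfer, rule dk_eq_relI, rule dk_rels.intros(5)) simp
  show "K * \<xi> i = - (\<xi> i * K)"
    by (transfer, rule dk_eq_relI, rule dk_rels.intros(6)) simp
  show "K * \<xi>b i = - (\<xi>b i * K)"
    by (transfer, rule dk_eq_relI, rule dk_rels.intros(7)) simp
  show "Kb * \<xi> i = - (\<xi> i * Kb)"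
    by (transfer, rule dk_eq_relI, rule dk_rels.intros(8)) simp
  show "Kb * \<xi>b i = - (\<xi>b i * Kb)"
    by (transfer, rule dk_eq_relI, rule dk_rels.intros(9)) simp
  show "\<xi> i * \<xi> j = - (\<xi> j * \<xi> i)"
    by (transfer, rule dk_eq_relI, rule dk_rels.intros(10)) simp
  show "\<xi>b i * \<xi>b j = - (\<xi>b j * \<xi>b i)"
    by (transfer, rule dk_eq_relI, rule dk_rels.intros(11)) simp
  show "\<xi> i * \<xi>b j = - (\<xi>b j * \<xi> i)" if "i \<noteq> j"
    using that by (transfer, intro dk_eq_relI[OF dk_rels.intros(12)]) simp_all
  show "\<xi> i * \<xi>b i = 1 - K * Kb - \<xi>b i * \<xi> i"
    by (transfer, rule dk_eq_relI, rule dk_rels.intros(13)) simp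
qed


subsection \<open>Coproduct and antipode\<close>

lemma free_eval_ideal:
  assumes "\<And>r. r \<in> X \<Longrightarrow> free_eval \<phi> r = 0" "f - g \<in> ideal_gen X"
  shows "free_eval \<phi> f = free_eval \<phi> g"
proof -
  have "free_eval \<phi> (f - g) = 0" using assms(2)
    by induction (auto simp: assms(1) free_eval_mult clinear_add[OF clinear_free_eval(1)]
        clinear_0[OF clinear_free_eval(1)])
  then show ?thesis by (simp add: clinear_diff[OF clinear_free_eval(1)])
qed

lemma free_anti_eval_ideal:
  assumes "\<And>r. r \<in> X \<Longrightarrow> free_anti_eval \<phi> r = 0" "f - g \<in> ideal_gen X"
  shows "free_anti_eval \<phi> f = free_anti_eval \<phi> g"
proof -
  have "free_anti_eval \<phi> (f - g) = 0" using assms(2)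
    by induction (auto simp: assms(1) free_anti_eval_mult clinear_add[OF clinear_free_eval(2)]
        clinear_0[OF clinear_free_eval(2)])
  then show ?thesis by (simp add: clinear_diff[OF clinear_free_eval(2)])
qed

fun comult_gen :: "'n dk_gen \<Rightarrow> ('n dk, 'n dk) tensor" where
  "comult_gen GK = K \<otimes>\<^sub>c K"
| "comult_gen GKb = Kb \<otimes>\<^sub>c Kb"
| "comult_gen (GX i) = K \<otimes>\<^sub>c \<xi> i + \<xi> i \<otimes>\<^sub>c 1"
| "comult_gen (GXb i) = Kb \<otimes>\<^sub>c \<xi>b i + \<xi>b i \<otimes>\<^sub>c 1"

fun antipode_gen :: "'n dk_gen \<Rightarrow> 'n dk" where
  "antipode_gen GK = K"
| "antipode_gen GKb = Kb"
| "antipode_gen (GX i) = - (K * \<xi> i)"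
| "antipode_gen (GXb i) = - (Kb * \<xi>b i)"

lemma K_Kb_commute: "Kb * K = K * Kb"
proof -
  have "Kb * K = K * (K * Kb * (K * Kb)) * Kb"
    using dk_relations(1,2) by (metis mult.assoc mult.left_neutral mult.right_neutral)
  then show ?thesis by (simp add: dk_relations(3))
qed

lemmas dk_relations_ord = dk_relations(1,2,4-9) K_Kb_commute

lemma dk_relations_ord2:
  "K * (K * z) = z" "Kb * (Kb * z) = z" "\<xi> i * (\<xi> i * z) = 0" "\<xi>b i * (\<xi>b i * z) = 0"
  "K * (\<xi> i * z) = - (\<xi> i * (K * z))" "K * (\<xi>b i * z) = - (\<xi>b i * (K * z))"
  "Kb * (\<xi> i * z) = - (\<xi> i * (Kb * z))" "Kb * (\<xi>b i * z) = - (\<xi>b i * (Kb * z))"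
  "Kb * (K * z) = K * (Kb * z)"
  by (simp_all add: mult.assoc[symmetric] dk_relations_ord)

lemma free_eval_comult_rels:
  assumes "r \<in> dk_rels"
  shows "free_eval comult_gen r = 0"
proof -
  note simps = free_eval_mult free_eval_gen free_eval_one clinear_add[OF clinear_free_eval(1)]
    clinear_diff[OF clinear_free_eval(1)]
  note tsimps = distrib_left distrib_right tens_simps tens_diff tens_minus one_tensor_def mult.assoc
    dk_relations_ord dk_relations_ord2
  show ?thesis
    using assms
  proof cases
    case (10 i j)
    show ?thesis using dk_relations(10)[of i j] unfolding 10 by (simp add: simps tsimps)
  next
    case (11 i j)
    show ?thesis using dk_relations(11)[of i j] unfolding 11 by (simp add: simps tsimps)
  next
    case (12 i j)
    show ?thesis using dk_relations(12)[OF \<open>i \<noteq> j\<close>] unfolding 12 by (simp add: simps tsimps)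
  next
    case (13 i)
    show ?thesis unfolding 13 by (simp add: simps tsimps dk_relations(13))
  qed (simp_all add: simps tsimps)
qed

lemma free_anti_eval_antipode_rels:
  assumes "r \<in> dk_rels"
  shows "free_anti_eval antipode_gen r = 0"
proof -
  note simps = free_anti_eval_mult free_eval_gen free_eval_one clinear_add[OF clinear_free_eval(2)]
    clinear_diff[OF clinear_free_eval(2)]
  note dsimps = mult.assoc dk_relations_ord dk_relations_ord2
  show ?thesis
    using assms
  proof cases
    case (10 i j)
    show ?thesis using dk_relations(10)[of i j] unfolding 10 by (simp add: simps dsimps)
  next
    case (11 i j)
    show ?thesis using dk_relations(11)[of i j] unfolding 11 by (simp add: simps dsimps)
  next
    case (12 i j)
    have *: "\<xi> i * (\<xi>b j * z) = - (\<xi>b j * (\<xi> i * z))" for z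
      using dk_relations(12)[OF \<open>i \<noteq> j\<close>] by (simp add: mult.assoc[symmetric])
    show ?thesis unfolding 12 by (simp add: simps dsimps *)
  next
    case (13 i)
    have *: "\<xi> i * (\<xi>b i * z) = z - K * (Kb * z) - \<xi>b i * (\<xi> i * z)" for z
      using dk_relations(13)[of i] by (simp add: mult.assoc[symmetric] left_diff_distrib)
    show ?thesis unfolding 13 by (simp add: simps dsimps * algebra_simps)
  qed (simp_all add: simps dsimps)
qed

lift_definition comult :: "'n dk \<Rightarrow> ('n dk, 'n dk) tensor" is "free_eval comult_gen"
  unfolding dk_eq_def by (rule free_eval_ideal) (rule free_eval_comult_rels)

lift_definition antipode :: "'n dk \<Rightarrow> 'n dk" is "free_anti_eval antipode_gen"
  unfolding dk_eq_def by (rule free_anti_eval_ideal) (rule free_anti_eval_antipode_rels)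

lemma comult_hom:
  "clinear comult" "comult 1 = 1" "comult (x * y) = comult x * comult y"
  "comult K = K \<otimes>\<^sub>c K" "comult Kb = Kb \<otimes>\<^sub>c Kb"
  "comult (\<xi> i) = K \<otimes>\<^sub>c \<xi> i + \<xi> i \<otimes>\<^sub>c 1" "comult (\<xi>b i) = Kb \<otimes>\<^sub>c \<xi>b i + \<xi>b i \<otimes>\<^sub>c 1"
proof -
  show "clinear comult"
    by (rule clinearI; transfer)
      (simp_all add: clinear_add[OF clinear_free_eval(1)] clinear_scale[OF clinear_free_eval(1)])
qed (transfer; simp add: free_eval_one free_eval_mult free_eval_gen)+

lemma antipode_antihom:
  "clinear antipode" "antipode 1 = 1" "antipode (x * y) = antipode y * antipode x"
  "antipode K = K" "antipode Kb = Kb"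
  "antipode (\<xi> i) = - (K * \<xi> i)" "antipode (\<xi>b i) = - (Kb * \<xi>b i)"
proof -
  show "clinear antipode"
    by (rule clinearI; transfer)
      (simp_all add: clinear_add[OF clinear_free_eval(2)] clinear_scale[OF clinear_free_eval(2)])
qed (transfer; simp add: free_eval_one free_anti_eval_mult free_eval_gen)+


subsection \<open>R-matrix, ribbon element, integrals\<close>

text \<open>The words \<open>w\<close> in \<open>W\<close>, and their barred versions are indexed by their sets of letters.\<close>

definition \<xi>_word :: "'n::{finite,linorder} set \<Rightarrow> 'n dk" where
  "\<xi>_word A = prod_list (map \<xi> (sorted_list_of_set A))"

definition \<xi>b_word :: "'n::{finite,linorder} set \<Rightarrow> 'n dk" where
  "\<xi>b_word A = prod_list (map \<xi>b (sorted_list_of_set A))"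

definition Rmat :: "('n::{finite,linorder} dk, 'n dk) tensor" where
  "Rmat = (\<Sum>A\<in>UNIV. (-1) ^ (card A div 2) *\<^sub>c (\<xi>_word A \<otimes>\<^sub>c (\<xi>b_word A * Kb ^ card A)))
     * ((1/2) *\<^sub>c (1 \<otimes>\<^sub>c 1 + K \<otimes>\<^sub>c 1 + 1 \<otimes>\<^sub>c Kb - K \<otimes>\<^sub>c Kb))"

definition ribbon :: "'n::{finite,linorder} dk" where
  "ribbon = (1 + K - Kb + K * Kb)
     * (\<Sum>A\<in>UNIV. ((-1) ^ ((card A + 1) div 2) / 2) *\<^sub>c (\<xi>_word A * \<xi>b_word A))"

definition integral_elt :: "'n::{finite,linorder} dk" where
  "integral_elt = (1/2) *\<^sub>c ((1 + K + Kb + K * Kb) * \<xi>_word UNIV * \<xi>b_word UNIV)"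

definition pbw_basis :: "'n::{finite,linorder} dk set" where
  "pbw_basis = {K ^ a * Kb ^ b * \<xi>_word A * \<xi>b_word B | a b A B. a \<in> {0,1} \<and> b \<in> {0,1}}"

definition cointegral :: "'n::{finite,linorder} dk \<Rightarrow> complex" where
  "cointegral x = 2 * cvec.representation pbw_basis x (\<xi>_word UNIV * \<xi>b_word UNIV)"


subsection \<open>The projective action on the center\<close>

definition center :: "'a::calgebra set" where
  "center = {z. \<forall>x. z * x = x * z}"

definition alg_inverse :: "'a::calgebra \<Rightarrow> 'a" where
  "alg_inverse x = (THE y. x * y = 1 \<and> y * x = 1)"

definition S_LM :: "'n::{finite,linorder} dk \<Rightarrow> 'n dk" where
  "S_LM x = tlift (\<lambda>a b. cointegral b *\<^sub>c a)
     (alg_inverse Rmat * (1 \<otimes>\<^sub>c x) * alg_inverse (tflip Rmat))"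

definition T_LM :: "'n::{finite,linorder} dk \<Rightarrow> 'n dk" where
  "T_LM x = ribbon * x"

definition higman_map :: "'n::{finite,linorder} dk \<Rightarrow> 'n dk" where
  "higman_map x = tlift (\<lambda>a b. antipode b * x * a * alg_inverse K) (comult integral_elt)"

definition Hig :: "'n::{finite,linorder} dk set" where
  "Hig = range higman_map"

definition Z_\<Lambda> :: "'n::{finite,linorder} dk set" where
  "Z_\<Lambda> = cvec.span {(1 + K * Kb) * \<xi>_word A * \<xi>b_word B | A B. even (card A + card B)}"


section \<open>Representations of \<open>SL(2,\<int>)\<close>\<close>

definition SL2Z :: "(int^2^2) set" where
  "SL2Z = {g. det g = 1}"

definition sl2_s :: "int^2^2" where
  "sl2_s = vector [vector [0, -1], vector [1, 0]]"

definition sl2_t :: "int^2^2" where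
  "sl2_t = vector [vector [1, 1], vector [0, 1]]"

text \<open>A representation is given by a subspace of an ambient complex vector space together with
  the action on it.\<close>

type_synonym 'v rep = "'v set \<times> (int^2^2 \<Rightarrow> 'v \<Rightarrow> 'v)"

abbreviation rep_space :: "'v rep \<Rightarrow> 'v set" where "rep_space \<equiv> fst"
abbreviation rep_act :: "'v rep \<Rightarrow> int^2^2 \<Rightarrow> 'v \<Rightarrow> 'v" where "rep_act \<equiv> snd"

definition is_rep :: "'v::cvector rep \<Rightarrow> bool" where
  "is_rep M \<longleftrightarrow> cvec.subspace (rep_space M)
     \<and> (\<forall>g\<in>SL2Z. \<forall>v\<in>rep_space M. rep_act M g v \<in> rep_space M)
     \<and> (\<forall>g\<in>SL2Z. \<forall>u\<in>rep_space M. \<forall>v\<in>rep_space M. rep_act M g (u + v) = rep_act M g u + rep_act M g v)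
     \<and> (\<forall>g\<in>SL2Z. \<forall>c. \<forall>v\<in>rep_space M. rep_act M g (c *\<^sub>c v) = c *\<^sub>c rep_act M g v)
     \<and> (\<forall>v\<in>rep_space M. rep_act M (mat 1) v = v)
     \<and> (\<forall>g\<in>SL2Z. \<forall>h\<in>SL2Z. \<forall>v\<in>rep_space M. rep_act M (g ** h) v = rep_act M g (rep_act M h v))"

definition irreducible_rep :: "'v::cvector rep \<Rightarrow> bool" where
  "irreducible_rep M \<longleftrightarrow> is_rep M \<and> rep_space M \<noteq> {0}
     \<and> (\<forall>U. cvec.subspace U \<and> U \<subseteq> rep_space M \<and> (\<forall>g\<in>SL2Z. \<forall>v\<in>U. rep_act M g v \<in> U)
          \<longrightarrow> U = {0} \<or> U = rep_space M)"

text \<open>Reduction \<open>SL(2,\<int>) \<rightarrow> SL(2,\<int>/m)\<close> is onto, so a representation factors through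
  \<open>SL(2,\<int>/m)\<close> iff matrices congruent modulo \<open>m\<close> act equally.\<close>

definition factors_mod :: "int \<Rightarrow> 'v rep \<Rightarrow> bool" where
  "factors_mod m M \<longleftrightarrow> (\<forall>g\<in>SL2Z. \<forall>h\<in>SL2Z. (\<forall>i j. g $ i $ j mod m = h $ i $ j mod m)
     \<longrightarrow> (\<forall>v\<in>rep_space M. rep_act M g v = rep_act M h v))"

definition is_N1 :: "'v::cvector rep \<Rightarrow> bool" where
  "is_N1 M \<longleftrightarrow> irreducible_rep M \<and> cvec.dim (rep_space M) = 2 \<and> factors_mod 2 M"

definition triv_rep :: "complex rep" where
  "triv_rep = (UNIV, \<lambda>g z. z)"

definition std_rep :: "(complex^2) rep" where
  "std_rep = (UNIV, \<lambda>g v. map_matrix of_int g *v v)"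

text \<open>The \<open>k\<close>-th tensor power of \<^const>\<open>std_rep\<close> in coordinates: its vectors are the functions on
  the basis \<open>e\<^bsub>i\<^sub>1\<^esub> \<otimes> \<dots> \<otimes> e\<^bsub>i\<^sub>k\<^esub>\<close>, labelled by lists of length \<open>k\<close> and
  extended by \<open>0\<close> to all lists, and \<open>g\<close> acts by its \<open>k\<close>-fold Kronecker power.  For \<open>k = 0\<close> this
  is the trivial representation.\<close>

definition std_power :: "nat \<Rightarrow> (2 list \<Rightarrow> complex) rep" where
  "std_power k = ({f. \<forall>is. length is \<noteq> k \<longrightarrow> f is = 0},
     \<lambda>g f is. if length is = k
       then \<Sum>js | length js = k. (\<Prod>m<k. of_int (g $ (is ! m) $ (js ! m))) * f js else 0)"

lemma sum_lists_prod:
  fixes F :: "nat \<Rightarrow> 'a::finite \<Rightarrow> 'b::comm_semiring_1"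
  shows "(\<Sum>js | length js = k. \<Prod>m<k. F m (js ! m)) = (\<Prod>m<k. \<Sum>j\<in>UNIV. F m j)"
proof (induction k arbitrary: F)
  case 0
  have "{js :: 'a list. length js = 0} = {[]}" by auto
  then show ?case by simp
next
  case (Suc k)
  have eq: "{js :: 'a list. length js = Suc k} = (\<lambda>(j, js). j # js) ` (UNIV \<times> {js. length js = k})"
    by (force simp: length_Suc_conv)
  have inj: "inj_on (\<lambda>(j, js). j # js) (UNIV \<times> {js :: 'a list. length js = k})"
    by (auto simp: inj_on_def)
  have "(\<Sum>js | length js = Suc k. \<Prod>m<Suc k. F m (js ! m))
    = (\<Sum>(j, js)\<in>UNIV \<times> {js. length js = k}. F 0 j * (\<Prod>m<k. F (Suc m) (js ! m)))"
    unfolding eq sum.reindex[OF inj]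
    by (rule sum.cong) (auto simp: prod.lessThan_Suc_shift simp del: prod.lessThan_Suc)
  also have "\<dots> = (\<Sum>j\<in>UNIV. F 0 j) * (\<Sum>js | length js = k. \<Prod>m<k. F (Suc m) (js ! m))"
    by (simp add: sum.cartesian_product[symmetric] sum_product)
  also have "\<dots> = (\<Prod>m<Suc k. \<Sum>j\<in>UNIV. F m j)"
    by (simp add: Suc.IH[of "\<lambda>m. F (Suc m)"] prod.lessThan_Suc_shift del: prod.lessThan_Suc)
  finally show ?case .
qed

lemma std_power_pure_tensor:
  fixes v :: "nat \<Rightarrow> complex^2"
  shows "rep_act (std_power k) g (\<lambda>is. if length is = k then \<Prod>m<k. v m $ (is ! m) else 0)
    = (\<lambda>is. if length is = k then \<Prod>m<k. rep_act std_rep g (v m) $ (is ! m) else 0)"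
  by (auto simp: std_power_def std_rep_def matrix_vector_mult_def fun_eq_iff
      prod.distrib[symmetric] sum_lists_prod[symmetric])

definition rep_sum :: "'v rep \<Rightarrow> 'w rep \<Rightarrow> ('v \<times> 'w) rep" (infixr \<open>\<oplus>\<^sub>r\<close> 65) where
  "M \<oplus>\<^sub>r N = (rep_space M \<times> rep_space N, \<lambda>g. map_prod (rep_act M g) (rep_act N g))"

definition rep_Sum :: "'i set \<Rightarrow> ('i \<Rightarrow> 'v::zero rep) \<Rightarrow> ('i \<Rightarrow> 'v) rep" where
  "rep_Sum I M = ({f. (\<forall>i\<in>I. f i \<in> rep_space (M i)) \<and> (\<forall>i. i \<notin> I \<longrightarrow> f i = 0)},
     \<lambda>g f i. if i \<in> I then rep_act (M i) g (f i) else 0)"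

text \<open>\<open>U\<close> is a subspace of the center stable under the projective action, and as a projective
  representation it is isomorphic to \<open>M\<close>: the isomorphism intertwines the generators \<open>s\<close> and
  \<open>t\<close> up to one nonzero scalar each.\<close>

definition proj_decomposes_as :: "'n::{finite,linorder} dk set \<Rightarrow> 'v::cvector rep \<Rightarrow> bool" where
  "proj_decomposes_as U M \<longleftrightarrow>
     cvec.subspace U \<and> U \<subseteq> center \<and> S_LM ` U \<subseteq> U \<and> T_LM ` U \<subseteq> U
     \<and> (\<exists>\<phi> c d. clinear \<phi> \<and> bij_betw \<phi> U (rep_space M) \<and> c \<noteq> 0 \<and> d \<noteq> 0
          \<and> (\<forall>x\<in>U. \<phi> (S_LM x) = c *\<^sub>c rep_act M sl2_s (\<phi> x))
          \<and> (\<forall>x\<in>U. \<phi> (T_LM x) = d *\<^sub>c rep_act M sl2_t (\<phi> x)))"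

end

theory Submission
  imports Defs
begin

text \<open>
  The element \<open>K * Kb\<close> is central of order two.  Where it is \<open>1\<close> the algebra is an exterior algebra
  on all \<open>\<xi> i, \<xi>b i\<close> extended by \<open>K\<close>; where it is \<open>-1\<close> it is a Clifford algebra extended by \<open>K\<close>.
  The \<open>R\<close>-matrix is \<open>\<Prod>i. (1 + \<xi> i \<otimes> \<xi>b i Kb)\<close> times a group part, the ribbon element is a group part
  times \<open>\<Prod>i. (1 - \<xi> i \<xi>b i)\<close>, and the cointegral only sees the top coefficient at every site.  So on
  central elements that factor over the sites, both \<open>S_LM\<close> and \<open>T_LM\<close> act site by site.

  On \<open>Z_\<Lambda>\<close> a site contributes the span of \<open>- \<xi> i \<xi>b i\<close> and \<open>1\<close>, on which \<open>s\<close> and \<open>t\<close> act by their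
  defining matrices, and the two odd letters, which are fixed.  Choosing the \<open>k\<close> sites of the first
  kind and one of two odd letters at the others gives the multiplicity \<open>(n choose k) * 2 ^ (n - k)\<close>.

  The integral is a group part times \<open>\<Prod>i. \<xi> i \<xi>b i\<close>, so the Higman map is an iterated adjoint action
  over the sites, and its image is spanned by three elements: the exterior top element times \<open>K\<close>, the
  idempotent of the Clifford part, and the chirality element of the Clifford part.  Up to a scalar \<open>s\<close>
  exchanges the first two and \<open>t\<close> the last two, which is the permutation representation of \<open>S\<^sub>3\<close>.
\<close>

section \<open>Ordered products in a noncommutative ring\<close>

text \<open>The cointegral is a coordinate in a PBW basis, and coordinates make sense only once the
  PBW monomials are known to be independent. Four modules, one for each character of the group
  generated by \<open>K\<close> and \<open>Kb\<close>, supply this: a monomial sends the vacuum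
  vector of each module to a signed basis vector, and averaging over the characters separates the
  group parts.

  Products over sites are noncommutative, so they are ordered lists, and a site can be treated alone
  only if its factor commutes with the other sites. Two devices arrange this: a factor
  \<open>Kb\<close> attached to odd letters, which cancels when their number is even, and the
  idempotents \<open>eps h\<close>, in whose blocks \<open>Kb\<close> is \<open>K\<close> up to sign
  and the anticommutator at a site is the constant 0 or 2.

  Separating all \<open>\<xi>\<close> from all \<open>\<xi>b\<close> costs a sign. As
  \<open>s\<close> and \<open>t\<close> are matched only up to nonzero scalars, such signs are kept
  as an unknown \<open>c\<close> with \<open>c * c = 1\<close>.

  Under \<open>S_LM\<close> the two labels of a group part \<open>K ^ of_bool p * eps h\<close>
  trade places; with the rule for one site this settles where each basis element goes.\<close>

lemma prod_list_map_one: "prod_list (map (\<lambda>_. 1) xs) = (1 :: 'a::monoid_mult)"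
  by (induction xs) auto

lemma prod_list_map_commute:
  fixes f :: "'i \<Rightarrow> 'a::monoid_mult"
  assumes "\<And>j. j \<in> set xs \<Longrightarrow> y * f j = f j * y"
  shows "y * prod_list (map f xs) = prod_list (map f xs) * y"
  using assms
proof (induction xs)
  case (Cons a xs)
  have "y * (f a * prod_list (map f xs)) = f a * (y * prod_list (map f xs))"
    using Cons.prems[of a] by (simp add: mult.assoc[symmetric])
  then show ?case using Cons by (simp add: mult.assoc)
qed simp

lemma prod_list_map_twist:
  fixes f :: "'i \<Rightarrow> 'a::monoid_mult"
  assumes "\<And>j. j \<in> set xs \<Longrightarrow> y * f j = g j * y"
  shows "y * prod_list (map f xs) = prod_list (map g xs) * y"
  using assms
proof (induction xs)
  case (Cons a xs)
  have "y * (f a * prod_list (map f xs)) = g a * (y * prod_list (map f xs))"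
    using Cons.prems[of a] by (simp add: mult.assoc[symmetric])
  then show ?case using Cons by (simp add: mult.assoc)
qed simp

lemma prod_list_map_mult:
  fixes f g :: "'i \<Rightarrow> 'a::monoid_mult"
  assumes "distinct xs"
    and "\<And>i j. \<lbrakk>i \<in> set xs; j \<in> set xs; i \<noteq> j\<rbrakk> \<Longrightarrow> g i * f j = f j * g i"
  shows "prod_list (map f xs) * prod_list (map g xs) = prod_list (map (\<lambda>i. f i * g i) xs)"
  using assms
proof (induction xs)
  case (Cons a xs)
  have "g a * prod_list (map f xs) = prod_list (map f xs) * g a"
    by (rule prod_list_map_commute) (use Cons.prems in auto)
  then have "f a * prod_list (map f xs) * (g a * prod_list (map g xs))
      = f a * g a * (prod_list (map f xs) * prod_list (map g xs))"
    by (metis mult.assoc)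
  then show ?case using Cons by simp
qed simp

text \<open>Applied with a central idempotent as \<open>c\<close>, this allows identities that hold
  only in one block to be used in every factor.\<close>

lemma prod_list_map_cong_central:
  fixes f g :: "'i \<Rightarrow> 'a::monoid_mult"
  assumes "\<And>j. j \<in> set xs \<Longrightarrow> c * f j = f j * c" "\<And>j. j \<in> set xs \<Longrightarrow> c * f j = c * g j"
  shows "c * prod_list (map f xs) = c * prod_list (map g xs)"
  using assms
proof (induction xs)
  case (Cons a xs)
  have "c * (f a * prod_list (map f xs)) = f a * (c * prod_list (map f xs))"
    using Cons.prems(1)[of a] by (simp add: mult.assoc[symmetric])
  also have "\<dots> = f a * c * prod_list (map g xs)"
    using Cons by (simp add: mult.assoc)
  also have "\<dots> = c * g a * prod_list (map g xs)"
    using Cons.prems(1)[of a] Cons.prems(2)[of a] by simp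
  finally show ?case by (simp add: mult.assoc)
qed simp

text \<open>Each factor contributes 1 or \<open>g i\<close>, and \<open>filter\<close> keeps the
  chosen sites in order. This is how a sum over words is recognized as a product over sites.\<close>

lemma prod_list_map_one_plus:
  fixes g :: "'i \<Rightarrow> 'a::calgebra"
  assumes "distinct xs"
  shows "prod_list (map (\<lambda>i. 1 + g i) xs)
    = (\<Sum>A\<in>Pow (set xs). prod_list (map g (filter (\<lambda>i. i \<in> A) xs)))"
  using assms
proof (induction xs)
  case (Cons a xs)
  have inj: "inj_on (insert a) (Pow (set xs))"
    using Cons.prems by (auto simp: inj_on_def)
  have disj: "Pow (set xs) \<inter> insert a ` Pow (set xs) = {}"
    using Cons.prems by auto
  have 1: "filter (\<lambda>i. i \<in> A) (a # xs) = filter (\<lambda>i. i \<in> A) xs" if "A \<in> Pow (set xs)" for A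
    using Cons.prems that by auto
  have 2: "filter (\<lambda>i. i \<in> insert a A) (a # xs) = a # filter (\<lambda>i. i \<in> A) xs" for A
    using Cons.prems by (auto intro!: filter_cong)
  have 1: "(\<Sum>A\<in>Pow (set xs). prod_list (map g (filter (\<lambda>i. i \<in> A) (a # xs))))
      = (\<Sum>A\<in>Pow (set xs). prod_list (map g (filter (\<lambda>i. i \<in> A) xs)))"
    by (rule sum.cong) (use 1 in auto)
  show ?case
    using Cons
    by (simp add: Pow_insert sum.union_disjoint[OF _ _ disj] sum.reindex[OF inj] 1 2 o_def
        distrib_right sum_distrib_left sum.distrib cong: sum.cong del: filter.simps insert_iff)
qed simp

lemma prod_list_map_sum:
  fixes G :: "'i \<Rightarrow> 'l \<Rightarrow> 'a::calgebra"
  assumes "distinct xs"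
  shows "prod_list (map (\<lambda>i. \<Sum>l\<in>L. G i l) xs)
    = (\<Sum>\<sigma>\<in>PiE (set xs) (\<lambda>_. L). prod_list (map (\<lambda>i. G i (\<sigma> i)) xs))"
  using assms
proof (induction xs)
  case (Cons a xs)
  have inj: "inj_on (\<lambda>(l, \<sigma>). \<sigma>(a := l)) (L \<times> PiE (set xs) (\<lambda>_. L))"
    using Cons.prems by (intro inj_combinator) auto
  have eq: "map (\<lambda>i. G i ((\<sigma>(a := l)) i)) xs = map (\<lambda>i. G i (\<sigma> i)) xs" for \<sigma> :: "'i \<Rightarrow> 'l" and l
    using Cons.prems by (auto intro!: map_cong)
  have "(\<Sum>\<sigma>\<in>PiE (set (a # xs)) (\<lambda>_. L). prod_list (map (\<lambda>i. G i (\<sigma> i)) (a # xs)))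
     = (\<Sum>(l, \<sigma>)\<in>L \<times> PiE (set xs) (\<lambda>_. L). G a l * prod_list (map (\<lambda>i. G i (\<sigma> i)) xs))"
    unfolding list.set PiE_insert_eq sum.reindex[OF inj]
    by (intro sum.cong) (auto simp: eq[unfolded fun_upd_apply])
  then show ?case
    using Cons by (simp add: sum.cartesian_product[symmetric] sum_product)
qed simp

lemma prod_list_map_cscale:
  fixes F :: "'i \<Rightarrow> 'a::calgebra"
  assumes "distinct xs"
  shows "prod_list (map (\<lambda>i. c i *\<^sub>c F i) xs) = (\<Prod>i\<in>set xs. c i) *\<^sub>c prod_list (map F xs)"
  using assms
  by (induction xs) (auto simp: cscale_one cscale_mult_left cscale_mult_right cscale_cscale)

lemma prod_list_map_tens:
  fixes a :: "'i \<Rightarrow> 'a::calgebra" and b :: "'i \<Rightarrow> 'b::calgebra"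
  shows "prod_list (map (\<lambda>i. a i \<otimes>\<^sub>c b i) xs) = prod_list (map a xs) \<otimes>\<^sub>c prod_list (map b xs)"
  by (induction xs) (auto simp: one_tensor_def)

lemma prod_list_map_alg_hom:
  fixes h :: "'a::monoid_mult \<Rightarrow> 'b::monoid_mult"
  assumes "h 1 = 1" "\<And>x y. h (x * y) = h x * h y"
  shows "h (prod_list (map f xs)) = prod_list (map (\<lambda>i. h (f i)) xs)"
  by (induction xs) (auto simp: assms)


section \<open>Complex vector spaces\<close>

lemma cscale_two: "2 *\<^sub>c x = x + (x :: 'a::cvector)"
  using cscale_add_left[of 1 1 x] by (simp add: cscale_one)

lemma cscale_four: "4 *\<^sub>c x = x + (x + (x + (x :: 'a::cvector)))"
  using cscale_cscale[of 2 2 x] by (simp add: cscale_two add.assoc)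

lemma clinear_sum: "clinear f \<Longrightarrow> f (sum g A) = (\<Sum>i\<in>A. f (g i))"
  by (induction A rule: infinite_finite_induct) (auto simp: clinear_0 clinear_add)

lemma clinear_comp: "clinear f \<Longrightarrow> clinear g \<Longrightarrow> clinear (\<lambda>x. f (g x))"
  by (rule clinearI) (auto simp: clinear_add clinear_scale)

lemma clinear_eq_on_span:
  assumes "clinear f" "clinear g" "\<And>b. b \<in> B \<Longrightarrow> f b = g b" "x \<in> cvec.span B"
  shows "f x = g x"
  using assms(4)
  by (induction rule: cvec.span_induct_alt)
    (auto simp: assms(3) clinear_0 clinear_add clinear_scale assms(1,2))

lemma dual_family_independent:
  fixes v :: "'i \<Rightarrow> 'a::cvector"
  assumes lin: "\<And>i. clinear (\<psi> i :: 'a \<Rightarrow> complex)"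
    and dual: "\<And>i j. \<psi> i (v j) = (if i = j then 1 else 0)"
  shows "inj v" "cvec.independent (range v)"
proof -
  show inj: "inj v"
    by (rule injI) (metis dual zero_neq_one)
  show "cvec.independent (range v)"
    unfolding cvec.independent_explicit_module
  proof (intro allI impI)
    fix t u w assume t: "finite t" "t \<subseteq> range v" and s: "(\<Sum>w\<in>t. u w *\<^sub>c w) = 0" and w: "w \<in> t"
    obtain i where i: "w = v i" using t w by auto
    have "0 = \<psi> i (\<Sum>w\<in>t. u w *\<^sub>c w)" by (simp add: s clinear_0[OF lin])
    also have "\<dots> = (\<Sum>w\<in>t. u w * \<psi> i w)"
      by (simp add: clinear_sum[OF lin] clinear_scale[OF lin] cscale_complex_def)
    also have "\<dots> = (\<Sum>w'\<in>t. if w' = w then u w else 0)"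
    proof (rule sum.cong)
      fix w' assume "w' \<in> t"
      then obtain j where "w' = v j" using t by auto
      then show "u w' * \<psi> i w' = (if w' = w then u w else 0)"
        using injD[OF inj, of i j] by (auto simp: dual i)
    qed simp
    finally show "u w = 0" using t w by simp
  qed
qed

text \<open>The linear endomorphisms form a type, so that \<open>free_eval\<close> can take values
  in them: a module over the presented algebra is then given by naming operators for the generators
  and checking the relations.\<close>

typedef (overloaded) 'a cendo = "{f :: 'a::cvector \<Rightarrow> 'a. clinear f}"
  by (rule exI[of _ id]) (auto intro: clinearI)

setup_lifting type_definition_cendo

instantiation cendo :: (cvector) calgebra
begin

lift_definition zero_cendo :: "'a cendo" is "\<lambda>_. 0" by (rule clinearI) auto
lift_definition one_cendo :: "'a cendo" is "\<lambda>x. x" by (rule clinearI) auto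
lift_definition plus_cendo :: "'a cendo \<Rightarrow> 'a cendo \<Rightarrow> 'a cendo" is "\<lambda>f g x. f x + g x"
  by (rule clinearI) (auto simp: clinear_add clinear_scale cscale_add_right)
lift_definition minus_cendo :: "'a cendo \<Rightarrow> 'a cendo \<Rightarrow> 'a cendo" is "\<lambda>f g x. f x - g x"
  by (rule clinearI) (auto simp: clinear_add clinear_scale cvec.scale_right_diff_distrib)
lift_definition uminus_cendo :: "'a cendo \<Rightarrow> 'a cendo" is "\<lambda>f x. - f x"
  by (rule clinearI) (auto simp: clinear_add clinear_scale)
lift_definition times_cendo :: "'a cendo \<Rightarrow> 'a cendo \<Rightarrow> 'a cendo" is "\<lambda>f g x. f (g x)"
  by (rule clinear_comp)
lift_definition cscale_cendo :: "complex \<Rightarrow> 'a cendo \<Rightarrow> 'a cendo" is "\<lambda>c f x. c *\<^sub>c f x"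
  by (rule clinearI) (auto simp: clinear_add clinear_scale cscale_add_right cscale_cscale mult.commute)

instance
  by standard
    (transfer; force simp: fun_eq_iff cscale_add_right cscale_add_left cscale_cscale cscale_one
      clinear_add clinear_scale algebra_simps)+

end


section \<open>Creation and annihilation operators\<close>

text \<open>Operators on the exterior algebra of \<open>\<complex>\<^sup>X\<close>, whose elements are given by their coordinates
  in the basis of subsets of \<open>X\<close>; the injection \<open>r\<close> orders \<open>X\<close>.\<close>

definition sign_below :: "('x \<Rightarrow> nat) \<Rightarrow> 'x \<Rightarrow> 'x set \<Rightarrow> complex" where
  "sign_below r x S = (-1) ^ card {y \<in> S. r y < r x}"

lemma sign_below_insert:
  "finite S \<Longrightarrow> y \<notin> S \<Longrightarrow> sign_below r x (insert y S) = (if r y < r x then - 1 else 1) * sign_below r x S"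
proof -
  assume "finite S" "y \<notin> S"
  moreover have "{z \<in> insert y S. r z < r x} = (if r y < r x then insert y {z \<in> S. r z < r x} else {z \<in> S. r z < r x})"
    by auto
  ultimately show ?thesis by (auto simp: sign_below_def)
qed

lemma sign_below_square [simp]: "sign_below r x S * sign_below r x S = 1"
  by (simp add: sign_below_def power_mult_distrib[symmetric])

lemma sign_below_remove:
  "finite S \<Longrightarrow> y \<in> S \<Longrightarrow> sign_below r x (S - {y}) = (if r y < r x then - 1 else 1) * sign_below r x S"
  using sign_below_insert[of "S - {y}" y r x] by (auto simp: insert_absorb)

definition create :: "('x \<Rightarrow> nat) \<Rightarrow> 'x \<Rightarrow> ('x set \<Rightarrow> complex) \<Rightarrow> 'x set \<Rightarrow> complex" where
  "create r x f S = (if x \<in> S then sign_below r x S * f (S - {x}) else 0)"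

definition annihilate :: "('x \<Rightarrow> nat) \<Rightarrow> 'x \<Rightarrow> ('x set \<Rightarrow> complex) \<Rightarrow> 'x set \<Rightarrow> complex" where
  "annihilate r x f S = (if x \<notin> S then sign_below r x S * f (insert x S) else 0)"

definition parity :: "('x set \<Rightarrow> complex) \<Rightarrow> 'x set \<Rightarrow> complex" where
  "parity f S = (-1) ^ card S * f S"

lemma clinear_create: "clinear (create r x)"
  and clinear_annihilate: "clinear (annihilate r x)"
  and clinear_parity: "clinear parity"
  by (rule clinearI; force simp: create_def annihilate_def parity_def fun_eq_iff cscale_fun_def
      cscale_complex_def algebra_simps)+

text \<open>The canonical anticommutation relations. Acting with \<open>x\<close> and
  \<open>y\<close> in the two orders gives signs that differ by the factor -1 picked up by whichever
  of them has the larger rank, so distinct elements have to have distinct ranks.\<close>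

lemma create_annihilate:
  fixes f :: "'x::finite set \<Rightarrow> complex"
  assumes r: "inj r"
  shows "create r x (create r y f) + create r y (create r x f) = 0"
    and "annihilate r x (annihilate r y f) + annihilate r y (annihilate r x f) = 0"
    and "create r x (annihilate r y f) + annihilate r y (create r x f) = (if x = y then f else 0)"
proof -
  have tri: "x = y \<or> r x < r y \<or> r y < r x"
    using r by (metis injD linorder_neqE_nat)
  show "create r x (create r y f) + create r y (create r x f) = 0"
  proof (rule ext)
    fix S :: "'x set"
    have "S - {x} - {y} = S - {y} - {x}" by auto
    then have f: "f (S - {x} - {y}) = f (S - {y} - {x})" by (simp only:)
    have s: "sign_below r x (S - {y}) = (if r y < r x then - 1 else 1) * sign_below r x S"
      "sign_below r y (S - {x}) = (if r x < r y then - 1 else 1) * sign_below r y S"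
      if "x \<in> S" "y \<in> S"
      using that by (simp_all only: sign_below_remove finite)
    show "(create r x (create r y f) + create r y (create r x f)) S = 0 S"
    proof (cases "x \<in> S \<and> y \<in> S \<and> x \<noteq> y")
      case True
      then show ?thesis using tri s f
        by (simp add: create_def eq_commute[of y x], elim disjE) simp_all
    qed (auto simp: create_def)
  qed
  show "annihilate r x (annihilate r y f) + annihilate r y (annihilate r x f) = 0"
  proof (rule ext)
    fix S :: "'x set"
    have "insert x (insert y S) = insert y (insert x S)" by auto
    then show "(annihilate r x (annihilate r y f) + annihilate r y (annihilate r x f)) S = 0 S"
      using tri by (auto simp: annihilate_def sign_below_insert)
  qed
  show "create r x (annihilate r y f) + annihilate r y (create r x f) = (if x = y then f else 0)"
  proof (rule ext)
    fix S :: "'x set"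
    show "(create r x (annihilate r y f) + annihilate r y (create r x f)) S = (if x = y then f else 0) S"
    proof (cases "x = y")
      case True
      then show ?thesis
        by (cases "x \<in> S")
          (simp_all add: create_def annihilate_def sign_below_insert sign_below_remove insert_absorb
            mult.assoc[symmetric])
    next
      case False
      have f: "f (insert y S - {x}) = f (insert y (S - {x}))" using False by (simp add: insert_Diff_if)
      have s: "sign_below r x (insert y S) = (if r y < r x then - 1 else 1) * sign_below r x S"
        "sign_below r y (S - {x}) = (if r x < r y then - 1 else 1) * sign_below r y S"
        if "x \<in> S" "y \<notin> S"
        using that by (simp_all only: sign_below_remove sign_below_insert finite not_False_eq_True)
      show ?thesis
      proof (cases "x \<in> S \<and> y \<notin> S")
        case True
        then show ?thesis using tri False s f
          by (simp add: create_def annihilate_def, elim disjE) simp_all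
      qed (use False in \<open>auto simp: create_def annihilate_def\<close>)
    qed
  qed
qed

lemma parity_simps:
  fixes f :: "'x::finite set \<Rightarrow> complex"
  shows "parity (parity f) = f"
    and "parity (create r x f) = - create r x (parity f)"
    and "parity (annihilate r x f) = - annihilate r x (parity f)"
proof -
  show "parity (parity f) = f"
    by (auto simp: parity_def fun_eq_iff mult.assoc[symmetric] power_mult_distrib[symmetric])
  show "parity (create r x f) = - create r x (parity f)"
  proof (rule ext)
    fix S :: "'x set"
    have "(-1) ^ card S = - ((-1) ^ card (S - {x}) :: complex)" if "x \<in> S"
      using that by (subst card.remove[of S x]) (simp_all del: card_Diff_singleton)
    then show "parity (create r x f) S = (- create r x (parity f)) S"
      by (cases "x \<in> S") (simp_all add: parity_def create_def del: card_Diff_singleton)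
  qed
  show "parity (annihilate r x f) = - annihilate r x (parity f)"
    by (auto simp: parity_def annihilate_def fun_eq_iff)
qed

definition ket :: "'x set \<Rightarrow> 'x set \<Rightarrow> complex" where
  "ket S = (\<lambda>T. if T = S then 1 else 0)"

lemma create_ket: "x \<notin> S \<Longrightarrow> create r x (ket S) = sign_below r x (insert x S) *\<^sub>c ket (insert x S)"
  by (auto simp: create_def ket_def fun_eq_iff cscale_fun_def cscale_complex_def)

lemma annihilate_ket: "x \<notin> S \<Longrightarrow> annihilate r x (ket S) = 0"
  by (auto simp: annihilate_def ket_def fun_eq_iff)

lemma parity_ket: "parity (ket S) = (-1) ^ card S *\<^sub>c ket S"
  by (auto simp: parity_def ket_def fun_eq_iff cscale_fun_def cscale_complex_def)

section \<open>The regular module and the PBW basis\<close>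

lift_definition create_op :: "('x \<Rightarrow> nat) \<Rightarrow> 'x \<Rightarrow> ('x set \<Rightarrow> complex) cendo" is create
  by (rule clinear_create)
lift_definition annihilate_op :: "('x \<Rightarrow> nat) \<Rightarrow> 'x \<Rightarrow> ('x set \<Rightarrow> complex) cendo" is annihilate
  by (rule clinear_annihilate)
lift_definition parity_op :: "('x set \<Rightarrow> complex) cendo" is parity
  by (rule clinear_parity)

lemma create_annihilate_op:
  fixes r :: "'x::finite \<Rightarrow> nat"
  assumes "inj r"
  shows "create_op r x * create_op r y = - (create_op r y * create_op r x)"
    and "annihilate_op r x * annihilate_op r y = - (annihilate_op r y * annihilate_op r x)"
    and "create_op r x * annihilate_op r y
      = (if x = y then 1 else 0) - annihilate_op r y * create_op r x"
  unfolding eq_neg_iff_add_eq_0 eq_diff_eq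
  using create_annihilate[OF assms, of x y]
  by (simp_all add: Rep_cendo_inject[symmetric] fun_eq_iff[where 'b = "'x set \<Rightarrow> complex"]
      times_cendo.rep_eq plus_cendo.rep_eq zero_cendo.rep_eq one_cendo.rep_eq
      create_op.rep_eq annihilate_op.rep_eq)

lemma parity_op_simps:
  "parity_op * parity_op = (1 :: ('x::finite set \<Rightarrow> complex) cendo)"
  "parity_op * create_op r x = - (create_op (r :: 'x \<Rightarrow> nat) x * parity_op)"
  "parity_op * annihilate_op r x = - (annihilate_op (r :: 'x \<Rightarrow> nat) x * parity_op)"
  by (simp_all add: Rep_cendo_inject[symmetric] fun_eq_iff[where 'b = "'x set \<Rightarrow> complex"]
      times_cendo.rep_eq uminus_cendo.rep_eq one_cendo.rep_eq
      create_op.rep_eq annihilate_op.rep_eq parity_op.rep_eq parity_simps)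

section \<open>Four Fock modules and the coordinates they define\<close>

definition op_rank :: "'x::finite \<Rightarrow> nat" where
  "op_rank = (SOME r. inj r)"

lemma inj_op_rank: "inj (op_rank :: 'x::finite \<Rightarrow> nat)"
  unfolding op_rank_def by (rule someI_ex[of inj]) (use finite_imp_inj_to_nat_seg[of "UNIV :: 'x set"] in auto)

text \<open>The sign by which a group element of order two, switched on or off by \<open>p\<close>, acts in the
  character \<open>a\<close>.\<close>

definition char_sign :: "bool \<Rightarrow> bool \<Rightarrow> complex" where
  "char_sign a p = (if a \<and> p then - 1 else 1)"

text \<open>\<open>K * Kb\<close> acts by the scalar
  \<open>char_sign a True * char_sign b True\<close>, because the parity operator squares to the
  identity. The annihilation part of \<open>\<xi>b i\<close> is scaled by one minus this scalar, so
  that its anticommutator with creation at \<open>Inl i\<close> is \<open>1 - K * Kb\<close>: this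
  is 0 if \<open>a = b\<close> and 2 otherwise.\<close>

fun rep_gen :: "bool \<Rightarrow> bool \<Rightarrow> 'n::finite dk_gen \<Rightarrow> (('n + 'n) set \<Rightarrow> complex) cendo" where
  "rep_gen a b GK = char_sign a True *\<^sub>c parity_op"
| "rep_gen a b GKb = char_sign b True *\<^sub>c parity_op"
| "rep_gen a b (GX i) = create_op op_rank (Inl i)"
| "rep_gen a b (GXb i) = create_op op_rank (Inr i)
    + (1 - char_sign a True * char_sign b True) *\<^sub>c annihilate_op op_rank (Inl i)"

lemma free_eval_rep_rels:
  assumes "r \<in> dk_rels"
  shows "free_eval (rep_gen a b) r = (0 :: (('n::finite + 'n) set \<Rightarrow> complex) cendo)"
proof -
  note simps = free_eval_mult free_eval_gen free_eval_one clinear_add[OF clinear_free_eval(1)]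
    clinear_diff[OF clinear_free_eval(1)]
  note ca = create_annihilate_op[OF inj_op_rank[where 'x = "'n + 'n"]]
  have sq: "create_op op_rank x * create_op op_rank x = (0 :: (('n + 'n) set \<Rightarrow> complex) cendo)"
    "annihilate_op op_rank x * annihilate_op op_rank x = (0 :: (('n + 'n) set \<Rightarrow> complex) cendo)" for x
  proof -
    have *: "z = 0" if "z = - z" for z :: "(('n + 'n) set \<Rightarrow> complex) cendo"
    proof -
      have "(2::complex) *\<^sub>c z = z + z" by (simp add: cscale_add_left[of 1 1 z, simplified] cscale_one)
      also have "\<dots> = 0" using that by (metis add.right_inverse)
      finally show ?thesis by simp
    qed
    show "create_op op_rank x * create_op op_rank x = (0 :: (('n + 'n) set \<Rightarrow> complex) cendo)"
      by (rule *) (rule ca)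
    show "annihilate_op op_rank x * annihilate_op op_rank x = (0 :: (('n + 'n) set \<Rightarrow> complex) cendo)"
      by (rule *) (rule ca)
  qed
  note tsimps = distrib_left distrib_right cscale_mult_left cscale_mult_right cscale_cscale
    cscale_add_right parity_op_simps cscale_one char_sign_def sq
  show ?thesis
    using assms
  proof cases
    case (3)
    show ?thesis unfolding 3
      by (simp add: simps tsimps)
  next
    case (5 i)
    show ?thesis unfolding 5
      using ca(3)[of "Inr i" "Inl i"] by (simp add: simps tsimps)
  next
    case (10 i j)
    show ?thesis unfolding 10 using ca(1)[of "Inl i" "Inl j"] by (simp add: simps tsimps)
  next
    case (11 i j)
    show ?thesis unfolding 11
      using ca(1)[of "Inr i" "Inr j"] ca(2)[of "Inl i" "Inl j"]
        ca(3)[of "Inr i" "Inl j"] ca(3)[of "Inr j" "Inl i"]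
      by (simp add: simps tsimps cvec.scale_right_diff_distrib)
  next
    case (12 i j)
    show ?thesis unfolding 12
      using ca(1)[of "Inl i" "Inr j"] ca(3)[of "Inl i" "Inl j"] \<open>i \<noteq> j\<close>
      by (simp add: simps tsimps)
  next
    case (13 i)
    show ?thesis unfolding 13
      using ca(1)[of "Inl i" "Inr i"] ca(3)[of "Inl i" "Inl i"]
      by (simp add: simps tsimps cvec.scale_right_diff_distrib cvec.scale_left_diff_distrib)
  qed (simp_all add: simps tsimps)
qed

lift_definition dk_rep :: "bool \<Rightarrow> bool \<Rightarrow> 'n::finite dk \<Rightarrow> (('n + 'n) set \<Rightarrow> complex) cendo"
  is "\<lambda>a b. free_eval (rep_gen a b)"
  unfolding dk_eq_def by (rule free_eval_ideal) (rule free_eval_rep_rels)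

lemma dk_rep_hom:
  "clinear (dk_rep a b)" "dk_rep a b 1 = 1" "dk_rep a b (x * y) = dk_rep a b x * dk_rep a b y"
  "dk_rep a b K = char_sign a True *\<^sub>c parity_op" "dk_rep a b Kb = char_sign b True *\<^sub>c parity_op"
  "dk_rep a b (\<xi> i) = create_op op_rank (Inl i)"
  "dk_rep a b (\<xi>b i) = create_op op_rank (Inr i)
    + (1 - char_sign a True * char_sign b True) *\<^sub>c annihilate_op op_rank (Inl i)"
proof -
  show "clinear (dk_rep a b)"
    by (rule clinearI; transfer)
      (simp_all add: clinear_add[OF clinear_free_eval(1)] clinear_scale[OF clinear_free_eval(1)])
qed (transfer; simp add: free_eval_one free_eval_mult free_eval_gen)+

text \<open>The element applied to the vacuum \<open>ket {}\<close>. Taken over all \<open>a\<close>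
  and \<open>b\<close>, these vectors determine \<open>x\<close>; \<open>pbw_coeff\<close> recovers
  its coordinates from them.\<close>

definition vac :: "bool \<Rightarrow> bool \<Rightarrow> 'n::finite dk \<Rightarrow> ('n + 'n) set \<Rightarrow> complex" where
  "vac a b x = Rep_cendo (dk_rep a b x) (ket {})"

lemma clinear_vac: "clinear (vac a b)"
  by (rule clinearI)
    (simp_all add: vac_def clinear_add[OF dk_rep_hom(1)] clinear_scale[OF dk_rep_hom(1)]
      plus_cendo.rep_eq cscale_cendo.rep_eq)

lemma vac_mult:
  "vac a b 1 = ket {}"
  "vac a b (K * x) = char_sign a True *\<^sub>c parity (vac a b x)"
  "vac a b (Kb * x) = char_sign b True *\<^sub>c parity (vac a b x)"
  "vac a b (\<xi> i * x) = create op_rank (Inl i) (vac a b x)"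
  "vac a b (\<xi>b i * x) = create op_rank (Inr i) (vac a b x)
    + (1 - char_sign a True * char_sign b True) *\<^sub>c annihilate op_rank (Inl i) (vac a b x)"
  by (simp_all add: vac_def dk_rep_hom times_cendo.rep_eq one_cendo.rep_eq cscale_cendo.rep_eq
      parity_op.rep_eq create_op.rep_eq annihilate_op.rep_eq plus_cendo.rep_eq)

text \<open>The letter \<open>Inl a\<close> is the vector \<open>e\<^sub>a\<close> of a copy of the standard representation
  spanned by \<open>- \<xi> i * \<xi>b i\<close> and \<open>1\<close>; the letters \<open>Inr _\<close> are the odd ones.\<close>

fun letter :: "'n \<Rightarrow> 2 + bool \<Rightarrow> 'n dk" where
  "letter i (Inl a) = (if a = 1 then - (\<xi> i * \<xi>b i) else 1)"
| "letter i (Inr b) = (if b then \<xi>b i else \<xi> i)"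

lemma letter_cases [case_names one two xi xib]:
  fixes l :: "2 + bool"
  assumes "l = Inl 1 \<Longrightarrow> P" "l = Inl 2 \<Longrightarrow> P" "l = Inr False \<Longrightarrow> P" "l = Inr True \<Longrightarrow> P"
  shows P
  using assms exhaust_2 by (cases l) (metis (full_types))+

lemma sum_letters:
  fixes g :: "2 + bool \<Rightarrow> 'a::comm_monoid_add"
  shows "(\<Sum>l\<in>UNIV. g l) = g (Inl 1) + g (Inl 2) + g (Inr False) + g (Inr True)"
proof -
  have *: "(UNIV :: (2 + bool) set) = {Inl 1, Inl 2, Inr False, Inr True}"
    by (auto intro: letter_cases)
  show ?thesis unfolding * by (simp add: add.assoc)
qed

definition sites :: "'n::{finite,linorder} list" where
  "sites = sorted_list_of_set UNIV"

lemma sites [simp]: "distinct sites" "set sites = UNIV"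
  by (simp_all add: sites_def)

abbreviation word :: "'n list \<Rightarrow> ('n \<Rightarrow> 2 + bool) \<Rightarrow> 'n dk" where
  "word xs \<sigma> \<equiv> prod_list (map (\<lambda>i. letter i (\<sigma> i)) xs)"

abbreviation monomial :: "('n::{finite,linorder} \<Rightarrow> 2 + bool) \<Rightarrow> 'n dk" where
  "monomial \<equiv> word sites"

text \<open>Letters are interleaved site by site instead of putting all \<open>\<xi>\<close> before
  all \<open>\<xi>b\<close>. This keeps each site together and differs from the members of
  \<open>pbw_basis\<close> only by signs.\<close>

definition pbw :: "bool \<Rightarrow> bool \<Rightarrow> ('n::{finite,linorder} \<Rightarrow> 2 + bool) \<Rightarrow> 'n dk" where
  "pbw p q \<sigma> = K ^ of_bool p * Kb ^ of_bool q * monomial \<sigma>"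

fun letter_set :: "'n \<Rightarrow> 2 + bool \<Rightarrow> ('n + 'n) set" where
  "letter_set i (Inl a) = (if a = 1 then {Inl i, Inr i} else {})"
| "letter_set i (Inr b) = (if b then {Inr i} else {Inl i})"

abbreviation support :: "('n \<Rightarrow> 2 + bool) \<Rightarrow> ('n + 'n) set" where
  "support \<sigma> \<equiv> (\<Union>i. letter_set i (\<sigma> i))"

lemma inj_support: "inj support"
proof (rule injI, rule ext)
  fix \<sigma> \<tau> :: "'n \<Rightarrow> 2 + bool" and i assume eq: "support \<sigma> = support \<tau>"
  have *: "letter_set i (\<rho> i) = support \<rho> \<inter> {Inl i, Inr i}" for \<rho> :: "'n \<Rightarrow> 2 + bool"
  proof -
    have "x \<in> letter_set j (\<rho> j) \<Longrightarrow> x \<in> {Inl j, Inr j}" for j x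
      by (rule letter_cases[of "\<rho> j"]) auto
    moreover have "x \<in> letter_set j (\<rho> j) \<Longrightarrow> x \<in> {Inl i, Inr i} \<Longrightarrow> j = i" for j x
      using calculation[of x j] by auto
    ultimately show ?thesis by blast
  qed
  have "letter_set i (\<sigma> i) = letter_set i (\<tau> i)"
    by (simp add: * eq)
  then show "\<sigma> i = \<tau> i"
    by (cases "\<sigma> i" rule: letter_cases; cases "\<tau> i" rule: letter_cases) auto
qed

text \<open>Each letter meets a basis vector that avoids both modes of its site, so the annihilation
  part of \<open>\<xi>b i\<close> contributes nothing. What remains is a creation sign, and it is
  the same in all four modules, as the averaging in \<open>pbw_coeff\<close> requires.\<close>

lemma vac_word:
  assumes "distinct xs"
  obtains c where "c * c = 1"
    and "\<And>a b. vac a b (word xs \<sigma>) = c *\<^sub>c ket (\<Union>i\<in>set xs. letter_set i (\<sigma> i))"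
proof -
  have "\<exists>c. c * c = 1 \<and> (\<forall>a b. vac a b (word xs \<sigma>) = c *\<^sub>c ket (\<Union>i\<in>set xs. letter_set i (\<sigma> i)))"
    using assms
  proof (induction xs)
    case Nil
    show ?case by (rule exI[of _ 1]) (simp add: vac_mult cscale_one)
  next
    case (Cons i xs)
    define S where "S = (\<Union>i\<in>set xs. letter_set i (\<sigma> i))"
    obtain c where c: "c * c = 1" "\<And>a b. vac a b (word xs \<sigma>) = c *\<^sub>c ket S"
      using Cons S_def by auto
    have "x \<in> letter_set j (\<sigma> j) \<Longrightarrow> x \<in> {Inl j, Inr j}" for j x
      by (rule letter_cases[of "\<sigma> j"]) auto
    then have iS: "Inl i \<notin> S" "Inr i \<notin> S"
      using Cons.prems by (fastforce simp: S_def)+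
    have 1: "vac a b (\<xi> i * word xs \<sigma>) = (c * sign_below op_rank (Inl i) (insert (Inl i) S)) *\<^sub>c ket (insert (Inl i) S)" for a b
      by (simp add: vac_mult c clinear_scale[OF clinear_create] create_ket iS cscale_cscale)
    have 2: "vac a b (\<xi>b i * word xs \<sigma>) = (c * sign_below op_rank (Inr i) (insert (Inr i) S)) *\<^sub>c ket (insert (Inr i) S)" for a b
      by (simp add: vac_mult c clinear_scale[OF clinear_create] clinear_scale[OF clinear_annihilate]
          create_ket annihilate_ket iS cscale_cscale)
    have 3: "vac a b (\<xi> i * (\<xi>b i * word xs \<sigma>)) = (c * sign_below op_rank (Inr i) (insert (Inr i) S)
        * sign_below op_rank (Inl i) (insert (Inl i) (insert (Inr i) S))) *\<^sub>c ket (insert (Inl i) (insert (Inr i) S))" for a b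
      unfolding vac_mult(4) 2
      by (simp add: clinear_scale[OF clinear_create] create_ket iS cscale_cscale)
    have sq: "(c * s) * (c * s) = 1" if "s * s = 1" for s
    proof -
      have "(c * s) * (c * s) = (c * c) * (s * s)" by (simp only: mult_ac)
      then show ?thesis by (simp add: c that)
    qed
    show ?case
    proof (cases "\<sigma> i" rule: letter_cases)
      case one
      define e where "e = c * sign_below op_rank (Inr i) (insert (Inr i) S)
        * sign_below op_rank (Inl i) (insert (Inl i) (insert (Inr i) S))"
      have "e * e = (c * c) * (sign_below op_rank (Inr i) (insert (Inr i) S) * sign_below op_rank (Inr i) (insert (Inr i) S))
        * (sign_below op_rank (Inl i) (insert (Inl i) (insert (Inr i) S)) * sign_below op_rank (Inl i) (insert (Inl i) (insert (Inr i) S)))"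
        unfolding e_def by (simp only: mult_ac)
      then have "e * e = 1" by (simp add: c)
      then show ?thesis
        by (intro exI[of _ "- e"])
          (simp add: one 3[folded e_def] mult.assoc clinear_neg[OF clinear_vac] S_def[symmetric])
    next
      case two
      then show ?thesis using c by (intro exI[of _ c]) (simp add: S_def)
    next
      case xi
      then show ?thesis using sq[OF sign_below_square]
        by (intro exI[of _ "c * sign_below op_rank (Inl i) (insert (Inl i) S)"]) (simp add: 1 S_def[symmetric])
    next
      case xib
      then show ?thesis using sq[OF sign_below_square]
        by (intro exI[of _ "c * sign_below op_rank (Inr i) (insert (Inr i) S)"]) (simp add: 2 S_def[symmetric])
    qed
  qed
  then show ?thesis using that by blast
qed

text \<open>Fourier inversion on the group generated by \<open>K\<close> and \<open>Kb\<close>: the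
  sum over the characters with the factor 1/4 isolates the group part, evaluation at
  \<open>support \<sigma>\<close> isolates the word, and the last factor, a sign, cancels the sign
  with which the module produces that basis vector.\<close>

definition pbw_coeff :: "bool \<Rightarrow> bool \<Rightarrow> ('n::{finite,linorder} \<Rightarrow> 2 + bool) \<Rightarrow> 'n dk \<Rightarrow> complex" where
  "pbw_coeff p q \<sigma> x = (\<Sum>a\<in>UNIV. \<Sum>b\<in>UNIV. char_sign a p * char_sign b q * vac a b x (support \<sigma>))
     * vac False False (pbw p q \<sigma>) (support \<sigma>) / 4"

lemma clinear_pbw_coeff:
  fixes \<sigma> :: "'n::{finite,linorder} \<Rightarrow> 2 + bool"
  shows "clinear (pbw_coeff p q \<sigma>)"
proof -
  have *: "clinear (\<lambda>x. vac a b x S)" for a b and S :: "('n + 'n) set"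
    by (rule clinearI) (simp_all add: clinear_add[OF clinear_vac] clinear_scale[OF clinear_vac] cscale_fun_def)
  show ?thesis
    unfolding pbw_coeff_def
    by (rule clinearI)
      (simp_all add: clinear_add[OF *] clinear_scale[OF *] cscale_complex_def UNIV_bool algebra_simps add_divide_distrib)
qed

lemma pbw_coeff_pbw:
  "pbw_coeff p q \<sigma> (pbw p' q' \<tau>) = (if p = p' \<and> q = q' \<and> \<sigma> = \<tau> then 1 else 0)"
proof -
  obtain c where c: "c * c = 1" "\<And>a b. vac a b (monomial \<tau>) = c *\<^sub>c ket (support \<tau>)"
    using vac_word[of sites \<tau>] by auto
  define d :: complex where "d = (-1) ^ card (support \<tau>)"
  have d: "d * d = 1" by (simp add: d_def power_mult_distrib[symmetric])
  \<comment> \<open>\<open>K\<close> and \<open>Kb\<close> each act by the parity operator up to a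
    character, so the parity \<open>d\<close> of the support enters exactly when one of the two is
    present without the other.\<close>
  have vac_pow: "vac a b (pbw p q \<tau>)
      = (char_sign a p * char_sign b q * (if p = q then 1 else d) * c) *\<^sub>c ket (support \<tau>)" for a b p q
    by (cases p; cases q) (simp_all add: pbw_def mult.assoc vac_mult c parity_ket parity_simps
        clinear_scale[OF clinear_parity] cscale_cscale char_sign_def mult_ac d_def[symmetric] d)
  show ?thesis
  proof (cases "\<sigma> = \<tau>")
    case False
    then have "support \<sigma> \<noteq> support \<tau>" by (simp add: inj_eq[OF inj_support])
    then show ?thesis using False
      by (simp add: pbw_coeff_def vac_pow ket_def cscale_fun_def cscale_complex_def)
  next
    case True
    have sq: "c * (c * z) = z" "d * (d * z) = z" for z
      by (simp_all add: c d mult.assoc[symmetric])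
    have v: "vac a b (pbw p q \<tau>) (support \<sigma>) = char_sign a p * char_sign b q * (if p = q then 1 else d) * c" for a b p q
      by (simp add: vac_pow True ket_def cscale_fun_def cscale_complex_def)
    show ?thesis
      unfolding pbw_coeff_def True v[unfolded True] UNIV_bool
      by (cases p; cases q; cases p'; cases q') (simp_all add: char_sign_def sq mult_ac c d)
  qed
qed

section \<open>Spanning: bringing products into site order\<close>

lemma dk_induct [case_names one K Kb xi xib add scale]:
  assumes "P 1"
    and "\<And>x. P x \<Longrightarrow> P (K * x)" "\<And>x. P x \<Longrightarrow> P (Kb * x)"
    and "\<And>i x. P x \<Longrightarrow> P (\<xi> i * x)" "\<And>i x. P x \<Longrightarrow> P (\<xi>b i * x)"
    and "\<And>x y. P x \<Longrightarrow> P y \<Longrightarrow> P (x + y)" "\<And>c x. P x \<Longrightarrow> P (c *\<^sub>c x)"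
  shows "P (x :: 'n dk)"
proof (induction x rule: dk.abs_induct)
  case (1 f)
  have word: "P (abs_dk (Poly_Mapping.single w 1))" for w :: "'n dk_gen list"
  proof (induction w)
    case Nil
    have "abs_dk (Poly_Mapping.single [] 1) = (1 :: 'n dk)"
      by (simp add: one_dk.abs_eq single_one[symmetric] zero_list_def)
    then show ?case using assms(1) by simp
  next
    case (Cons g w)
    have "abs_dk (Poly_Mapping.single (g # w) 1) = abs_dk (gen g) * abs_dk (Poly_Mapping.single w 1)"
      by (simp add: times_dk.abs_eq mult_single plus_list_def)
    then show ?case
      using assms(2-5)[OF Cons]
      by (cases g) (auto simp: K.abs_eq[symmetric] Kb.abs_eq[symmetric] \<xi>.abs_eq[symmetric] \<xi>b.abs_eq[symmetric])
  qed
  show ?case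
  proof (induction f rule: free_induct)
    case zero
    have "abs_dk (0 :: 'n dk_gen list \<Rightarrow>\<^sub>0 complex) = 0 *\<^sub>c 1" by (simp add: zero_dk.abs_eq)
    then show ?case using assms(7)[OF assms(1), of 0] by (simp only:)
  next
    case (single k c)
    have "Poly_Mapping.single k c = c *\<^sub>c Poly_Mapping.single k 1"
      by (rule poly_mapping_eqI) (auto simp: lookup_single when_def cscale_complex_def)
    then have "abs_dk (Poly_Mapping.single k c) = c *\<^sub>c abs_dk (Poly_Mapping.single k 1)"
      by (simp add: cscale_dk.abs_eq)
    then show ?case using assms(7)[OF word] by simp
  next
    case (add f g)
    then show ?case using assms(6) by (simp add: plus_dk.abs_eq[symmetric])
  qed
qed

lemma center_dkI:
  assumes "z * K = K * z" "z * Kb = Kb * z" "\<And>i. z * \<xi> i = \<xi> i * z" "\<And>i. z * \<xi>b i = \<xi>b i * z"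
  shows "z \<in> center"
proof -
  have "z * x = x * z" for x
  proof (induction x rule: dk_induct)
    case (K x) then show ?case by (metis assms(1) mult.assoc)
  next
    case (Kb x) then show ?case by (metis assms(2) mult.assoc)
  next
    case (xi i x) then show ?case by (metis assms(3) mult.assoc)
  next
    case (xib i x) then show ?case by (metis assms(4) mult.assoc)
  qed (simp_all add: distrib_left distrib_right cscale_mult_left cscale_mult_right)
  then show ?thesis by (simp add: center_def)
qed

lemma \<xi>b_\<xi>: "\<xi>b i * \<xi> i = 1 - K * Kb - \<xi> i * \<xi>b i"
  by (simp add: dk_relations(13))

lemma \<xi>b_\<xi>_left: "\<xi>b i * (\<xi> i * z) = z - K * (Kb * z) - \<xi> i * (\<xi>b i * z)"
  by (simp add: mult.assoc[symmetric] \<xi>b_\<xi> left_diff_distrib)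

text \<open>Rewrites products of the generators of one site to the order \<open>\<xi>, \<xi>b, K, Kb\<close>.\<close>

lemmas dk_site = dk_relations_ord(1-8) K_Kb_commute dk_relations_ord2 \<xi>b_\<xi> \<xi>b_\<xi>_left mult.assoc

lemma dk_other_site:
  assumes "i \<noteq> j"
  shows "\<xi> i * \<xi>b j = - (\<xi>b j * \<xi> i)" "\<xi> i * (\<xi>b j * z) = - (\<xi>b j * (\<xi> i * z))"
    "\<xi> i * \<xi> j = - (\<xi> j * \<xi> i)" "\<xi> i * (\<xi> j * z) = - (\<xi> j * (\<xi> i * z))"
    "\<xi>b i * \<xi>b j = - (\<xi>b j * \<xi>b i)" "\<xi>b i * (\<xi>b j * z) = - (\<xi>b j * (\<xi>b i * z))"
    "\<xi>b i * \<xi> j = - (\<xi> j * \<xi>b i)" "\<xi>b i * (\<xi> j * z) = - (\<xi> j * (\<xi>b i * z))"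
proof -
  show 1: "\<xi> i * \<xi>b j = - (\<xi>b j * \<xi> i)" "\<xi> i * \<xi> j = - (\<xi> j * \<xi> i)" "\<xi>b i * \<xi>b j = - (\<xi>b j * \<xi>b i)"
    by (rule dk_relations; fact)+
  show 2: "\<xi>b i * \<xi> j = - (\<xi> j * \<xi>b i)" using dk_relations(12)[of j i] assms by simp
  show "\<xi> i * (\<xi>b j * z) = - (\<xi>b j * (\<xi> i * z))" "\<xi> i * (\<xi> j * z) = - (\<xi> j * (\<xi> i * z))"
    "\<xi>b i * (\<xi>b j * z) = - (\<xi>b j * (\<xi>b i * z))" "\<xi>b i * (\<xi> j * z) = - (\<xi> j * (\<xi>b i * z))"
    by (simp_all add: mult.assoc[symmetric] 1 2)
qed

definition parity_sign :: "2 + bool \<Rightarrow> complex" where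
  "parity_sign l = (if isl l then 1 else - 1)"

lemma parity_sign_square [simp]: "parity_sign l * parity_sign l = 1"
  by (simp add: parity_sign_def)

lemma letter_group:
  "K * letter i l = parity_sign l *\<^sub>c (letter i l * K)"
  "Kb * letter i l = parity_sign l *\<^sub>c (letter i l * Kb)"
  by (cases l rule: letter_cases; simp add: parity_sign_def dk_site cscale_one)+

lemma letter_other_site:
  assumes "i \<noteq> j"
  shows "\<xi> i * letter j l = parity_sign l *\<^sub>c (letter j l * \<xi> i)"
    "\<xi>b i * letter j l = parity_sign l *\<^sub>c (letter j l * \<xi>b i)"
  by (cases l rule: letter_cases; simp add: parity_sign_def mult.assoc dk_other_site[OF assms] cscale_one)+

lemma move_past_word:
  assumes "\<And>j. j \<in> set xs \<Longrightarrow> y * letter j (\<sigma> j) = parity_sign (\<sigma> j) *\<^sub>c (letter j (\<sigma> j) * y)"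
  shows "y * word xs \<sigma> = (\<Prod>l\<leftarrow>map \<sigma> xs. parity_sign l) *\<^sub>c (word xs \<sigma> * y)"
  using assms
proof (induction xs)
  case (Cons a xs)
  have "y * (letter a (\<sigma> a) * word xs \<sigma>) = (y * letter a (\<sigma> a)) * word xs \<sigma>"
    by (simp add: mult.assoc)
  also have "\<dots> = parity_sign (\<sigma> a) *\<^sub>c (letter a (\<sigma> a) * (y * word xs \<sigma>))"
    using Cons.prems[of a] by (simp add: cscale_mult_left mult.assoc)
  finally show ?case using Cons by (simp add: cscale_mult_right cscale_cscale mult.assoc)
qed (simp add: cscale_one)

lemma prod_list_parity_sign_square: "prod_list (map parity_sign ls) * prod_list (map parity_sign ls) = 1"
proof (induction ls)
  case (Cons l ls)
  have "parity_sign l * p * (parity_sign l * p) = (parity_sign l * parity_sign l) * (p * p)" for p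
    by (simp only: mult_ac)
  from this[of "prod_list (map parity_sign ls)"] show ?case
    by (simp only: list.map prod_list.Cons Cons.IH parity_sign_square mult_1_left)
qed simp

lemma group_word:
  "K * word xs \<sigma> = prod_list (map parity_sign (map \<sigma> xs)) *\<^sub>c (word xs \<sigma> * K)"
  "Kb * word xs \<sigma> = prod_list (map parity_sign (map \<sigma> xs)) *\<^sub>c (word xs \<sigma> * Kb)"
  by (rule move_past_word, rule letter_group)+

lemma word_cong: "(\<And>i. i \<in> set xs \<Longrightarrow> \<sigma> i = \<tau> i) \<Longrightarrow> word xs \<sigma> = word xs \<tau>"
  by (metis (no_types, lifting) map_eq_conv)

lemma word_one: "word xs (\<lambda>_. Inl 2) = 1"
  by (induction xs) auto

text \<open>Bringing \<open>\<xi>b i * \<xi> i\<close> into order creates no group element except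
  \<open>K * Kb\<close>, which commutes with all letters. Allowing this one factor makes the span
  stable under the generators at the sites of \<open>xs\<close>.\<close>

definition word_span :: "'n list \<Rightarrow> 'n dk set" where
  "word_span xs = cvec.span {(K * Kb) ^ of_bool q * word xs \<tau> | q \<tau>. True}"

lemma word_span_letter:
  assumes "i \<notin> set xs" "x \<in> word_span xs"
  shows "letter i l * x \<in> word_span (i # xs)"
  using assms(2) unfolding word_span_def
proof (induction rule: cvec.span_induct_alt)
  case base show ?case by (simp add: cvec.span_zero)
next
  case (step c b y)
  obtain q \<tau> where b: "b = (K * Kb) ^ of_bool q * word xs \<tau>" using step by auto
  have "letter i l * b = (K * Kb) ^ of_bool q * word (i # xs) (\<tau>(i := l))"
  proof -
    have "word xs (\<tau>(i := l)) = word xs \<tau>"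
      using assms(1) by (intro word_cong) auto
    moreover have "letter i l * (K * Kb) = K * Kb * letter i l"
      by (cases l rule: letter_cases) (simp_all add: dk_site)
    then have "letter i l * ((K * Kb) * z) = K * Kb * (letter i l * z)" for z
      by (simp only: mult.assoc[symmetric])
    ultimately show ?thesis by (cases q) (simp_all add: b mult.assoc)
  qed
  then have "letter i l * b \<in> cvec.span {(K * Kb) ^ of_bool q * word (i # xs) \<tau> | q \<tau>. True}"
    by (intro cvec.span_base) blast
  then show ?case using step
    by (simp add: distrib_left cscale_mult_right cvec.span_add cvec.span_scale)
qed

lemma word_span_base: "word xs \<tau> \<in> word_span xs" "K * (Kb * word xs \<tau>) \<in> word_span xs"
proof -
  have "(K * Kb) ^ of_bool q * word xs \<tau> \<in> word_span xs" for q
    unfolding word_span_def by (rule cvec.span_base) auto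
  from this[of False] this[of True]
  show "word xs \<tau> \<in> word_span xs" "K * (Kb * word xs \<tau>) \<in> word_span xs"
    by (simp_all add: mult.assoc)
qed

text \<open>By induction along the list: at a different site the generator passes the letter with a
  sign, and at its own site its product with the letter is again a combination of letters, possibly
  times \<open>K * Kb\<close>.\<close>

lemma generator_word_in_word_span:
  assumes "distinct xs" "i \<in> set xs"
  shows "\<xi> i * word xs \<sigma> \<in> word_span xs" "\<xi>b i * word xs \<sigma> \<in> word_span xs"
proof -
  have "\<xi> i * word xs \<sigma> \<in> word_span xs \<and> \<xi>b i * word xs \<sigma> \<in> word_span xs"
    using assms
  proof (induction xs)
    case (Cons a xs)
    show ?case
    proof (cases "i = a")
      case True
      have upd: "word (a # xs) (\<sigma>(a := l)) = letter a l * word xs \<sigma>" for l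
      proof -
        have "word xs (\<sigma>(a := l)) = word xs \<sigma>"
          using Cons.prems by (intro word_cong) auto
        then show ?thesis by simp
      qed
      have mem: "letter a l * word xs \<sigma> \<in> word_span (a # xs)"
        "K * (Kb * (letter a l * word xs \<sigma>)) \<in> word_span (a # xs)" for l
        using word_span_base[where xs = "a # xs" and \<tau> = "\<sigma>(a := l)"] unfolding upd by auto
      note mem' = mem[of "Inl 1"] mem[of "Inl 2"] mem[of "Inr False"] mem[of "Inr True"]
      have neg: "- x \<in> word_span ys \<longleftrightarrow> x \<in> word_span ys" for x and ys :: "'a list"
        unfolding word_span_def using cvec.span_neg[of x] cvec.span_neg[of "- x"] by auto
      have d: "x - y \<in> word_span ys" if "x \<in> word_span ys" "y \<in> word_span ys" for x y and ys :: "'a list"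
        using that unfolding word_span_def by (rule cvec.span_diff)
      have z: "0 \<in> word_span ys" for ys :: "'a list"
        unfolding word_span_def by (rule cvec.span_zero)
      show ?thesis
        using mem' unfolding True
        by (cases "\<sigma> a" rule: letter_cases) (simp_all add: dk_site neg z d)
    next
      case False
      have "y * word (a # xs) \<sigma> = parity_sign (\<sigma> a) *\<^sub>c (letter a (\<sigma> a) * (y * word xs \<sigma>))"
        if "y * letter a (\<sigma> a) = parity_sign (\<sigma> a) *\<^sub>c (letter a (\<sigma> a) * y)" for y
        by (simp add: mult.assoc[symmetric] that cscale_mult_left)
      from this[OF letter_other_site(1)[OF False]] this[OF letter_other_site(2)[OF False]]
      show ?thesis
        using Cons False word_span_letter[of a xs _ "\<sigma> a"]
        by (simp add: word_span_def cvec.span_scale)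
    qed
  qed simp
  then show "\<xi> i * word xs \<sigma> \<in> word_span xs" "\<xi>b i * word xs \<sigma> \<in> word_span xs" by auto
qed

text \<open>The span contains 1 and is stable under left multiplication by all four kinds of
  generators.\<close>

lemma span_pbw:
  "cvec.span (range (\<lambda>(p, q, \<sigma>). pbw p q \<sigma>)) = (UNIV :: 'n::{finite,linorder} dk set)"
proof -
  let ?B = "range (\<lambda>(p, q, \<sigma>). pbw p q \<sigma> :: 'n dk)"
  let ?W = "cvec.span ?B"
  have base: "pbw p q \<sigma> \<in> ?W" for p q \<sigma>
    by (rule cvec.span_base) (rule image_eqI[of _ _ "(p, q, \<sigma>)"], auto)
  have KW: "K * x \<in> ?W" if "x \<in> ?W" for x
    using that
  proof (induction rule: cvec.span_induct_alt)
    case (step c b y)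
    obtain p q \<sigma> where b: "b = pbw p q \<sigma>" using step by auto
    have "K * b = pbw (\<not> p) q \<sigma>" by (cases p) (simp_all add: b pbw_def mult.assoc dk_site)
    then show ?case using step base[of "\<not> p" q \<sigma>]
      by (simp add: distrib_left cscale_mult_right cvec.span_add cvec.span_scale)
  qed (simp add: cvec.span_zero)
  have KbW: "Kb * x \<in> ?W" if "x \<in> ?W" for x
    using that
  proof (induction rule: cvec.span_induct_alt)
    case (step c b y)
    obtain p q \<sigma> where b: "b = pbw p q \<sigma>" using step by auto
    have "Kb * b = pbw p (\<not> q) \<sigma>" by (cases p; cases q) (simp_all add: b pbw_def mult.assoc dk_site)
    then show ?case using step base[of p "\<not> q" \<sigma>]
      by (simp add: distrib_left cscale_mult_right cvec.span_add cvec.span_scale)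
  qed (simp add: cvec.span_zero)
  have word_spanW: "word_span sites \<subseteq> ?W"
    unfolding word_span_def
  proof (rule cvec.span_minimal)
    show "{(K * Kb) ^ of_bool q * monomial \<tau> | q \<tau>. True} \<subseteq> ?W"
    proof safe
      fix q and \<tau> :: "'n \<Rightarrow> 2 + bool"
      show "(K * Kb) ^ of_bool q * monomial \<tau> \<in> ?W"
        using base[of q q \<tau>] by (cases q) (simp_all add: pbw_def)
    qed
  qed (rule cvec.subspace_span)
  \<comment> \<open>An odd generator anticommutes with \<open>K\<close> and \<open>Kb\<close>, so it
    can be moved behind the group part, where only its product with a monomial matters.\<close>
  have genW: "y * x \<in> ?W" if "x \<in> ?W" "\<And>z. K * (y * z) = - (y * (K * z))" "\<And>z. Kb * (y * z) = - (y * (Kb * z))"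
    "\<And>\<sigma>. y * monomial \<sigma> \<in> ?W" for y x
    using that(1)
  proof (induction rule: cvec.span_induct_alt)
    case (step c b x)
    obtain p q \<sigma> where b: "b = pbw p q \<sigma>" using step by auto
    have "y * (K * z) = - (K * (y * z))" "y * (Kb * z) = - (Kb * (y * z))" for z
      by (simp_all add: that)
    then have "y * b \<in> ?W"
      using that(4)[of \<sigma>] KW[of "y * monomial \<sigma>"] KbW[of "y * monomial \<sigma>"] KW[of "Kb * (y * monomial \<sigma>)"]
      by (cases p; cases q) (simp_all add: b pbw_def mult.assoc cvec.span_neg)
    then show ?case using step by (simp add: distrib_left cscale_mult_right cvec.span_add cvec.span_scale)
  qed (simp add: cvec.span_zero)
  have "x \<in> ?W" for x
  proof (induction x rule: dk_induct)
    case one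
    have "pbw False False (\<lambda>_. Inl 2) = (1 :: 'n dk)"
      by (simp only: pbw_def word_one) simp
    then show ?case using base[of False False "\<lambda>_. Inl 2"] by simp
  next
    case (xi i x)
    show ?case
      by (rule genW[OF xi]) (use generator_word_in_word_span[of sites i] word_spanW in \<open>auto simp: dk_site\<close>)
  next
    case (xib i x)
    show ?case
      by (rule genW[OF xib]) (use generator_word_in_word_span[of sites i] word_spanW in \<open>auto simp: dk_site\<close>)
  qed (auto intro: KW KbW cvec.span_add cvec.span_scale)
  then show ?thesis by blast
qed

section \<open>From site monomials to the given basis and its cointegral\<close>

lemma sorted_list_of_set_filter_sites:
  "sorted_list_of_set A = filter (\<lambda>i. i \<in> A) (sites :: 'n::{finite,linorder} list)"
proof -
  have "sorted_list_of_set (set (filter (\<lambda>i. i \<in> A) (sites :: 'n list))) = filter (\<lambda>i. i \<in> A) sites"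
    by (intro sorted_list_of_set.idem_if_sorted_distinct)
      (simp_all add: sites_def sorted_wrt_filter del: set_filter)
  then show ?thesis by (simp add: Collect_mem_eq)
qed

lemma \<xi>b_past_word:
  assumes "i \<notin> set ys"
  shows "\<xi>b i * prod_list (map \<xi> ys) = (-1) ^ length ys *\<^sub>c (prod_list (map \<xi> ys) * \<xi>b i)"
  using assms
proof (induction ys)
  case (Cons j ys)
  then have "\<xi>b i * (\<xi> j * z) = - (\<xi> j * (\<xi>b i * z))" for z
    by (intro dk_other_site) auto
  then show ?case using Cons by (simp add: mult.assoc cscale_mult_right)
qed (simp add: cscale_one)

definition \<xi>_sites :: "('n \<Rightarrow> 2 + bool) \<Rightarrow> 'n set" where
  "\<xi>_sites \<sigma> = {i. \<sigma> i \<in> {Inl 1, Inr False}}"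

definition \<xi>b_sites :: "('n \<Rightarrow> 2 + bool) \<Rightarrow> 'n set" where
  "\<xi>b_sites \<sigma> = {i. \<sigma> i \<in> {Inl 1, Inr True}}"

definition letters_of :: "'n set \<Rightarrow> 'n set \<Rightarrow> 'n \<Rightarrow> 2 + bool" where
  "letters_of A B i = (if i \<in> A then if i \<in> B then Inl 1 else Inr False
     else if i \<in> B then Inr True else Inl 2)"

lemma letters_of_inverse [simp]:
  "\<xi>_sites (letters_of A B) = A" "\<xi>b_sites (letters_of A B) = B"
  "letters_of (\<xi>_sites \<sigma>) (\<xi>b_sites \<sigma>) = \<sigma>"
proof -
  show "\<xi>_sites (letters_of A B) = A" "\<xi>b_sites (letters_of A B) = B"
    by (auto simp: \<xi>_sites_def \<xi>b_sites_def letters_of_def)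
  show "letters_of (\<xi>_sites \<sigma>) (\<xi>b_sites \<sigma>) = \<sigma>"
  proof
    fix i show "letters_of (\<xi>_sites \<sigma>) (\<xi>b_sites \<sigma>) i = \<sigma> i"
      by (cases "\<sigma> i" rule: letter_cases) (simp_all add: \<xi>_sites_def \<xi>b_sites_def letters_of_def)
  qed
qed

text \<open>Sorting the letters moves \<open>\<xi>b\<close> past \<open>\<xi>\<close> at other
  sites, which changes only the sign. The sign is left unevaluated: spans, intertwiners and the
  cointegral need it only up to a nonzero factor.\<close>

lemma word_eq_\<xi>_\<xi>b:
  assumes "distinct xs"
  shows "\<exists>c. c * c = 1 \<and> word xs \<sigma> = c *\<^sub>c
    (prod_list (map \<xi> (filter (\<lambda>i. i \<in> \<xi>_sites \<sigma>) xs)) * prod_list (map \<xi>b (filter (\<lambda>i. i \<in> \<xi>b_sites \<sigma>) xs)))"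
  using assms
proof (induction xs)
  case Nil
  show ?case by (rule exI[of _ 1]) (simp add: cscale_one)
next
  case (Cons a xs)
  let ?X = "prod_list (map \<xi> (filter (\<lambda>i. i \<in> \<xi>_sites \<sigma>) xs))"
  let ?Y = "prod_list (map \<xi>b (filter (\<lambda>i. i \<in> \<xi>b_sites \<sigma>) xs))"
  define d :: complex where "d = (-1) ^ length (filter (\<lambda>i. i \<in> \<xi>_sites \<sigma>) xs)"
  obtain c where c: "c * c = 1" "word xs \<sigma> = c *\<^sub>c (?X * ?Y)" using Cons by auto
  have d: "d * d = 1" by (simp add: d_def power_mult_distrib[symmetric])
  have b: "\<xi>b a * ?X = d *\<^sub>c (?X * \<xi>b a)"
    unfolding d_def by (rule \<xi>b_past_word) (use Cons.prems in auto)
  have b': "\<xi>b a * (?X * ?Y) = d *\<^sub>c (?X * (\<xi>b a * ?Y))"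
    by (simp add: mult.assoc[symmetric] b cscale_mult_left)
  have sq: "(c * d) * (c * d) = 1"
  proof -
    have "(c * d) * (c * d) = (c * c) * (d * d)" by (simp only: mult_ac)
    then show ?thesis by (simp add: c d)
  qed
  have pm: "a \<in> \<xi>_sites \<sigma> \<longleftrightarrow> \<sigma> a = Inl 1 \<or> \<sigma> a = Inr False" "a \<in> \<xi>b_sites \<sigma> \<longleftrightarrow> \<sigma> a = Inl 1 \<or> \<sigma> a = Inr True"
    by (auto simp: \<xi>_sites_def \<xi>b_sites_def)
  show ?case
  proof (cases "\<sigma> a" rule: letter_cases)
    case one
    show ?thesis using sq
      by (intro exI[of _ "- (c * d)"]) (simp add: pm one c b' mult.assoc cscale_mult_right cscale_cscale)
  next
    case two
    show ?thesis using c by (intro exI[of _ c]) (simp add: pm two)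
  next
    case xi
    show ?thesis using c by (intro exI[of _ c]) (simp add: pm xi cscale_mult_right mult.assoc)
  next
    case xib
    show ?thesis using sq
      by (intro exI[of _ "c * d"]) (simp add: pm xib c b' mult.assoc cscale_mult_right cscale_cscale)
  qed
qed

lemma \<xi>_word_sites: "\<xi>_word A = prod_list (map \<xi> (filter (\<lambda>i. i \<in> A) sites))"
  and \<xi>b_word_sites: "\<xi>b_word A = prod_list (map \<xi>b (filter (\<lambda>i. i \<in> A) sites))"
  by (simp_all add: \<xi>_word_def \<xi>b_word_def sorted_list_of_set_filter_sites)

lemma words_eq_monomial:
  fixes A :: "'n::{finite,linorder} set"
  obtains c where "c * c = 1" "\<xi>_word A * \<xi>b_word B = c *\<^sub>c monomial (letters_of A B)"
proof -
  obtain c where c: "c * c = 1" "monomial (letters_of A B) = c *\<^sub>c (\<xi>_word A * \<xi>b_word B)"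
    using word_eq_\<xi>_\<xi>b[of "sites :: 'n list" "letters_of A B"]
    by (auto simp: \<xi>_word_sites \<xi>b_word_sites)
  have "\<xi>_word A * \<xi>b_word B = c *\<^sub>c monomial (letters_of A B)"
    by (simp add: c cscale_cscale cscale_one)
  then show ?thesis using that c by blast
qed

definition pbw_words :: "bool \<times> bool \<times> 'n set \<times> 'n set \<Rightarrow> 'n::{finite,linorder} dk" where
  "pbw_words = (\<lambda>(p, q, A, B). K ^ of_bool p * Kb ^ of_bool q * \<xi>_word A * \<xi>b_word B)"

lemma range_pbw_words: "range pbw_words = (pbw_basis :: 'n::{finite,linorder} dk set)"
proof (intro equalityI subsetI)
  fix x :: "'n dk" assume "x \<in> range pbw_words"
  then obtain i where "x = pbw_words i" by blast
  moreover obtain p q A B where "i = (p, q, A, B)" by (metis prod_cases4)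
  ultimately have "x = K ^ of_bool p * Kb ^ of_bool q * \<xi>_word A * \<xi>b_word B"
    by (simp only: pbw_words_def prod.case)
  moreover have "of_bool p \<in> {0, 1::nat}" "of_bool q \<in> {0, 1::nat}" by auto
  ultimately show "x \<in> pbw_basis" unfolding pbw_basis_def by blast
next
  fix x :: "'n dk" assume "x \<in> pbw_basis"
  then obtain a b A B where "x = K ^ a * Kb ^ b * \<xi>_word A * \<xi>b_word B" and ab: "a \<in> {0,1}" "b \<in> {0,1}"
    by (auto simp: pbw_basis_def)
  moreover have "of_bool (a = 1) = a" "of_bool (b = 1) = b" using ab by auto
  ultimately have "x = pbw_words (a = 1, b = 1, A, B)"
    by (simp only: pbw_words_def prod.case)
  then show "x \<in> range pbw_words" by (rule range_eqI)
qed

text \<open>Its value is 2 or -2 according to the sign of reordering all letters; half of it becomes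
  the projective scalar of \<open>s\<close>.\<close>

definition top_value :: "'n::{finite,linorder} itself \<Rightarrow> complex" where
  "top_value _ = cointegral (monomial (\<lambda>_. Inl 1) :: 'n dk)"

text \<open>\<open>cvec.representation\<close> yields coordinates only for an independent set, so
  the independence of \<open>pbw_basis\<close> comes first. It follows from the dual functionals
  \<open>pbw_coeff\<close>, transported from site monomials to pairs of words by the signs
  \<open>c A B\<close>.\<close>

lemma cointegral_pbw:
  shows "clinear (cointegral :: 'n::{finite,linorder} dk \<Rightarrow> complex)"
    and "cointegral (pbw p q (\<sigma> :: 'n \<Rightarrow> _)) = (if \<not> p \<and> \<not> q \<and> \<sigma> = (\<lambda>_. Inl 1) then top_value TYPE('n) else 0)"
    and "top_value TYPE('n) \<noteq> 0"
proof -
  have "\<forall>A B. \<exists>c. c * c = 1 \<and> \<xi>_word A * \<xi>b_word B = c *\<^sub>c (monomial (letters_of A B) :: 'n dk)"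
  proof (intro allI)
    fix A B :: "'n set"
    show "\<exists>c. c * c = 1 \<and> \<xi>_word A * \<xi>b_word B = c *\<^sub>c (monomial (letters_of A B) :: 'n dk)"
      by (rule words_eq_monomial[of A B]) blast
  qed
  then obtain c :: "'n set \<Rightarrow> 'n set \<Rightarrow> complex" where c: "c A B * c A B = 1"
    "\<xi>_word A * \<xi>b_word B = c A B *\<^sub>c (monomial (letters_of A B) :: 'n dk)" for A B
    by metis
  have v: "pbw_words (p, q, A, B) = c A B *\<^sub>c pbw p q (letters_of A B)" for p q A B
    by (simp add: pbw_words_def pbw_def c mult.assoc cscale_mult_right)
  \<comment> \<open>Each \<open>c A B\<close> is its own inverse, so the same factor rescales the
    basis vector and its dual functional.\<close>
  define \<psi> where "\<psi> = (\<lambda>(p, q, A, B) x. c A B * pbw_coeff p q (letters_of A B) (x :: 'n dk))"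
  have lin: "clinear (\<psi> i)" for i
    unfolding \<psi>_def
    by (rule clinearI) (auto simp: case_prod_unfold clinear_add[OF clinear_pbw_coeff]
        clinear_scale[OF clinear_pbw_coeff] cscale_complex_def distrib_left)
  have inj_lo: "letters_of A B = letters_of A' B' \<longleftrightarrow> A = A' \<and> B = B'" for A B A' B' :: "'n set"
    using letters_of_inverse(1,2)[of A B] letters_of_inverse(1,2)[of A' B'] by metis
  have dual: "\<psi> i (pbw_words j) = (if i = j then 1 else 0)" for i j
    by (cases i; cases j)
      (auto simp: \<psi>_def v clinear_scale[OF clinear_pbw_coeff] pbw_coeff_pbw cscale_complex_def inj_lo c)
  note inj = dual_family_independent(1)[of \<psi> pbw_words, OF lin dual]
  have indep: "cvec.independent (pbw_basis :: 'n dk set)"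
    using dual_family_independent(2)[of \<psi> pbw_words, OF lin dual] by (simp add: range_pbw_words)
  have pbw_eq: "pbw p q \<sigma> = c (\<xi>_sites \<sigma>) (\<xi>b_sites \<sigma>) *\<^sub>c pbw_words (p, q, \<xi>_sites \<sigma>, \<xi>b_sites \<sigma>)" for p q \<sigma>
    by (simp add: v cscale_cscale c cscale_one)
  have mem: "pbw_words i \<in> pbw_basis" for i :: "bool \<times> bool \<times> 'n set \<times> 'n set"
    unfolding range_pbw_words[symmetric] by simp
  have span: "cvec.span pbw_basis = (UNIV :: 'n dk set)"
  proof -
    have "range (\<lambda>(p, q, \<sigma>). pbw p q \<sigma> :: 'n dk) \<subseteq> cvec.span pbw_basis"
      unfolding pbw_eq using mem by (auto intro!: cvec.span_scale intro: cvec.span_base)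
    then show ?thesis using cvec.span_minimal[OF _ cvec.subspace_span] span_pbw by blast
  qed
  show lin: "clinear (cointegral :: 'n dk \<Rightarrow> complex)"
    unfolding cointegral_def
    by (rule clinearI) (auto simp: cvec.representation_add[OF indep] cvec.representation_scale[OF indep]
        span cscale_complex_def distrib_left)
  have top: "\<xi>_word UNIV * \<xi>b_word UNIV = (pbw_words (False, False, UNIV, UNIV) :: 'n dk)"
    by (simp add: pbw_words_def)
  have val: "cointegral (pbw p q \<sigma>) = (if (p, q, \<xi>_sites \<sigma>, \<xi>b_sites \<sigma>) = (False, False, UNIV, UNIV)
      then 2 * c UNIV UNIV else 0)" for p q and \<sigma> :: "'n \<Rightarrow> _"
    by (simp add: cointegral_def top pbw_eq cvec.representation_scale[OF indep] span
        cvec.representation_basis[OF indep mem] inj_eq[OF inj])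
  have lo: "\<xi>_sites \<sigma> = UNIV \<and> \<xi>b_sites \<sigma> = UNIV \<longleftrightarrow> \<sigma> = (\<lambda>_. Inl 1)" for \<sigma> :: "'n \<Rightarrow> _"
    using letters_of_inverse(3)[of \<sigma>] letters_of_inverse(1,2)[of UNIV UNIV]
    by (auto simp: letters_of_def[abs_def])
  have tv: "top_value TYPE('n) = 2 * c UNIV UNIV"
    using val[of False False "\<lambda>_. Inl 1"] by (simp add: top_value_def pbw_def \<xi>_sites_def \<xi>b_sites_def)
  show "cointegral (pbw p q \<sigma>) = (if \<not> p \<and> \<not> q \<and> \<sigma> = (\<lambda>_. Inl 1) then top_value TYPE('n) else 0)"
    using lo[of \<sigma>] by (auto simp: val tv)
  show "top_value TYPE('n) \<noteq> 0"
    using c(1)[of UNIV UNIV] by (auto simp: tv)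
qed

section \<open>Factorization of the ribbon element and the R-matrix over the sites\<close>

lemma prod_list_minus_\<xi>_\<xi>b:
  assumes "distinct ys"
  shows "prod_list (map (\<lambda>i. - (\<xi> i * \<xi>b i)) ys)
    = (-1) ^ ((length ys + 1) div 2) *\<^sub>c (prod_list (map \<xi> ys) * prod_list (map \<xi>b ys))"
  using assms
proof (induction ys)
  case (Cons a ys)
  have b: "\<xi>b a * (prod_list (map \<xi> ys) * z) = (-1) ^ length ys *\<^sub>c (prod_list (map \<xi> ys) * (\<xi>b a * z))" for z
    using \<xi>b_past_word[of a ys] Cons.prems by (simp add: mult.assoc[symmetric] cscale_mult_left)
  \<comment> \<open>For \<open>k\<close> sites the \<open>k\<close> minus signs and the k (k - 1) /
    2 transpositions combine to k (k + 1) / 2 signs, a number with the parity of (k + 1) div 2. This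
    is the induction step of that count.\<close>
  have s: "(-1) ^ (Suc (length ys) div 2) * (-1) ^ length ys = ((-1) ^ (length ys div 2) :: complex)"
    by (cases "even (length ys)") (auto elim!: evenE oddE simp: power_add power_mult power_mult_distrib[symmetric])
  show ?case using Cons
    by (simp add: mult.assoc cscale_mult_right b cscale_cscale s)
qed (simp add: cscale_one)

text \<open>Collecting the factors \<open>Kb\<close> on the right moves them past k (k - 1) / 2
  letters in all, a number with the parity of k div 2. This is the sign in the definition of
  \<open>Rmat\<close>, so the sum over words there is an expanded product over sites.\<close>

lemma prod_list_Rmat:
  "prod_list (map (\<lambda>i. \<xi> i \<otimes>\<^sub>c (\<xi>b i * Kb)) ys)
    = (-1) ^ (length ys div 2) *\<^sub>c (prod_list (map \<xi> ys) \<otimes>\<^sub>c (prod_list (map \<xi>b ys) * Kb ^ length ys))"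
proof (induction ys)
  case (Cons a ys)
  have b: "Kb * prod_list (map \<xi>b ys) = (-1) ^ length ys *\<^sub>c (prod_list (map \<xi>b ys) * Kb)"
    by (induction ys) (simp_all add: dk_site cscale_one cscale_mult_right)
  then have b: "Kb * (prod_list (map \<xi>b ys) * z) = (-1) ^ length ys *\<^sub>c (prod_list (map \<xi>b ys) * (Kb * z))" for z
    by (simp add: mult.assoc[symmetric] cscale_mult_left)
  have s: "(-1) ^ (length ys div 2) * (-1) ^ length ys = ((-1) ^ (Suc (length ys) div 2) :: complex)"
    by (cases "even (length ys)") (auto elim!: evenE oddE simp: power_add power_mult power_mult_distrib[symmetric])
  show ?case using Cons
    by (simp add: mult.assoc cscale_mult_right b cscale_cscale s tens_simps)
qed (simp add: one_tensor_def cscale_one)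

lemma ribbon_eq:
  "(ribbon :: 'n::{finite,linorder} dk) = (1/2) *\<^sub>c ((1 + K - Kb + K * Kb) * prod_list (map (\<lambda>i. 1 - \<xi> i * \<xi>b i) sites))"
proof -
  have "prod_list (map (\<lambda>i. 1 - \<xi> i * \<xi>b i) (sites :: 'n list))
    = (\<Sum>A\<in>UNIV. (-1) ^ ((card A + 1) div 2) *\<^sub>c (\<xi>_word A * \<xi>b_word A))"
    using prod_list_map_one_plus[of "sites :: 'n list" "\<lambda>i. - (\<xi> i * \<xi>b i)"]
    by (simp add: prod_list_minus_\<xi>_\<xi>b \<xi>_word_sites \<xi>b_word_sites distinct_length_filter Int_absorb1)
  moreover have "(\<Sum>A\<in>UNIV. ((-1) ^ ((card A + 1) div 2) / 2) *\<^sub>c (\<xi>_word A * \<xi>b_word (A :: 'n set)))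
    = (1/2) *\<^sub>c (\<Sum>A\<in>UNIV. (-1) ^ ((card A + 1) div 2) *\<^sub>c (\<xi>_word A * \<xi>b_word A))"
    by (simp only: cvec.scale_sum_right cscale_cscale) simp
  ultimately show ?thesis
    by (simp only: ribbon_def cscale_mult_right)
qed

lemma Rmat_eq:
  "Rmat = prod_list (map (\<lambda>i. 1 + \<xi> i \<otimes>\<^sub>c (\<xi>b i * Kb)) sites)
     * ((1/2) *\<^sub>c (1 \<otimes>\<^sub>c 1 + K \<otimes>\<^sub>c 1 + 1 \<otimes>\<^sub>c Kb - K \<otimes>\<^sub>c Kb))"
  by (simp add: Rmat_def prod_list_map_one_plus prod_list_Rmat \<xi>_word_sites \<xi>b_word_sites
      distinct_length_filter Int_absorb1)

section \<open>The S-transform\<close>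

lemma alg_inverse_eqI: "x * y = 1 \<Longrightarrow> y * x = 1 \<Longrightarrow> alg_inverse x = (y :: 'a::calgebra)"
  unfolding alg_inverse_def
  by (rule the_equality) (auto, metis mult.assoc mult.left_neutral mult.right_neutral)

lemma clinear_tflip: "clinear (tflip :: ('a::cvector, 'b::cvector) tensor \<Rightarrow> _)"
  and tflip_tens [simp]: "tflip ((a :: 'a) \<otimes>\<^sub>c (b :: 'b)) = b \<otimes>\<^sub>c a"
proof -
  have "cbilinear (\<lambda>(a :: 'a) (b :: 'b). b \<otimes>\<^sub>c a)"
    by (rule cbilinearI) (simp_all add: tens_simps)
  then show "clinear (tflip :: ('a, 'b) tensor \<Rightarrow> _)" "tflip (a \<otimes>\<^sub>c b) = b \<otimes>\<^sub>c a"
    by (simp_all add: tflip_def clinear_tlift tlift_tens)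
qed

lemma tflip_mult: "tflip (x * y) = tflip x * tflip (y :: ('a::calgebra, 'b::calgebra) tensor)"
proof (induction x rule: tensor_induct)
  case (tens a b)
  show ?case
    by (induction y rule: tensor_induct) (simp_all add: distrib_left clinear_add[OF clinear_tflip])
qed (simp add: distrib_right clinear_add[OF clinear_tflip])

lemma tens_one_central:
  assumes "x \<in> center"
  shows "(1 \<otimes>\<^sub>c x) * y = y * ((1 :: 'b::calgebra) \<otimes>\<^sub>c (x :: 'a::calgebra))"
  using assms by (induction y rule: tensor_induct) (auto simp: center_def distrib_left distrib_right)

text \<open>The idempotents of the central involution \<open>K * Kb\<close>:
  \<open>eps False\<close> selects the block where \<open>Kb\<close> equals \<open>K\<close> and
  \<open>\<xi> i\<close>, \<open>\<xi>b i\<close> anticommute, \<open>eps True\<close> the block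
  where \<open>Kb\<close> equals \<open>- K\<close> and their anticommutator is 2.\<close>

definition eps :: "bool \<Rightarrow> 'n dk" where
  "eps h = (1/2) *\<^sub>c (1 + (if h then - 1 else 1) *\<^sub>c (K * Kb))"

lemma eps_center: "eps h \<in> center"
  by (rule center_dkI)
    (simp_all add: eps_def cscale_mult_left cscale_mult_right distrib_left distrib_right dk_site)

lemma eps_commute: "eps h * x = x * eps h"
  using eps_center by (auto simp: center_def)

lemma eps_left_commute: "eps h * (x * y) = x * (eps h * y)"
  by (metis eps_commute mult.assoc)

lemma eps_group:
  "Kb * eps h = (if h then - 1 else 1) *\<^sub>c (K * eps h)"
  "K * (Kb * eps h) = (if h then - 1 else 1) *\<^sub>c eps h"
  by (simp_all add: eps_def cscale_mult_right distrib_left dk_site cscale_one cscale_cscale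
      cvec.scale_right_diff_distrib cscale_add_right)

lemma half_half: "(1/2) *\<^sub>c x + (1/2) *\<^sub>c x = (x :: 'a::cvector)"
  by (simp add: cscale_add_left[symmetric] cscale_one)

lemma eps_sum: "eps False + eps True = 1"
proof -
  have "eps False + eps True = (1/2) *\<^sub>c 1 + (1/2) *\<^sub>c (1 :: 'a dk)"
    by (simp add: eps_def cscale_add_right cscale_one cvec.scale_right_diff_distrib)
  then show ?thesis by (simp add: half_half)
qed

section \<open>The inverse R-matrices as products over the sites\<close>

abbreviation Zfac :: "('n dk, 'n dk) tensor" where
  "Zfac \<equiv> (1/2) *\<^sub>c (1 \<otimes>\<^sub>c 1 + K \<otimes>\<^sub>c 1 + 1 \<otimes>\<^sub>c Kb - K \<otimes>\<^sub>c Kb)"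

abbreviation Zfac' :: "('n dk, 'n dk) tensor" where
  "Zfac' \<equiv> (1/2) *\<^sub>c (1 \<otimes>\<^sub>c 1 + 1 \<otimes>\<^sub>c K + Kb \<otimes>\<^sub>c 1 - Kb \<otimes>\<^sub>c K)"

lemmas tens_expand = distrib_left distrib_right left_diff_distrib right_diff_distrib
  tens_simps tens_diff tens_minus cscale_mult_left cscale_mult_right

text \<open>On a joint eigenspace of the two commuting involutions, with eigenvalues a and b, the
  factor is (1 + a + b - a b) / 2. This is -1 if a = b = -1 and 1 otherwise.\<close>

lemma Zfac_square: "Zfac * Zfac = (1 :: ('n dk, 'n dk) tensor)" "Zfac' * Zfac' = (1 :: ('n dk, 'n dk) tensor)"
proof -
  have "(1 \<otimes>\<^sub>c 1 + K \<otimes>\<^sub>c 1 + 1 \<otimes>\<^sub>c Kb - K \<otimes>\<^sub>c Kb) * (1 \<otimes>\<^sub>c 1 + K \<otimes>\<^sub>c 1 + 1 \<otimes>\<^sub>c Kb - K \<otimes>\<^sub>c Kb)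
      = 4 *\<^sub>c (1 :: ('n dk, 'n dk) tensor)"
    by (simp add: tens_expand dk_site one_tensor_def cscale_four algebra_simps)
  then show "Zfac * Zfac = (1 :: ('n dk, 'n dk) tensor)"
    by (simp add: cscale_mult_left cscale_mult_right cscale_cscale cscale_one)
  have "(1 \<otimes>\<^sub>c 1 + 1 \<otimes>\<^sub>c K + Kb \<otimes>\<^sub>c 1 - Kb \<otimes>\<^sub>c K) * (1 \<otimes>\<^sub>c 1 + 1 \<otimes>\<^sub>c K + Kb \<otimes>\<^sub>c 1 - Kb \<otimes>\<^sub>c K)
      = 4 *\<^sub>c (1 :: ('n dk, 'n dk) tensor)"
    by (simp add: tens_expand dk_site one_tensor_def cscale_four algebra_simps)
  then show "Zfac' * Zfac' = (1 :: ('n dk, 'n dk) tensor)"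
    by (simp add: cscale_mult_left cscale_mult_right cscale_cscale cscale_one)
qed

abbreviation afac :: "'n \<Rightarrow> ('n dk, 'n dk) tensor" where
  "afac i \<equiv> \<xi> i \<otimes>\<^sub>c (\<xi>b i * Kb)"

abbreviation bfac :: "'n \<Rightarrow> ('n dk, 'n dk) tensor" where
  "bfac i \<equiv> (\<xi>b i * Kb) \<otimes>\<^sub>c \<xi> i"

lemma fac_commute:
  "afac i * afac j = afac j * afac i" "bfac i * bfac j = bfac j * bfac i"
  "afac i * afac i = 0" "bfac i * bfac i = 0"
proof -
  show "afac i * afac j = afac j * afac i" "bfac i * bfac j = bfac j * bfac i"
    by (cases "i = j"; simp add: dk_site dk_other_site[of i j] tens_minus)+
  show "afac i * afac i = 0" "bfac i * bfac i = 0"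
    by (simp_all add: dk_site)
qed

lemma prod_one_plus_minus:
  fixes g :: "'i \<Rightarrow> 'a::calgebra"
  assumes "distinct xs" "\<And>i j. g i * g j = g j * g i" "\<And>i. g i * g i = 0"
  shows "prod_list (map (\<lambda>i. 1 + g i) xs) * prod_list (map (\<lambda>i. 1 - g i) xs) = 1"
    and "prod_list (map (\<lambda>i. 1 - g i) xs) * prod_list (map (\<lambda>i. 1 + g i) xs) = 1"
proof -
  show "prod_list (map (\<lambda>i. 1 + g i) xs) * prod_list (map (\<lambda>i. 1 - g i) xs) = 1"
    "prod_list (map (\<lambda>i. 1 - g i) xs) * prod_list (map (\<lambda>i. 1 + g i) xs) = 1"
    using assms by (subst prod_list_map_mult; simp add: tens_expand prod_list_map_one)+
qed

lemma alg_inverse_Rmat: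
  "alg_inverse (Rmat :: ('n::{finite,linorder} dk, 'n dk) tensor)
    = Zfac * prod_list (map (\<lambda>i. 1 - afac i) sites)"
proof -
  note p = prod_one_plus_minus[of "sites :: 'n list" afac, OF sites(1) fac_commute(1) fac_commute(3)]
  show ?thesis
    unfolding Rmat_eq
  proof (rule alg_inverse_eqI)
    show "prod_list (map (\<lambda>i. 1 + afac i) sites) * Zfac * (Zfac * prod_list (map (\<lambda>i. 1 - afac i) sites)) = (1 :: ('n dk, 'n dk) tensor)"
      by (metis (no_types, lifting) Zfac_square(1) p(1) mult.assoc mult.left_neutral)
    show "Zfac * prod_list (map (\<lambda>i. 1 - afac i) sites) * (prod_list (map (\<lambda>i. 1 + afac i) sites) * Zfac) = (1 :: ('n dk, 'n dk) tensor)"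
      by (metis (no_types, lifting) Zfac_square(1) p(2) mult.assoc mult.left_neutral)
  qed
qed

lemma alg_inverse_Rmat_flip:
  "alg_inverse (tflip Rmat :: ('n::{finite,linorder} dk, 'n dk) tensor)
    = Zfac' * prod_list (map (\<lambda>i. 1 - bfac i) sites)"
proof -
  note p = prod_one_plus_minus[of "sites :: 'n list" bfac, OF sites(1) fac_commute(2) fac_commute(4)]
  have f1: "tflip 1 = (1 :: ('n dk, 'n dk) tensor)" by (simp add: one_tensor_def)
  have R: "tflip Rmat = prod_list (map (\<lambda>i. 1 + bfac i) (sites :: 'n list)) * Zfac'"
    unfolding Rmat_eq tflip_mult prod_list_map_alg_hom[where h = tflip, OF f1 tflip_mult]
    by (simp add: clinear_scale[OF clinear_tflip] clinear_add[OF clinear_tflip] clinear_diff[OF clinear_tflip] f1)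
  show ?thesis
    unfolding R
  proof (rule alg_inverse_eqI)
    show "prod_list (map (\<lambda>i. 1 + bfac i) sites) * Zfac' * (Zfac' * prod_list (map (\<lambda>i. 1 - bfac i) sites)) = (1 :: ('n dk, 'n dk) tensor)"
      by (metis (no_types, lifting) Zfac_square(2) p(1) mult.assoc mult.left_neutral)
    show "Zfac' * prod_list (map (\<lambda>i. 1 - bfac i) sites) * (prod_list (map (\<lambda>i. 1 + bfac i) sites) * Zfac') = (1 :: ('n dk, 'n dk) tensor)"
      by (metis (no_types, lifting) Zfac_square(2) p(2) mult.assoc mult.left_neutral)
  qed
qed

text \<open>Conjugation by \<open>Zfac'\<close> carries \<open>afac' i\<close> to
  \<open>- afac i\<close>. The form arises when the group part of the flipped inverse is moved to
  the left past the site factors of the other inverse.\<close>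

abbreviation afac' :: "'n \<Rightarrow> ('n dk, 'n dk) tensor" where
  "afac' i \<equiv> (\<xi> i * Kb) \<otimes>\<^sub>c (\<xi>b i * (K * Kb))"

lemma Zfac'_afac: "Zfac' * (1 + afac' i) = (1 - afac i) * Zfac'"
  by (simp add: tens_expand dk_site algebra_simps one_tensor_def)

text \<open>The contribution of site \<open>i\<close> to the product of the two inverses once all
  group parts stand on the left.\<close>

definition site_fac :: "'n \<Rightarrow> ('n dk, 'n dk) tensor" where
  "site_fac i = (1 + afac' i) * (1 - bfac i)"

lemma afac'_bfac_commute:
  assumes "i \<noteq> j"
  shows "(1 - bfac i) * (1 + afac' j) = (1 + afac' j) * (1 - bfac i)"
proof -
  have "bfac i * afac' j = afac' j * bfac i"
    using assms by (simp add: dk_site dk_other_site[of i j] tens_minus)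
  then show ?thesis
    by (simp only: distrib_left distrib_right left_diff_distrib right_diff_distrib mult_1_left mult_1_right)
      (simp add: algebra_simps)
qed

definition slice :: "('n::{finite,linorder} dk, 'n dk) tensor \<Rightarrow> 'n dk" where
  "slice = tlift (\<lambda>a b. cointegral b *\<^sub>c a)"

lemma clinear_slice: "clinear (slice :: ('n::{finite,linorder} dk, 'n dk) tensor \<Rightarrow> _)"
  and slice_tens: "slice (a \<otimes>\<^sub>c (b :: 'n dk)) = cointegral b *\<^sub>c a"
proof -
  have "cbilinear (\<lambda>a b :: 'n dk. cointegral b *\<^sub>c (a :: 'n dk))"
    by (rule cbilinearI)
      (simp_all add: clinear_add[OF cointegral_pbw(1)] clinear_scale[OF cointegral_pbw(1)]
        cscale_add_right cscale_add_left cscale_cscale cscale_complex_def mult.commute)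
  then show "clinear (slice :: ('n dk, 'n dk) tensor \<Rightarrow> _)" "slice (a \<otimes>\<^sub>c b) = cointegral b *\<^sub>c a"
    by (simp_all add: slice_def clinear_tlift tlift_tens)
qed

text \<open>Centrality of \<open>x\<close> moves it out from between the two inverses, which then
  merge into one group part and one ordered product over the sites.\<close>

lemma S_LM_central:
  fixes x :: "'n::{finite,linorder} dk"
  assumes x: "x \<in> center"
  shows "S_LM x = slice (Zfac * Zfac' * prod_list (map site_fac sites) * (1 \<otimes>\<^sub>c x))"
proof -
  let ?P = "\<lambda>f. prod_list (map f (sites :: 'n list)) :: ('n dk, 'n dk) tensor"
  have 1: "?P (\<lambda>i. 1 - afac i) * Zfac' = Zfac' * ?P (\<lambda>i. 1 + afac' i)"
    by (rule prod_list_map_twist[symmetric]) (rule Zfac'_afac)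
  have 2: "?P (\<lambda>i. 1 + afac' i) * ?P (\<lambda>i. 1 - bfac i) = ?P site_fac"
    unfolding site_fac_def
    by (rule prod_list_map_mult[OF sites(1)]) (rule afac'_bfac_commute)
  have "Zfac * ?P (\<lambda>i. 1 - afac i) * (1 \<otimes>\<^sub>c x) * (Zfac' * ?P (\<lambda>i. 1 - bfac i))
      = Zfac * (?P (\<lambda>i. 1 - afac i) * Zfac') * ?P (\<lambda>i. 1 - bfac i) * (1 \<otimes>\<^sub>c x)"
    by (simp only: mult.assoc tens_one_central[OF x])
  also have "\<dots> = Zfac * Zfac' * (?P (\<lambda>i. 1 + afac' i) * ?P (\<lambda>i. 1 - bfac i)) * (1 \<otimes>\<^sub>c x)"
    by (simp only: 1 mult.assoc)
  finally show ?thesis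
    by (simp only: S_LM_def slice_def alg_inverse_Rmat alg_inverse_Rmat_flip 2)
qed

text \<open>Half of \<open>eps h\<close> keeps the group part, the other half multiplies it by
  \<open>K * Kb\<close> with the sign of \<open>h\<close>. The first half gives the trivial group
  part for \<open>a = p\<close> and \<open>b = False\<close>, the second for
  \<open>a \<noteq> p\<close> and \<open>b = True\<close>. Moving \<open>K\<close> past the word
  costs a sign, which is 1 on the top word.\<close>

lemma cointegral_group_word:
  fixes \<sigma> :: "'n::{finite,linorder} \<Rightarrow> 2 + bool"
  shows "cointegral (K ^ of_bool a * Kb ^ of_bool b * monomial \<sigma> * (K ^ of_bool p * eps h))
    = (if \<sigma> = (\<lambda>_. Inl 1) \<and> (a = p \<longleftrightarrow> \<not> b)
       then (if b \<and> h then - 1 else 1) * (top_value TYPE('n) / 2) else 0)"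
proof -
  define s where "s = prod_list (map parity_sign (map \<sigma> sites))"
  have s: "s = 1" if "\<sigma> = (\<lambda>_. Inl 1)"
  proof -
    have "prod_list (map parity_sign (map (\<lambda>_. Inl 1) xs)) = 1" for xs :: "'n list"
      by (induction xs) (auto simp: parity_sign_def)
    then show ?thesis using that by (simp add: s_def)
  qed
  have mK: "monomial \<sigma> * (K ^ of_bool p * z) = (if p then s else 1) *\<^sub>c (K ^ of_bool p * (monomial \<sigma> * z))" for z
  proof (cases p)
    case True
    have "K * (monomial \<sigma> * z) = s *\<^sub>c (monomial \<sigma> * (K * z))"
      unfolding s_def mult.assoc[symmetric] group_word(1) cscale_mult_left ..
    then have "s *\<^sub>c (K * (monomial \<sigma> * z)) = (s * s) *\<^sub>c (monomial \<sigma> * (K * z))"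
      by (simp add: cscale_cscale)
    then show ?thesis using True prod_list_parity_sign_square[of "map \<sigma> sites"]
      by (simp add: s_def cscale_one)
  qed (simp add: cscale_one)
  have K_pow: "K ^ of_bool a * (Kb ^ of_bool b * (K ^ of_bool p * z)) = K ^ of_bool (a \<noteq> p) * (Kb ^ of_bool b * z)" for z :: "'n dk"
    by (cases a; cases b; cases p) (simp_all add: dk_site)
  have LK: "K ^ of_bool a * (Kb ^ of_bool b * (K * (Kb * z))) = K ^ of_bool (\<not> a) * (Kb ^ of_bool (\<not> b) * z)" for a b and z :: "'n dk"
    by (cases a; cases b) (simp_all add: dk_site)
  have eps_eq: "eps h * z = (1/2) *\<^sub>c z + ((if h then - 1 else 1) / 2) *\<^sub>c (K * (Kb * z))" for z :: "'n dk"
    by (simp add: eps_def cscale_mult_left distrib_right cscale_add_right cscale_cscale mult.assoc)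
  have "K ^ of_bool a * Kb ^ of_bool b * monomial \<sigma> * (K ^ of_bool p * eps h)
      = (if p then s else 1) *\<^sub>c (K ^ of_bool (a \<noteq> p) * (Kb ^ of_bool b * (eps h * monomial \<sigma>)))"
    by (simp only: mult.assoc mK K_pow cscale_mult_right eps_commute[of h "monomial \<sigma>"])
  also have "\<dots> = ((if p then s else 1) / 2) *\<^sub>c pbw (a \<noteq> p) b \<sigma>
      + ((if p then s else 1) * (if h then - 1 else 1) / 2) *\<^sub>c pbw (a = p) (\<not> b) \<sigma>"
    by (simp add: eps_eq distrib_left cscale_mult_right cscale_add_right cscale_cscale LK pbw_def mult.assoc
        del: of_bool_not_iff)
  finally show ?thesis
    using s by (auto simp: clinear_add[OF cointegral_pbw(1)] clinear_scale[OF cointegral_pbw(1)]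
        cointegral_pbw(2) cscale_complex_def)
qed

text \<open>For \<open>p = False\<close> the cointegral keeps the two summands of
  \<open>Zfac * Zfac'\<close> in which \<open>K\<close> and \<open>Kb\<close> have equal exponents
  in the second tensor factor, for \<open>p = True\<close> the two with different exponents. In both
  cases they add up to \<open>K ^ of_bool h * eps p\<close>, which is the exchange of the labels
  \<open>p\<close> and \<open>h\<close>.\<close>

lemma eps_halves:
  "(1/4) *\<^sub>c ((1 + K) * (1 + Kb)) + ((if h then - 1 else 1) / 4) *\<^sub>c ((1 - K) * (1 - Kb)) = K ^ of_bool h * (eps False :: 'n dk)"
  "(1/4) *\<^sub>c ((1 + K) * (1 - Kb)) + ((if h then - 1 else 1) / 4) *\<^sub>c ((1 - K) * (1 + Kb)) = K ^ of_bool h * (eps True :: 'n dk)"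
proof -
  have q: "(1/4) *\<^sub>c x + (1/4) *\<^sub>c x = (1/2) *\<^sub>c x" for x :: "'n dk"
    by (simp add: cscale_add_left[symmetric])
  have q': "(1/4) *\<^sub>c x + ((1/4) *\<^sub>c x + y) = (1/2) *\<^sub>c x + y" for x y :: "'n dk"
    by (simp add: add.assoc[symmetric] q)
  show "(1/4) *\<^sub>c ((1 + K) * (1 + Kb)) + ((if h then - 1 else 1) / 4) *\<^sub>c ((1 - K) * (1 - Kb)) = K ^ of_bool h * (eps False :: 'n dk)"
    "(1/4) *\<^sub>c ((1 + K) * (1 - Kb)) + ((if h then - 1 else 1) / 4) *\<^sub>c ((1 - K) * (1 + Kb)) = K ^ of_bool h * (eps True :: 'n dk)"
    by (cases h; simp add: eps_def distrib_left distrib_right left_diff_distrib right_diff_distrib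
        cscale_add_right cvec.scale_right_diff_distrib cscale_mult_right dk_site cscale_one;
        simp add: algebra_simps q q')+
qed

text \<open>Only the coefficient of the top monomial survives the partial cointegral, so for a central
  element that factors over the sites \<open>S_LM\<close> is computed site by site.\<close>

lemma S_LM_sites:
  fixes x :: "'n::{finite,linorder} dk"
  assumes x: "x \<in> center"
    and fact: "1 \<otimes>\<^sub>c x = prod_list (map Y sites) * (1 \<otimes>\<^sub>c (K ^ of_bool p * eps h))"
    and comm: "\<And>i j. i \<noteq> j \<Longrightarrow> Y i * site_fac j = site_fac j * Y i"
    and site: "\<And>i. \<exists>b0 b1 b2. site_fac i * Y i * (1 \<otimes>\<^sub>c eps h) = 
      (\<alpha> i \<otimes>\<^sub>c letter i (Inl 1) + b0 \<otimes>\<^sub>c 1 + b1 \<otimes>\<^sub>c \<xi> i + b2 \<otimes>\<^sub>c \<xi>b i) * (1 \<otimes>\<^sub>c eps h)"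
  shows "S_LM x = (top_value TYPE('n) / 2) *\<^sub>c (K ^ of_bool h * eps p * prod_list (map \<alpha> sites))"
proof -
  let ?E = "1 \<otimes>\<^sub>c eps h :: ('n dk, 'n dk) tensor"
  let ?Kp = "1 \<otimes>\<^sub>c (K ^ of_bool p * eps h) :: ('n dk, 'n dk) tensor"
  obtain b0 b1 b2 where b: "site_fac i * Y i * ?E = 
      (\<alpha> i \<otimes>\<^sub>c letter i (Inl 1) + b0 i \<otimes>\<^sub>c 1 + b1 i \<otimes>\<^sub>c \<xi> i + b2 i \<otimes>\<^sub>c \<xi>b i) * ?E" for i
    using site by metis
  \<comment> \<open>A word containing any letter other than \<open>Inl 1\<close> is not the top
    monomial, so \<open>b0\<close>, \<open>b1\<close> and \<open>b2\<close> never influence the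
    result.\<close>
  define \<beta> where "\<beta> i l = (if l = Inl 1 then \<alpha> i else if l = Inl 2 then b0 i else if l = Inr False then b1 i else b2 i)" for i and l :: "2 + bool"
  have Ec: "?E * y = y * ?E" for y
    by (rule tens_one_central[OF eps_center])
  have site': "?E * (site_fac i * Y i) = ?E * (\<Sum>l\<in>UNIV. \<beta> i l \<otimes>\<^sub>c letter i l)" for i
    using b[of i] by (simp add: sum_letters \<beta>_def Ec)
  have "prod_list (map site_fac sites) * (1 \<otimes>\<^sub>c x) = prod_list (map (\<lambda>i. site_fac i * Y i) sites) * ?Kp"
    unfolding fact mult.assoc[symmetric]
    by (subst prod_list_map_mult) (simp_all add: comm)
  also have "?Kp = ?E * (1 \<otimes>\<^sub>c K ^ of_bool p)"
    by (simp add: eps_commute)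
  also have "prod_list (map (\<lambda>i. site_fac i * Y i) sites) * \<dots>
      = (?E * prod_list (map (\<lambda>i. site_fac i * Y i) sites)) * (1 \<otimes>\<^sub>c K ^ of_bool p)"
    by (simp only: Ec mult.assoc)
  also have "?E * prod_list (map (\<lambda>i. site_fac i * Y i) sites)
      = ?E * prod_list (map (\<lambda>i. \<Sum>l\<in>UNIV. \<beta> i l \<otimes>\<^sub>c letter i l) sites)"
    by (rule prod_list_map_cong_central[OF Ec site'])
  also have "prod_list (map (\<lambda>i. \<Sum>l\<in>UNIV. \<beta> i l \<otimes>\<^sub>c letter i l) sites)
      = (\<Sum>\<sigma>\<in>UNIV. prod_list (map (\<lambda>i. \<beta> i (\<sigma> i)) sites) \<otimes>\<^sub>c monomial \<sigma>)"
    by (simp add: prod_list_map_sum prod_list_map_tens PiE_UNIV_domain PiE_def extensional_def)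
  finally have P: "prod_list (map site_fac sites) * (1 \<otimes>\<^sub>c x)
      = (\<Sum>\<sigma>\<in>UNIV. prod_list (map (\<lambda>i. \<beta> i (\<sigma> i)) sites) \<otimes>\<^sub>c (monomial \<sigma> * (K ^ of_bool p * eps h)))"
    by (simp add: sum_distrib_left sum_distrib_right eps_commute eps_left_commute mult.assoc)
  \<comment> \<open>Sorted by the group element \<open>K ^ a * Kb ^ b\<close> in the second tensor
    factor. Its partner has the signs crossed: \<open>b\<close> decides the sign of \<open>K\<close>
    and \<open>a\<close> the sign of \<open>Kb\<close>.\<close>
  have ZZ: "Zfac * Zfac' = (1/4) *\<^sub>c (
      ((1 + K) * (1 + Kb)) \<otimes>\<^sub>c (K ^ of_bool False * Kb ^ of_bool False)
    + ((1 + K) * (1 - Kb)) \<otimes>\<^sub>c (K ^ of_bool True * Kb ^ of_bool False)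
    + ((1 - K) * (1 + Kb)) \<otimes>\<^sub>c (K ^ of_bool False * Kb ^ of_bool True)
    + ((1 - K) * (1 - Kb)) \<otimes>\<^sub>c (K ^ of_bool True * Kb ^ of_bool True) :: ('n dk, 'n dk) tensor)"
    by (simp add: tens_expand dk_site cscale_cscale) (simp add: algebra_simps)
  let ?t = "top_value TYPE('n) / 2"
  have "S_LM x = (\<Sum>\<sigma>\<in>UNIV. slice (Zfac * Zfac' * (prod_list (map (\<lambda>i. \<beta> i (\<sigma> i)) sites) \<otimes>\<^sub>c (monomial \<sigma> * (K ^ of_bool p * eps h)))))"
    unfolding S_LM_central[OF x] mult.assoc[of _ _ "1 \<otimes>\<^sub>c x"] P
    by (simp only: sum_distrib_left clinear_sum[OF clinear_slice])
  also have "\<dots> = (\<Sum>\<sigma> :: 'n \<Rightarrow> 2 + bool\<in>UNIV. if \<sigma> = (\<lambda>_. Inl 1) then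
       ?t *\<^sub>c (K ^ of_bool h * eps p * prod_list (map \<alpha> sites)) else 0)"
  proof (rule sum.cong)
    fix \<sigma> :: "'n \<Rightarrow> 2 + bool"
    let ?B = "prod_list (map (\<lambda>i. \<beta> i (\<sigma> i)) sites)"
    let ?M = "monomial \<sigma> * (K ^ of_bool p * eps h)"
    let ?g = "\<lambda>a b. cointegral (K ^ of_bool a * Kb ^ of_bool b * monomial \<sigma> * (K ^ of_bool p * eps h))"
    have "slice (Zfac * Zfac' * (?B \<otimes>\<^sub>c ?M)) = ((1/4) *\<^sub>c (?g False False *\<^sub>c ((1 + K) * (1 + Kb))
       + ?g True False *\<^sub>c ((1 + K) * (1 - Kb)) + ?g False True *\<^sub>c ((1 - K) * (1 + Kb))
       + ?g True True *\<^sub>c ((1 - K) * (1 - Kb)))) * ?B"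
      unfolding ZZ
      by (simp only: distrib_right cscale_mult_left tens_mult_tens clinear_add[OF clinear_slice]
          clinear_scale[OF clinear_slice] slice_tens mult.assoc)
    also have "\<dots> = (if \<sigma> = (\<lambda>_. Inl 1) then
       ?t *\<^sub>c (K ^ of_bool h * eps p * prod_list (map \<alpha> sites)) else 0)"
    proof (cases "\<sigma> = (\<lambda>_. Inl 1)")
      case True
      then have B: "?B = prod_list (map \<alpha> sites)" by (simp add: \<beta>_def)
      show ?thesis
      proof (cases p)
        case False
        have "(1/4) *\<^sub>c (?t *\<^sub>c ((1 + K) * (1 + Kb)) + ((if h then - 1 else 1) * ?t) *\<^sub>c ((1 - K) * (1 - Kb)))
            = ?t *\<^sub>c (K ^ of_bool h * (eps False :: 'n dk))"
          unfolding eps_halves(1)[symmetric] by (simp add: cscale_add_right cscale_cscale mult_ac)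
        then show ?thesis using True False unfolding B cointegral_group_word
          by (simp add: cscale_mult_left)
      next
        case p: True
        have "(1/4) *\<^sub>c (?t *\<^sub>c ((1 + K) * (1 - Kb)) + ((if h then - 1 else 1) * ?t) *\<^sub>c ((1 - K) * (1 + Kb)))
            = ?t *\<^sub>c (K ^ of_bool h * (eps True :: 'n dk))"
          unfolding eps_halves(2)[symmetric] by (simp add: cscale_add_right cscale_cscale mult_ac)
        then show ?thesis using True p unfolding B cointegral_group_word
          by (simp add: cscale_mult_left)
      qed
    next
      case False
      then show ?thesis unfolding cointegral_group_word by simp
    qed
    finally show "slice (Zfac * Zfac' * (?B \<otimes>\<^sub>c ?M)) = (if \<sigma> = (\<lambda>_. Inl 1) then
       ?t *\<^sub>c (K ^ of_bool h * eps p * prod_list (map \<alpha> sites)) else 0)" .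
  qed simp
  finally show ?thesis by simp
qed

section \<open>The S-transform at a single site, in each block\<close>

lemma site_fac_eps:
  "site_fac i * (1 \<otimes>\<^sub>c eps h) = (((if h then - 1 else 1) *\<^sub>c (\<xi> i * \<xi>b i)) \<otimes>\<^sub>c letter i (Inl 1)
    + (1 + (if h then - 2 else 0) *\<^sub>c (\<xi> i * \<xi>b i)) \<otimes>\<^sub>c 1 + (- (\<xi>b i * Kb)) \<otimes>\<^sub>c \<xi> i
    + ((if h then - 1 else 1) *\<^sub>c (\<xi> i * Kb)) \<otimes>\<^sub>c \<xi>b i) * (1 \<otimes>\<^sub>c eps h)"
proof -
  show ?thesis
    by (cases h; simp add: site_fac_def one_tensor_def tens_expand dk_site eps_group cscale_one;
        simp add: algebra_simps cscale_two)
qed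

lemma eps_False_site:
  "\<xi>b i * (\<xi> i * eps False) = - (\<xi> i * (\<xi>b i * eps False))"
  "\<xi> i * (\<xi>b i * (\<xi> i * eps False)) = 0" "\<xi>b i * (\<xi> i * (\<xi>b i * eps False)) = 0"
  by (simp_all add: dk_site eps_group cscale_one)

text \<open>In this block \<open>1 - K * Kb\<close> becomes 2, so up to scaling
  \<open>\<xi> i\<close> and \<open>\<xi>b i\<close> are a fermionic creation and annihilation
  pair.\<close>

lemma eps_True_site:
  "\<xi>b i * (\<xi> i * eps True) = 2 *\<^sub>c eps True - \<xi> i * (\<xi>b i * eps True)"
  "\<xi> i * (\<xi>b i * (\<xi> i * eps True)) = 2 *\<^sub>c (\<xi> i * eps True)"
  "\<xi>b i * (\<xi> i * (\<xi>b i * eps True)) = 2 *\<^sub>c (\<xi>b i * eps True)"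
proof -
  show "\<xi>b i * (\<xi> i * eps True) = 2 *\<^sub>c eps True - \<xi> i * (\<xi>b i * eps True)"
    "\<xi> i * (\<xi>b i * (\<xi> i * eps True)) = 2 *\<^sub>c (\<xi> i * eps True)"
    "\<xi>b i * (\<xi> i * (\<xi>b i * eps True)) = 2 *\<^sub>c (\<xi>b i * eps True)"
    by (simp_all add: dk_site eps_group cscale_one cscale_two right_diff_distrib distrib_left)
qed

text \<open>The minus sign in the letter \<open>- (\<xi> i * \<xi>b i)\<close> makes this the matrix
  of \<open>s\<close>: the first basis vector goes to the second, and the second to minus the
  first.\<close>

fun S_letter :: "'n \<Rightarrow> 2 + bool \<Rightarrow> 'n dk" where
  "S_letter i (Inl a) = (if a = 1 then 1 else \<xi> i * \<xi>b i)"
| "S_letter i (Inr b) = letter i (Inr b)"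

text \<open>The factor \<open>Kb\<close> attached to an odd letter makes it commute with the other sites.\<close>

definition dressed_letter :: "'n \<Rightarrow> 2 + bool \<Rightarrow> ('n dk, 'n dk) tensor" where
  "dressed_letter i l = (if isl l then 1 else Kb) \<otimes>\<^sub>c letter i l"

text \<open>The summands of \<open>site_fac_eps\<close> with an odd second factor carry a
  \<open>Kb\<close> in the first factor. It meets the \<open>Kb\<close> of a dressed odd letter and
  the two cancel, so an odd letter returns to itself.\<close>

lemma dressed_letter_site:
  "\<exists>b0 b1 b2. site_fac i * dressed_letter i l * (1 \<otimes>\<^sub>c eps False) = 
    (S_letter i l \<otimes>\<^sub>c letter i (Inl 1) + b0 \<otimes>\<^sub>c 1 + b1 \<otimes>\<^sub>c \<xi> i + b2 \<otimes>\<^sub>c \<xi>b i) * (1 \<otimes>\<^sub>c eps False)"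
proof -
  let ?E = "1 \<otimes>\<^sub>c eps False :: ('n dk, 'n dk) tensor"
  have 1: "site_fac i * dressed_letter i l * ?E = (site_fac i * ?E) * dressed_letter i l"
    by (simp only: mult.assoc tens_one_central[OF eps_center])
  note simps = dressed_letter_def tens_expand eps_commute eps_left_commute
    mult.assoc eps_False_site dk_relations_ord dk_relations_ord2 cscale_one
  show ?thesis
  proof (cases l rule: letter_cases)
    case one
    show ?thesis unfolding 1 unfolding site_fac_eps one
      by (rule exI[of _ 0], rule exI[of _ 0], rule exI[of _ 0]) (simp add: simps)
  next
    case two
    show ?thesis unfolding 1 unfolding site_fac_eps two
      by (rule exI[of _ 1], rule exI[of _ "- (\<xi>b i * Kb)"], rule exI[of _ "\<xi> i * Kb"]) (simp add: simps)
  next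
    case xi
    show ?thesis unfolding 1 unfolding site_fac_eps xi
      by (rule exI[of _ 0], rule exI[of _ Kb], rule exI[of _ 0]) (simp add: simps)
  next
    case xib
    show ?thesis unfolding 1 unfolding site_fac_eps xib
      by (rule exI[of _ 0], rule exI[of _ 0], rule exI[of _ Kb]) (simp add: simps)
  qed
qed

lemma site_fac_one:
  "\<exists>b0 b1 b2. site_fac i * 1 * (1 \<otimes>\<^sub>c eps True) = 
    (letter i (Inl 1) \<otimes>\<^sub>c letter i (Inl 1) + b0 \<otimes>\<^sub>c 1 + b1 \<otimes>\<^sub>c \<xi> i + b2 \<otimes>\<^sub>c \<xi>b i) * (1 \<otimes>\<^sub>c eps True)"
  using site_fac_eps[of i True] by (auto simp: cscale_one)

text \<open>In the Clifford block \<open>1 - \<xi> i * \<xi>b i\<close> is an involution, the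
  chirality element of one site, and it is a fixed vector of the transform at that site.\<close>

lemma site_fac_chirality:
  "\<exists>b0 b1 b2. site_fac i * (1 \<otimes>\<^sub>c (1 - \<xi> i * \<xi>b i)) * (1 \<otimes>\<^sub>c eps True) = 
    ((1 - \<xi> i * \<xi>b i) \<otimes>\<^sub>c letter i (Inl 1) + b0 \<otimes>\<^sub>c 1 + b1 \<otimes>\<^sub>c \<xi> i + b2 \<otimes>\<^sub>c \<xi>b i) * (1 \<otimes>\<^sub>c eps True)"
proof -
  let ?E = "1 \<otimes>\<^sub>c eps True :: ('n dk, 'n dk) tensor"
  have 1: "site_fac i * y * ?E = (site_fac i * ?E) * y" for y
    by (simp only: mult.assoc tens_one_central[OF eps_center])
  note simps = tens_expand eps_commute eps_left_commute
    mult.assoc eps_True_site dk_relations_ord dk_relations_ord2 cscale_one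
  show ?thesis unfolding 1 unfolding site_fac_eps
    by (rule exI[of _ "1 - 2 *\<^sub>c (\<xi> i * \<xi>b i)"], rule exI[of _ "- (\<xi>b i * Kb)"], rule exI[of _ "\<xi> i * Kb"])
      (simp add: simps, simp add: algebra_simps cscale_two)
qed

lemma commute_mult:
  fixes y :: "'a::semigroup_mult"
  assumes "y * a = a * y" "y * b = b * y"
  shows "y * (a * b) = (a * b) * y"
  using assms by (metis mult.assoc)

lemma site_fac_commuteI:
  assumes "Y * afac' j = afac' j * Y" "Y * bfac j = bfac j * Y"
  shows "Y * site_fac j = site_fac j * Y"
proof -
  have c: "Y * (1 + afac' j) = (1 + afac' j) * Y" "Y * (1 - bfac j) = (1 - bfac j) * Y"
    by (simp_all only: distrib_left distrib_right left_diff_distrib right_diff_distrib assms mult_1_left mult_1_right)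
  show ?thesis
    unfolding site_fac_def by (rule commute_mult[OF c])
qed

lemma dressed_letter_commute:
  "i \<noteq> j \<Longrightarrow> dressed_letter i l * site_fac j = site_fac j * dressed_letter i l"
  by (rule site_fac_commuteI; cases l rule: letter_cases)
    (simp_all add: dressed_letter_def dk_site dk_other_site[of i j] tens_minus)

lemma chirality_commute:
  "i \<noteq> j \<Longrightarrow> (1 \<otimes>\<^sub>c (1 - \<xi> i * \<xi>b i)) * site_fac j = site_fac j * (1 \<otimes>\<^sub>c (1 - \<xi> i * \<xi>b i))"
  by (rule site_fac_commuteI)
    (simp_all add: dk_site dk_other_site[of i j] tens_expand)

section \<open>Central elements and their S-transforms\<close>

definition odd_sites :: "('n \<Rightarrow> 2 + bool) \<Rightarrow> 'n set" where
  "odd_sites \<sigma> = {i. \<not> isl (\<sigma> i)}"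

lemma prod_parity_sign:
  "prod_list (map parity_sign (map \<sigma> (sites :: 'n::{finite,linorder} list))) = (-1) ^ card (odd_sites \<sigma>)"
proof -
  have "prod_list (map parity_sign (map \<sigma> xs)) = (-1) ^ length (filter (\<lambda>i. i \<in> odd_sites \<sigma>) xs)" for xs
    by (induction xs) (auto simp: parity_sign_def odd_sites_def)
  then show ?thesis by (simp add: distinct_length_filter)
qed

text \<open>Each odd letter brings one \<open>Kb\<close>, and an even number of them multiplies to
  1, so the dressing disappears from the whole product.\<close>

lemma prod_dressed_letter:
  fixes \<sigma> :: "'n::{finite,linorder} \<Rightarrow> 2 + bool"
  assumes "even (card (odd_sites \<sigma>))"
  shows "prod_list (map (\<lambda>i. dressed_letter i (\<sigma> i)) sites) = 1 \<otimes>\<^sub>c monomial \<sigma>"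
proof -
  have "prod_list (map (\<lambda>i. if isl (\<sigma> i) then 1 else Kb) xs) = (Kb :: 'n dk) ^ length (filter (\<lambda>i. i \<in> odd_sites \<sigma>) xs)" for xs
    by (induction xs) (auto simp: odd_sites_def)
  then have "prod_list (map (\<lambda>i. if isl (\<sigma> i) then 1 else Kb) sites) = (Kb :: 'n dk) ^ card (odd_sites \<sigma>)"
    by (simp add: distinct_length_filter)
  also have "\<dots> = 1" using assms by (elim evenE) (simp add: power_mult power2_eq_square dk_relations)
  finally show ?thesis by (simp add: dressed_letter_def prod_list_map_tens)
qed

text \<open>The exterior block is graded commutative: the sign rule for passing a letter holds there
  even at the generator's own site.\<close>

lemma eps_generator_word:
  "eps False * \<xi> i * word xs \<sigma> = prod_list (map parity_sign (map \<sigma> xs)) *\<^sub>c (word xs \<sigma> * (eps False * \<xi> i))"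
  "eps False * \<xi>b i * word xs \<sigma> = prod_list (map parity_sign (map \<sigma> xs)) *\<^sub>c (word xs \<sigma> * (eps False * \<xi>b i))"
proof -
  have c: "eps False * \<xi> i * letter j l = parity_sign l *\<^sub>c (letter j l * (eps False * \<xi> i))
    \<and> eps False * \<xi>b i * letter j l = parity_sign l *\<^sub>c (letter j l * (eps False * \<xi>b i))" for j l
  proof (cases "i = j")
    case True
    then show ?thesis
      by (cases l rule: letter_cases) (simp_all add: parity_sign_def eps_commute eps_left_commute mult.assoc
          eps_False_site dk_relations_ord dk_relations_ord2 cscale_one)
  next
    case False
    then show ?thesis
      by (simp add: mult.assoc letter_other_site eps_left_commute cscale_mult_right)
  qed
  show "eps False * \<xi> i * word xs \<sigma> = prod_list (map parity_sign (map \<sigma> xs)) *\<^sub>c (word xs \<sigma> * (eps False * \<xi> i))"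
    "eps False * \<xi>b i * word xs \<sigma> = prod_list (map parity_sign (map \<sigma> xs)) *\<^sub>c (word xs \<sigma> * (eps False * \<xi>b i))"
    by (rule move_past_word, simp add: c)+
qed

text \<open>Even elements of an exterior algebra are central, and an even word also commutes with
  \<open>K\<close> and \<open>Kb\<close>.\<close>

lemma eps_monomial_center:
  assumes "even (card (odd_sites \<sigma>))"
  shows "eps False * monomial \<sigma> \<in> center"
proof -
  have s: "prod_list (map parity_sign (map \<sigma> sites)) = 1"
    unfolding prod_parity_sign using assms by simp
  note g = group_word[where xs = sites and \<sigma> = \<sigma>, unfolded s cscale_one] eps_generator_word[where xs = sites and \<sigma> = \<sigma>, unfolded s cscale_one]
  show ?thesis
  proof (rule center_dkI)
    show "eps False * monomial \<sigma> * K = K * (eps False * monomial \<sigma>)"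
      by (simp add: mult.assoc g(1)[symmetric] eps_left_commute[of _ K])
    show "eps False * monomial \<sigma> * Kb = Kb * (eps False * monomial \<sigma>)"
      by (simp add: mult.assoc g(2)[symmetric] eps_left_commute[of _ Kb])
    show "eps False * monomial \<sigma> * \<xi> i = \<xi> i * (eps False * monomial \<sigma>)" for i
      using g(3)[of i] by (simp add: mult.assoc eps_commute eps_left_commute)
    show "eps False * monomial \<sigma> * \<xi>b i = \<xi>b i * (eps False * monomial \<sigma>)" for i
      using g(4)[of i] by (simp add: mult.assoc eps_commute eps_left_commute)
  qed
qed

lemma S_LM_monomial:
  fixes \<sigma> :: "'n::{finite,linorder} \<Rightarrow> 2 + bool"
  assumes "even (card (odd_sites \<sigma>))"
  shows "S_LM (eps False * monomial \<sigma>)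
    = (top_value TYPE('n) / 2) *\<^sub>c (eps False * prod_list (map (\<lambda>i. S_letter i (\<sigma> i)) sites))"
proof -
  have "S_LM (eps False * monomial \<sigma>)
    = (top_value TYPE('n) / 2) *\<^sub>c (K ^ of_bool False * eps False * prod_list (map (\<lambda>i. S_letter i (\<sigma> i)) sites))"
  proof (rule S_LM_sites[OF eps_monomial_center[OF assms]])
    show "1 \<otimes>\<^sub>c (eps False * monomial \<sigma>)
      = prod_list (map (\<lambda>i. dressed_letter i (\<sigma> i)) sites) * (1 \<otimes>\<^sub>c (K ^ of_bool False * eps False))"
      by (simp add: prod_dressed_letter[OF assms] eps_commute)
  qed (rule dressed_letter_commute dressed_letter_site; assumption?)+
  then show ?thesis by simp
qed


lemma split_sites:
  obtains ys zs where "(sites :: 'n::{finite,linorder} list) = ys @ i # zs" "i \<notin> set ys" "i \<notin> set zs"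
proof -
  have "i \<in> set (sites :: 'n list)" by simp
  then obtain ys zs where eq: "(sites :: 'n list) = ys @ i # zs" by (meson split_list)
  have "distinct (ys @ i # zs)" unfolding eq[symmetric] by simp
  then show ?thesis by (intro that[OF eq]) auto
qed

definition Hig1 :: "'n::{finite,linorder} dk" where
  "Hig1 = K * eps False * monomial (\<lambda>_. Inl 1)"

definition Hig3 :: "'n::{finite,linorder} dk" where
  "Hig3 = K * eps True * prod_list (map (\<lambda>i. 1 - \<xi> i * \<xi>b i) sites)"

text \<open>The generator is moved to its own site. The letter there already contains both
  \<open>\<xi> i\<close> and \<open>\<xi>b i\<close>, so in this block the product is 0.\<close>

lemma eps_generator_top:
  fixes i :: "'n::{finite,linorder}"
  shows "eps False * \<xi> i * monomial (\<lambda>_. Inl 1) = 0" "eps False * \<xi>b i * monomial (\<lambda>_. Inl 1) = 0"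
proof -
  obtain ys zs where s: "(sites :: 'n list) = ys @ i # zs" by (rule split_sites)
  have z: "eps False * \<xi> i * letter i (Inl 1) = 0" "eps False * \<xi>b i * letter i (Inl 1) = 0"
    by (simp_all add: eps_commute eps_left_commute mult.assoc eps_False_site dk_relations_ord dk_relations_ord2)
  have "y * (word ys (\<lambda>_. Inl 1) * (letter i (Inl 1) * w)) = 0"
    if "y * word ys (\<lambda>_. Inl 1) = c *\<^sub>c (word ys (\<lambda>_. Inl 1) * y)" "y * letter i (Inl 1) = 0" for y w :: "'n dk" and c
  proof -
    have "y * (word ys (\<lambda>_. Inl 1) * (letter i (Inl 1) * w)) = y * word ys (\<lambda>_. Inl 1) * (letter i (Inl 1) * w)"
      by (simp only: mult.assoc)
    also have "\<dots> = c *\<^sub>c (word ys (\<lambda>_. Inl 1) * (y * letter i (Inl 1) * w))"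
      unfolding that(1) by (simp only: mult.assoc cscale_mult_left)
    finally show ?thesis unfolding that(2) by simp
  qed
  from this[OF eps_generator_word(1) z(1), of "word zs (\<lambda>_. Inl 1)"]
    this[OF eps_generator_word(2) z(2), of "word zs (\<lambda>_. Inl 1)"]
  show "eps False * \<xi> i * monomial (\<lambda>_. Inl 1) = 0" "eps False * \<xi>b i * monomial (\<lambda>_. Inl 1) = 0"
    by (simp_all only: s map_append list.map prod_list.append prod_list.Cons)
qed

lemma odd_sites_top [simp]: "odd_sites (\<lambda>_. Inl a) = {}"
  by (simp add: odd_sites_def)

text \<open>\<open>K\<close> anticommutes with the odd generators, but in this block they annihilate
  the top word from the left and from the right, so each of their commutation relations reads 0 =
  0.\<close>

lemma Hig1_center: "(Hig1 :: 'n::{finite,linorder} dk) \<in> center"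
proof -
  let ?w = "monomial (\<lambda>_. Inl 1) :: 'n dk"
  have s: "prod_list (map parity_sign (map (\<lambda>_. Inl 1) (sites :: 'n list))) = 1"
    by (simp only: prod_parity_sign) simp
  note g = group_word[where xs = sites and \<sigma> = "\<lambda>_ :: 'n. Inl 1", unfolded s cscale_one]
    eps_generator_word[where xs = sites and \<sigma> = "\<lambda>_ :: 'n. Inl 1", unfolded s cscale_one eps_generator_top]
  have z: "\<xi> i * (?w * eps False) = 0" "\<xi>b i * (?w * eps False) = 0" "?w * (\<xi> i * eps False) = 0" "?w * (\<xi>b i * eps False) = 0" for i
    using eps_generator_top[of i] g(3)[of i] g(4)[of i]
    by (simp_all only: mult.assoc eps_commute[of False "\<xi> i * _"] eps_commute[of False "\<xi>b i * _"] eps_commute[of False ?w] eps_commute[of False "\<xi> i"] eps_commute[of False "\<xi>b i"])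
  show ?thesis
    unfolding Hig1_def
  proof (rule center_dkI)
    show "K * eps False * ?w * K = K * (K * eps False * ?w)"
      by (simp only: mult.assoc g(1)[symmetric] eps_left_commute[of _ K])
    show "K * eps False * ?w * Kb = Kb * (K * eps False * ?w)"
      by (simp only: mult.assoc g(2)[symmetric] eps_left_commute[of _ Kb] dk_relations_ord2(9))
    have c: "K * eps False * ?w * y = y * (K * eps False * ?w)"
      if "?w * (y * eps False) = 0" "y * (?w * eps False) = 0" "\<And>z. y * (K * z) = - (K * (y * z))" for y
    proof -
      have "K * eps False * ?w * y = K * (?w * (y * eps False))"
        by (simp only: mult.assoc eps_commute[of False "?w * y"])
      moreover have "y * (K * eps False * ?w) = - (K * (y * (?w * eps False)))"
        by (simp only: mult.assoc eps_commute[of False ?w] that(3))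
      ultimately show ?thesis by (simp only: that mult_zero_right minus_zero)
    qed
    show "K * eps False * ?w * \<xi> i = \<xi> i * (K * eps False * ?w)" "K * eps False * ?w * \<xi>b i = \<xi>b i * (K * eps False * ?w)" for i
      by (rule c[OF z(3) z(1)], simp add: dk_relations_ord2) (rule c[OF z(4) z(2)], simp add: dk_relations_ord2)
  qed
qed

lemma chirality_factor_commute:
  "i \<noteq> j \<Longrightarrow> (1 - \<xi> i * \<xi>b i) * (1 - \<xi> j * \<xi>b j) = (1 - \<xi> j * \<xi>b j) * (1 - \<xi> i * \<xi>b i)"
  by (simp add: left_diff_distrib right_diff_distrib mult.assoc dk_other_site[of i j])

abbreviation chirality :: "'n::{finite,linorder} dk" where
  "chirality \<equiv> prod_list (map (\<lambda>i. 1 - \<xi> i * \<xi>b i) sites)"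

text \<open>In the Clifford block an odd generator anticommutes with the chirality factor of its own
  site and commutes with the others, and each factor squares to 1. Hence the product anticommutes
  with all odd generators, and multiplying it by \<open>K\<close> gives a central element.\<close>

lemma chirality_simps:
  fixes i :: "'n::{finite,linorder}"
  shows "K * chirality = chirality * (K :: 'n dk)" "Kb * chirality = chirality * (Kb :: 'n dk)"
    "eps True * (\<xi> i * chirality) = - (eps True * (chirality * \<xi> i))"
  "eps True * (\<xi>b i * chirality) = - (eps True * (chirality * \<xi>b i))"
  "eps True * (chirality * chirality) = (eps True :: 'n dk)"
proof -
  show "K * chirality = chirality * (K :: 'n dk)" "Kb * chirality = chirality * (Kb :: 'n dk)"
    by (rule prod_list_map_commute; simp add: dk_site distrib_left left_diff_distrib right_diff_distrib)+
  have site: "eps True * y * chirality = - (chirality * (eps True * y))"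
    if "\<And>j. j \<noteq> i \<Longrightarrow> y * (1 - \<xi> j * \<xi>b j) = (1 - \<xi> j * \<xi>b j) * y"
      and "eps True * y * (1 - \<xi> i * \<xi>b i) = - ((1 - \<xi> i * \<xi>b i) * (eps True * y))" for y :: "'n dk" and i
  proof -
    let ?h = "\<lambda>j :: 'n. 1 - \<xi> j * \<xi>b j"
    obtain ys zs where s: "(sites :: 'n list) = ys @ i # zs" "i \<notin> set ys" "i \<notin> set zs" by (rule split_sites)
    have c: "eps True * y * ?h j = ?h j * (eps True * y)" if "j \<noteq> i" for j
    proof -
      have "eps True * y * ?h j = eps True * (?h j * y)"
        using \<open>\<And>j. j \<noteq> i \<Longrightarrow> y * ?h j = ?h j * y\<close>[OF that] by (simp only: mult.assoc)
      then show ?thesis by (simp only: eps_left_commute)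
    qed
    have "eps True * y * prod_list (map ?h ys) = prod_list (map ?h ys) * (eps True * y)"
      "eps True * y * prod_list (map ?h zs) = prod_list (map ?h zs) * (eps True * y)"
      using s by (auto intro!: prod_list_map_commute c)
    note cAB = this
    have gen: "u * (A * (h * B)) = - (A * (h * (B * u)))"
      if "u * A = A * u" "u * B = B * u" "u * h = - (h * u)" for u A B h :: "'n dk"
    proof -
      have "u * (A * (h * B)) = (u * A) * (h * B)" by (simp only: mult.assoc)
      also have "\<dots> = A * ((u * h) * B)" by (simp only: that(1) mult.assoc)
      also have "\<dots> = - (A * (h * (u * B)))" by (simp add: that(3) mult.assoc)
      finally show ?thesis by (simp only: that(2))
    qed
    from gen[OF cAB that(2)] show ?thesis
      unfolding s(1) by (simp only: map_append list.map prod_list.append prod_list.Cons mult.assoc)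
  qed
  note simps = eps_commute eps_left_commute mult.assoc eps_True_site left_diff_distrib right_diff_distrib dk_relations_ord dk_relations_ord2
  have "eps True * \<xi> i * chirality = - (chirality * (eps True * \<xi> i))"
    by (rule site[of i]) (simp_all add: simps dk_other_site[of i], simp add: cscale_two distrib_left)
  then show "eps True * (\<xi> i * chirality) = - (eps True * (chirality * \<xi> i))"
    by (simp add: mult.assoc eps_left_commute[of True chirality])
  have "eps True * \<xi>b i * chirality = - (chirality * (eps True * \<xi>b i))"
    by (rule site[of i]) (simp_all add: simps dk_other_site[of i], simp add: cscale_two distrib_left)
  then show "eps True * (\<xi>b i * chirality) = - (eps True * (chirality * \<xi>b i))"
    by (simp add: mult.assoc eps_left_commute[of True chirality])
  have "chirality * chirality = prod_list (map (\<lambda>i. (1 - \<xi> i * \<xi>b i) * (1 - \<xi> i * \<xi>b i)) (sites :: 'n list))"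
    by (rule prod_list_map_mult[OF sites(1)]) (rule chirality_factor_commute)
  also have "eps True * \<dots> = eps True * prod_list (map (\<lambda>i. 1) (sites :: 'n list))"
  proof (rule prod_list_map_cong_central[OF eps_commute])
    fix i :: 'n
    show "eps True * ((1 - \<xi> i * \<xi>b i) * (1 - \<xi> i * \<xi>b i)) = eps True * 1"
      by (simp add: simps cscale_two distrib_left)
  qed
  finally show "eps True * (chirality * chirality) = (eps True :: 'n dk)"
    by (simp only: prod_list_map_one mult_1_right)
qed

lemma chirality_left:
  "K * (chirality * z) = chirality * (K * z)" "Kb * (chirality * z) = chirality * (Kb * z)"
  by (simp_all only: mult.assoc[symmetric] chirality_simps(1,2))

lemma Hig3_eq: "Hig3 = chirality * (K * eps True)"
proof -
  have "Hig3 = eps True * (K * chirality)" unfolding Hig3_def by (simp only: mult.assoc eps_left_commute)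
  also have "\<dots> = chirality * (K * eps True)"
    by (simp only: chirality_simps(1) eps_left_commute eps_commute mult.assoc)
  finally show ?thesis .
qed

lemma Hig3_center: "(Hig3 :: 'n::{finite,linorder} dk) \<in> center"
  unfolding Hig3_eq
proof (rule center_dkI)
  show "chirality * (K * eps True) * K = K * (chirality * (K * eps True))"
    by (simp only: mult.assoc eps_commute chirality_left)
  show "chirality * (K * eps True) * Kb = Kb * (chirality * (K * eps True))"
    by (simp only: mult.assoc eps_commute chirality_left dk_relations_ord2(9))
  have anti: "chirality * (K * eps True) * y = y * (chirality * (K * eps True))"
    if "eps True * (y * chirality) = - (eps True * (chirality * y))" "K * y = - (y * K)" for y :: "'n dk"
  proof -
    have "y * (chirality * (K * eps True)) = (eps True * (y * chirality)) * K"
      by (simp only: eps_commute mult.assoc)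
    also have "\<dots> = - (eps True * (chirality * (y * K)))"
      unfolding that(1) by (simp add: mult.assoc)
    also have "y * K = - (K * y)" using that(2) by simp
    also have "- (eps True * (chirality * (- (K * y)))) = chirality * (K * eps True) * y"
      by (simp add: mult.assoc eps_commute)
    finally show ?thesis by simp
  qed
  show "chirality * (K * eps True) * \<xi> i = \<xi> i * (chirality * (K * eps True))" for i :: 'n
    by (rule anti) (rule chirality_simps dk_relations)+
  show "chirality * (K * eps True) * \<xi>b i = \<xi>b i * (chirality * (K * eps True))" for i :: 'n
    by (rule anti) (rule chirality_simps dk_relations)+
qed

text \<open>With \<open>p\<close> and \<open>h\<close> exchanged, the labels True, False of
  \<open>Hig1\<close> become the labels False, True of \<open>eps True\<close>, and conversely.
  \<open>Hig3\<close> has both labels True, and each of its site factors is fixed.\<close>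

lemma S_LM_Hig:
  "S_LM (Hig1 :: 'n::{finite,linorder} dk) = (top_value TYPE('n) / 2) *\<^sub>c eps True"
  "S_LM (eps True :: 'n dk) = (top_value TYPE('n) / 2) *\<^sub>c Hig1"
  "S_LM (Hig3 :: 'n dk) = (top_value TYPE('n) / 2) *\<^sub>c Hig3"
proof -
  have "S_LM (Hig1 :: 'n dk) = (top_value TYPE('n) / 2) *\<^sub>c (K ^ of_bool False * eps True * prod_list (map (\<lambda>i. S_letter i (Inl 1)) sites))"
  proof (rule S_LM_sites[OF Hig1_center])
    have c: "monomial (\<lambda>_. Inl 1) * K = K * (monomial (\<lambda>_. Inl 1) :: 'n dk)"
      unfolding group_word prod_parity_sign by (simp add: cscale_one)
    have "Hig1 = monomial (\<lambda>_. Inl 1) * (K * eps False :: 'n dk)"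
      unfolding Hig1_def by (simp only: mult.assoc[symmetric] c) (simp only: mult.assoc eps_commute)
    then show "1 \<otimes>\<^sub>c Hig1 = prod_list (map (\<lambda>i :: 'n. dressed_letter i (Inl 1)) sites) * (1 \<otimes>\<^sub>c (K ^ of_bool True * eps False))"
      by (subst prod_dressed_letter) simp_all
  qed (rule dressed_letter_commute dressed_letter_site; assumption?)+
  then show "S_LM (Hig1 :: 'n dk) = (top_value TYPE('n) / 2) *\<^sub>c eps True"
    by (simp add: prod_list_map_one)
  have "S_LM (eps True :: 'n dk) = (top_value TYPE('n) / 2) *\<^sub>c (K ^ of_bool True * eps False * prod_list (map (\<lambda>i. letter i (Inl 1)) sites))"
  proof (rule S_LM_sites[OF eps_center])
    show "1 \<otimes>\<^sub>c eps True = prod_list (map (\<lambda>i :: 'n. 1 :: ('n dk, 'n dk) tensor) sites) * (1 \<otimes>\<^sub>c (K ^ of_bool False * eps True :: 'n dk))"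
      by (simp only: prod_list_map_one) simp
  qed (simp, rule site_fac_one)
  then show "S_LM (eps True :: 'n dk) = (top_value TYPE('n) / 2) *\<^sub>c Hig1"
    by (simp add: Hig1_def)
  have "S_LM (Hig3 :: 'n dk) = (top_value TYPE('n) / 2) *\<^sub>c (K ^ of_bool True * eps True * prod_list (map (\<lambda>i. 1 - \<xi> i * \<xi>b i) sites))"
  proof (rule S_LM_sites[OF Hig3_center])
    show "(1 :: 'n dk) \<otimes>\<^sub>c Hig3 = prod_list (map (\<lambda>i. 1 \<otimes>\<^sub>c (1 - \<xi> i * \<xi>b i)) sites) * (1 \<otimes>\<^sub>c (K ^ of_bool True * eps True :: 'n dk))"
      unfolding Hig3_eq prod_list_map_tens prod_list_map_one by simp
  qed (rule chirality_commute site_fac_chirality; assumption?)+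
  then show "S_LM (Hig3 :: 'n dk) = (top_value TYPE('n) / 2) *\<^sub>c Hig3"
    by (simp add: Hig3_def)
qed

section \<open>The action of the ribbon element\<close>

lemma ribbon_eps:
  "ribbon * eps False = chirality * (eps False :: 'n::{finite,linorder} dk)"
  "ribbon * eps True = chirality * (K * eps True :: 'n dk)"
proof -
  have c: "ribbon * z = chirality * ((1/2) *\<^sub>c ((1 + K - Kb + K * Kb) * z))" for z :: "'n dk"
  proof -
    have "(1 + K - Kb + K * Kb) * chirality = chirality * (1 + K - Kb + K * Kb :: 'n dk)"
    proof -
      have "K * Kb * chirality = chirality * (K * Kb :: 'n dk)"
        by (simp only: mult.assoc chirality_simps(2)) (simp only: mult.assoc[symmetric] chirality_simps(1))
      then show ?thesis
        by (simp only: distrib_left distrib_right left_diff_distrib right_diff_distrib chirality_simps mult_1_left mult_1_right)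
    qed
    then show ?thesis
      unfolding ribbon_eq cscale_mult_left by (simp only: mult.assoc cscale_mult_right)
  qed
  \<comment> \<open>Where \<open>Kb\<close> equals \<open>K\<close> the group sum is 2, and where
    \<open>Kb\<close> equals \<open>- K\<close> it is \<open>2 * K\<close>; the factor 1/2 of the
    ribbon element cancels the 2.\<close>
  have "(1 + K - Kb + K * Kb) * eps False = (2::complex) *\<^sub>c (eps False :: 'n dk)"
    by (simp add: distrib_right left_diff_distrib mult.assoc eps_group cscale_two cscale_one dk_relations_ord2)
  then show "ribbon * eps False = chirality * (eps False :: 'n dk)"
    unfolding c by (simp add: cscale_cscale cscale_one)
  have "(1 + K - Kb + K * Kb) * eps True = (2::complex) *\<^sub>c (K * eps True :: 'n dk)"
    by (simp add: distrib_right left_diff_distrib mult.assoc eps_group cscale_two cscale_one dk_relations_ord2)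
  then show "ribbon * eps True = chirality * (K * eps True :: 'n dk)"
    unfolding c by (simp add: cscale_cscale cscale_one)
qed

text \<open>In the exterior block multiplication by \<open>1 - \<xi> i * \<xi>b i\<close> fixes the
  first basis vector and the odd letters and sends 1 to the sum of the two basis vectors, which is
  the matrix of \<open>t\<close>.\<close>

fun T_letter :: "'n \<Rightarrow> 2 + bool \<Rightarrow> 'n dk" where
  "T_letter i (Inl a) = (if a = 1 then letter i (Inl 1) else 1 - \<xi> i * \<xi>b i)"
| "T_letter i (Inr b) = letter i (Inr b)"

lemma T_LM_monomial:
  fixes \<sigma> :: "'n::{finite,linorder} \<Rightarrow> 2 + bool"
  shows "T_LM (eps False * monomial \<sigma>) = eps False * prod_list (map (\<lambda>i. T_letter i (\<sigma> i)) sites)"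
proof -
  have "T_LM (eps False * monomial \<sigma>) = eps False * (chirality * monomial \<sigma>)"
    unfolding T_LM_def mult.assoc[symmetric] ribbon_eps by (simp only: eps_commute)
  also have "chirality * monomial \<sigma> = prod_list (map (\<lambda>i. (1 - \<xi> i * \<xi>b i) * letter i (\<sigma> i)) sites)"
  proof (rule prod_list_map_mult[OF sites(1)])
    fix i j :: 'n assume "i \<noteq> j"
    then show "letter i (\<sigma> i) * (1 - \<xi> j * \<xi>b j) = (1 - \<xi> j * \<xi>b j) * letter i (\<sigma> i)"
      by (cases "\<sigma> i" rule: letter_cases)
        (simp_all add: right_diff_distrib left_diff_distrib mult.assoc dk_other_site[of i j])
  qed
  also have "eps False * \<dots> = eps False * prod_list (map (\<lambda>i. T_letter i (\<sigma> i)) sites)"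
  proof (rule prod_list_map_cong_central[OF eps_commute])
    fix i
    show "eps False * ((1 - \<xi> i * \<xi>b i) * letter i (\<sigma> i)) = eps False * T_letter i (\<sigma> i)"
      by (cases "\<sigma> i" rule: letter_cases)
        (simp_all add: right_diff_distrib left_diff_distrib mult.assoc eps_commute eps_left_commute
          eps_False_site dk_relations_ord dk_relations_ord2)
  qed
  finally show ?thesis .
qed

text \<open>The ribbon element fixes the top word in the exterior block. In the Clifford block it is
  the chirality element times \<open>K\<close>, that is \<open>Hig3\<close>, and its square is
  \<open>eps True\<close>.\<close>

lemma T_LM_Hig:
  "T_LM Hig1 = (Hig1 :: 'n::{finite,linorder} dk)" "T_LM (eps True) = (Hig3 :: 'n dk)" "T_LM Hig3 = (eps True :: 'n dk)"
proof -
  let ?w = "monomial (\<lambda>_. Inl 1) :: 'n dk"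
  have c: "?w * K = K * ?w"
    unfolding group_word prod_parity_sign by (simp add: cscale_one)
  have H1: "Hig1 = eps False * ?w * K"
    unfolding Hig1_def by (simp only: mult.assoc c eps_left_commute)
  have "T_LM (eps False * ?w) = eps False * ?w"
    unfolding T_LM_monomial by simp
  then show "T_LM Hig1 = (Hig1 :: 'n dk)"
    unfolding H1 T_LM_def by (simp only: mult.assoc[symmetric])
  show T: "T_LM (eps True) = (Hig3 :: 'n dk)"
    unfolding T_LM_def ribbon_eps Hig3_eq ..
  have "T_LM (Hig3 :: 'n dk) = ribbon * eps True * (chirality * K)"
    unfolding Hig3_eq T_LM_def by (simp only: mult.assoc eps_commute)
  also have "\<dots> = chirality * (chirality * eps True)"
    unfolding ribbon_eps by (simp only: mult.assoc eps_commute chirality_left dk_relations_ord2(1))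
  also have "\<dots> = eps True * (chirality * chirality)"
    by (simp only: mult.assoc eps_commute)
  finally show "T_LM Hig3 = (eps True :: 'n dk)"
    by (simp only: chirality_simps(5))
qed

section \<open>Decomposition of \<open>Z_\<Lambda>\<close>\<close>

lemma clinear_T_LM: "clinear T_LM"
  by (rule clinearI) (simp_all add: T_LM_def distrib_left cscale_mult_right)

lemma clinear_S_LM: "clinear (S_LM :: 'n::{finite,linorder} dk \<Rightarrow> _)"
  unfolding S_LM_def slice_def[symmetric]
  by (rule clinearI) (simp_all add: tens_simps distrib_left distrib_right cscale_mult_left cscale_mult_right
      clinear_add[OF clinear_slice] clinear_scale[OF clinear_slice])

lemma even_card_odd_sites_letters_of:
  fixes A B :: "'n::finite set"
  shows "even (card (odd_sites (letters_of A B))) \<longleftrightarrow> even (card A + card B)"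
proof -
  have "odd_sites (letters_of A B) = (A - B) \<union> (B - A)"
    by (auto simp: odd_sites_def letters_of_def)
  then have "card (odd_sites (letters_of A B)) = card (A - B) + card (B - A)"
    by (simp add: card_Un_disjoint Diff_Int_distrib Diff_disjoint inf_commute)
  moreover have "card A = card (A - B) + card (A \<inter> B)" "card B = card (B - A) + card (A \<inter> B)"
    by (simp_all add: card_Diff_subset_Int card_mono le_add_diff_inverse2 inf_commute)
  ultimately show ?thesis by auto
qed

definition even_words :: "('n::{finite,linorder} \<Rightarrow> 2 + bool) set" where
  "even_words = {\<sigma>. even (card (odd_sites \<sigma>))}"

lemma Z_\<Lambda>_eq: "Z_\<Lambda> = cvec.span ((\<lambda>\<sigma>. eps False * monomial \<sigma>) ` (even_words :: ('n::{finite,linorder} \<Rightarrow> _) set))"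
proof -
  let ?G = "{(1 + K * Kb) * \<xi>_word A * \<xi>b_word B | A B. even (card A + card (B :: 'n set))}"
  let ?H = "(\<lambda>\<sigma>. eps False * monomial \<sigma>) ` (even_words :: ('n \<Rightarrow> _) set)"
  have L: "1 + K * Kb = (2 :: complex) *\<^sub>c (eps False :: 'n dk)"
    by (simp add: eps_def cscale_cscale cscale_one)
  have gen: "\<exists>c. c \<noteq> 0 \<and> (1 + K * Kb) * \<xi>_word A * \<xi>b_word B = c *\<^sub>c (eps False * monomial (letters_of A B))" for A B :: "'n set"
  proof -
    obtain c where c: "c * c = 1" "\<xi>_word A * \<xi>b_word B = c *\<^sub>c monomial (letters_of A B)"
      by (rule words_eq_monomial)
    show ?thesis
      using c(1) by (intro exI[of _ "2 * c"])
        (auto simp: mult.assoc c(2) L cscale_mult_left cscale_mult_right cscale_cscale)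
  qed
  show ?thesis
    unfolding Z_\<Lambda>_def
  proof (rule antisym; rule cvec.span_minimal[OF _ cvec.subspace_span]; safe)
    fix A B :: "'n set" assume e: "even (card A + card B)"
    obtain c where c: "(1 + K * Kb) * \<xi>_word A * \<xi>b_word B = c *\<^sub>c (eps False * monomial (letters_of A B))"
      using gen by blast
    have "letters_of A B \<in> even_words" using e by (simp add: even_words_def even_card_odd_sites_letters_of)
    then show "(1 + K * Kb) * \<xi>_word A * \<xi>b_word B \<in> cvec.span ?H"
      unfolding c by (intro cvec.span_scale cvec.span_base) auto
  next
    fix \<sigma> :: "'n \<Rightarrow> 2 + bool" assume e: "\<sigma> \<in> even_words"
    obtain c where c: "c \<noteq> 0" "(1 + K * Kb) * \<xi>_word (\<xi>_sites \<sigma>) * \<xi>b_word (\<xi>b_sites \<sigma>) = c *\<^sub>c (eps False * monomial \<sigma>)"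
      using gen[of "\<xi>_sites \<sigma>" "\<xi>b_sites \<sigma>"] by auto
    have "even (card (\<xi>_sites \<sigma>) + card (\<xi>b_sites \<sigma>))"
      using e even_card_odd_sites_letters_of[of "\<xi>_sites \<sigma>" "\<xi>b_sites \<sigma>"] by (simp add: even_words_def)
    then have "c *\<^sub>c (eps False * monomial \<sigma>) \<in> cvec.span ?G"
      unfolding c(2)[symmetric] by (intro cvec.span_base) blast
    then have "(1 / c) *\<^sub>c c *\<^sub>c (eps False * monomial \<sigma>) \<in> cvec.span ?G"
      by (rule cvec.span_scale)
    then show "eps False * monomial \<sigma> \<in> cvec.span ?G"
      using c(1) by (simp add: cscale_cscale cscale_one)
  qed
qed

text \<open>The factor 2 undoes the 1/2 in \<open>eps False\<close>, which spreads a word over the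
  group parts 1 and \<open>K * Kb\<close>.\<close>

definition ext_coeff :: "('n::{finite,linorder} \<Rightarrow> 2 + bool) \<Rightarrow> 'n dk \<Rightarrow> complex" where
  "ext_coeff \<sigma> x = 2 * pbw_coeff False False \<sigma> x"

lemma clinear_ext_coeff: "clinear (ext_coeff \<sigma>)"
  by (rule clinearI) (simp_all add: ext_coeff_def clinear_add[OF clinear_pbw_coeff]
      clinear_scale[OF clinear_pbw_coeff] cscale_complex_def distrib_left)

lemma ext_coeff_monomial: "ext_coeff \<sigma> (eps False * monomial \<tau>) = (if \<sigma> = \<tau> then 1 else 0)"
proof -
  have "eps False * monomial \<tau> = (1/2) *\<^sub>c pbw False False \<tau> + (1/2) *\<^sub>c pbw True True \<tau>"
    by (simp add: eps_def pbw_def cscale_mult_left distrib_right cscale_add_right cscale_one mult.assoc)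
  then show ?thesis
    by (simp add: ext_coeff_def clinear_add[OF clinear_pbw_coeff] clinear_scale[OF clinear_pbw_coeff]
        pbw_coeff_pbw cscale_complex_def)
qed

lemma Z_\<Lambda>_expansion:
  fixes x :: "'n::{finite,linorder} dk"
  assumes "x \<in> Z_\<Lambda>"
  shows "x = (\<Sum>\<sigma>\<in>even_words. ext_coeff \<sigma> x *\<^sub>c (eps False * monomial \<sigma>))"
proof (rule clinear_eq_on_span[where f = "\<lambda>x. x"])
  show "clinear (\<lambda>x :: 'n dk. x)" by (rule clinearI) auto
  show "clinear (\<lambda>x :: 'n dk. \<Sum>\<sigma>\<in>even_words. ext_coeff \<sigma> x *\<^sub>c (eps False * monomial \<sigma>))"
    by (rule clinearI) (simp_all add: clinear_add[OF clinear_ext_coeff] clinear_scale[OF clinear_ext_coeff]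
        cscale_add_left sum.distrib cscale_complex_def cscale_cscale cvec.scale_sum_right)
  show "x \<in> cvec.span ((\<lambda>\<sigma>. eps False * monomial \<sigma>) ` even_words)"
    using assms by (simp add: Z_\<Lambda>_eq)
  fix b :: "'n dk" assume "b \<in> (\<lambda>\<sigma>. eps False * monomial \<sigma>) ` even_words"
  then obtain \<tau> where "b = eps False * monomial \<tau>" "\<tau> \<in> even_words" by blast
  moreover have "(\<Sum>\<sigma>\<in>even_words. ext_coeff \<sigma> (eps False * monomial \<tau>) *\<^sub>c (eps False * monomial \<sigma>))
    = (\<Sum>\<sigma>\<in>even_words. if \<sigma> = \<tau> then eps False * monomial \<sigma> else 0)"
    unfolding ext_coeff_monomial by (rule sum.cong) (auto simp: cscale_one)
  ultimately show "b = (\<Sum>\<sigma>\<in>even_words. ext_coeff \<sigma> b *\<^sub>c (eps False * monomial \<sigma>))"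
    by simp
qed

text \<open>The matrix of \<open>g\<close> on one site: the defining representation plus two fixed
  odd letters. The first letter argument is the row, so columns are images of letters.\<close>

definition letter_matrix :: "int^2^2 \<Rightarrow> 2 + bool \<Rightarrow> 2 + bool \<Rightarrow> complex" where
  "letter_matrix g l l' = (case (l, l') of (Inl a, Inl b) \<Rightarrow> of_int (g $ a $ b)
     | (Inr a, Inr b) \<Rightarrow> of_bool (a = b) | _ \<Rightarrow> 0)"

definition word_matrix :: "int^2^2 \<Rightarrow> ('n::finite \<Rightarrow> 2 + bool) \<Rightarrow> ('n \<Rightarrow> 2 + bool) \<Rightarrow> complex" where
  "word_matrix g \<sigma> \<tau> = (\<Prod>i\<in>UNIV. letter_matrix g (\<sigma> i) (\<tau> i))"

lemma prod_letter_matrix: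
  fixes \<tau> :: "'n::{finite,linorder} \<Rightarrow> 2 + bool"
  assumes "\<And>i l. G i l = (\<Sum>l'\<in>UNIV. letter_matrix g l' l *\<^sub>c letter i l')"
  shows "prod_list (map (\<lambda>i. G i (\<tau> i)) sites) = (\<Sum>\<sigma>\<in>UNIV. word_matrix g \<sigma> \<tau> *\<^sub>c monomial \<sigma>)"
  unfolding assms
  by (simp add: prod_list_map_sum prod_list_map_cscale word_matrix_def PiE_UNIV_domain PiE_def extensional_def)

lemma S_letter_matrix: "S_letter i l = (\<Sum>l'\<in>UNIV. letter_matrix sl2_s l' l *\<^sub>c letter i l')"
  and T_letter_matrix: "T_letter i l = (\<Sum>l'\<in>UNIV. letter_matrix sl2_t l' l *\<^sub>c letter i l')"
  by (cases l rule: letter_cases; simp add: sum_letters letter_matrix_def sl2_s_def sl2_t_def vector_2 cscale_one)+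

lemma S_LM_word_matrix:
  fixes \<tau> :: "'n::{finite,linorder} \<Rightarrow> 2 + bool"
  assumes "\<tau> \<in> even_words"
  shows "S_LM (eps False * monomial \<tau>) = (top_value TYPE('n) / 2) *\<^sub>c
    (\<Sum>\<sigma>\<in>UNIV. word_matrix sl2_s \<sigma> \<tau> *\<^sub>c (eps False * monomial \<sigma>))"
  using assms
  by (simp add: S_LM_monomial even_words_def prod_letter_matrix[OF S_letter_matrix] sum_distrib_left cscale_mult_right
     del: letter.simps)

lemma T_LM_word_matrix:
  "T_LM (eps False * monomial \<tau>) = 1 *\<^sub>c (\<Sum>\<sigma>\<in>UNIV. word_matrix sl2_t \<sigma> \<tau> *\<^sub>c (eps False * monomial \<sigma>))"
  by (simp add: T_LM_monomial prod_letter_matrix[OF T_letter_matrix] sum_distrib_left cscale_mult_right cscale_one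
     del: letter.simps)

text \<open>A word is determined by its pattern of odd letters and the list of its even letters; the
  patterns with \<open>k\<close> even sites index the copies of the \<open>k\<close>-th tensor power.\<close>

definition pattern :: "('n \<Rightarrow> 2 + bool) \<Rightarrow> 'n \<Rightarrow> bool option" where
  "pattern \<sigma> i = (case \<sigma> i of Inl _ \<Rightarrow> None | Inr b \<Rightarrow> Some b)"

definition free_sites :: "('n::{finite,linorder} \<Rightarrow> bool option) \<Rightarrow> 'n list" where
  "free_sites p = filter (\<lambda>i. p i = None) sites"

text \<open>At a free site, \<open>the\<close> is meaningful only if the list is long enough; the
  lemmas about its entries use lists with exactly one entry for each free site.\<close>

definition fill :: "('n::{finite,linorder} \<Rightarrow> bool option) \<Rightarrow> 2 list \<Rightarrow> 'n \<Rightarrow> 2 + bool" where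
  "fill p is i = (case p i of Some b \<Rightarrow> Inr b | None \<Rightarrow> Inl (the (map_of (zip (free_sites p) is) i)))"

definition even_letters :: "('n::{finite,linorder} \<Rightarrow> 2 + bool) \<Rightarrow> 2 list" where
  "even_letters \<sigma> = map (\<lambda>i. projl (\<sigma> i)) (free_sites (pattern \<sigma>))"

lemma free_sites: "distinct (free_sites p)" "set (free_sites p) = {i. p i = None}"
  by (simp_all add: free_sites_def)

lemma length_free_sites: "length (free_sites p) = card {i. p i = None}"
  using distinct_card[OF free_sites(1), of p] by (simp add: free_sites(2))

lemma pattern_fill [simp]: "pattern (fill p is) = p"
  by (auto simp: pattern_def fill_def fun_eq_iff split: option.split)

lemma fill_free_sites:
  assumes "length is = length (free_sites p)" "m < length is"
  shows "fill p is (free_sites p ! m) = Inl (is ! m)"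
proof -
  have "p (free_sites p ! m) = None" using assms free_sites(2)[of p] nth_mem[of m "free_sites p"] by auto
  moreover have "map_of (zip (free_sites p) is) (free_sites p ! m) = Some (is ! m)"
    by (rule map_of_zip_nth) (use assms free_sites(1) in auto)
  ultimately show ?thesis by (simp add: fill_def)
qed

lemma even_letters_fill:
  assumes "length is = length (free_sites p)"
  shows "even_letters (fill p is) = is"
  unfolding even_letters_def pattern_fill
  by (rule nth_equalityI) (use assms fill_free_sites[OF assms] in auto)

lemma fill_even_letters: "fill (pattern \<sigma>) (even_letters \<sigma>) = \<sigma>"
proof
  fix i
  show "fill (pattern \<sigma>) (even_letters \<sigma>) i = \<sigma> i"
  proof (cases "\<sigma> i")
    case (Inl a)
    then have "i \<in> set (free_sites (pattern \<sigma>))" by (simp add: free_sites pattern_def)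
    then obtain m where m: "m < length (free_sites (pattern \<sigma>))" "free_sites (pattern \<sigma>) ! m = i"
      by (auto simp: in_set_conv_nth)
    then have "fill (pattern \<sigma>) (even_letters \<sigma>) i = Inl (even_letters \<sigma> ! m)"
      using fill_free_sites[of "even_letters \<sigma>" "pattern \<sigma>" m] by (simp add: even_letters_def)
    then show ?thesis using m Inl by (simp add: even_letters_def)
  next
    case (Inr b)
    then show ?thesis by (simp add: fill_def pattern_def)
  qed
qed

lemma length_even_letters: "length (even_letters \<sigma>) = card {i. pattern \<sigma> i = None}"
  by (simp add: even_letters_def length_free_sites)

lemma card_odd_sites: "card (odd_sites \<sigma>) + card {i. pattern \<sigma> i = None} = CARD('n)"
  for \<sigma> :: "'n::finite \<Rightarrow> 2 + bool"
proof -
  have "odd_sites \<sigma> = - {i. pattern \<sigma> i = None}"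
  proof (rule set_eqI)
    fix i show "i \<in> odd_sites \<sigma> \<longleftrightarrow> i \<in> - {i. pattern \<sigma> i = None}"
      by (cases "\<sigma> i") (simp_all add: odd_sites_def pattern_def)
  qed
  then show ?thesis by (simp add: Compl_eq_Diff_UNIV card_Diff_subset card_mono)
qed

lemma word_matrix_fill:
  assumes "length is = length (free_sites p)" "length js = length (free_sites p)"
  shows "word_matrix g (fill p is) (fill p js) = (\<Prod>m<length (free_sites p). of_int (g $ (is ! m) $ (js ! m)))"
proof -
  have "word_matrix g (fill p is) (fill p js)
    = (\<Prod>i\<in>set (free_sites p). letter_matrix g (fill p is i) (fill p js i))"
    unfolding word_matrix_def free_sites(2)
    by (rule prod.mono_neutral_right) (auto simp: letter_matrix_def fill_def split: option.splits)
  also have "\<dots> = (\<Prod>m<length (free_sites p). letter_matrix g (fill p is (free_sites p ! m)) (fill p js (free_sites p ! m)))"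
    by (rule prod.reindex_bij_betw[symmetric, OF bij_betw_nth[OF free_sites(1)]]) auto
  also have "\<dots> = (\<Prod>m<length (free_sites p). of_int (g $ (is ! m) $ (js ! m)))"
    by (rule prod.cong) (use assms in \<open>auto simp: fill_free_sites letter_matrix_def\<close>)
  finally show ?thesis .
qed

lemma word_matrix_pattern:
  assumes "pattern \<sigma> \<noteq> pattern \<tau>"
  shows "word_matrix g \<sigma> \<tau> = 0"
proof -
  obtain i where "pattern \<sigma> i \<noteq> pattern \<tau> i" using assms by (auto simp: fun_eq_iff)
  then have "letter_matrix g (\<sigma> i) (\<tau> i) = 0"
    by (auto simp: letter_matrix_def pattern_def split: sum.splits)
  then show ?thesis unfolding word_matrix_def by (intro prod_zero) auto
qed

lemma card_patterns:
  "card {p :: 'n::finite \<Rightarrow> bool option. card {i. p i = None} = k} = (CARD('n) choose k) * 2 ^ (CARD('n) - k)"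
proof -
  let ?P = "\<lambda>R. {p :: 'n \<Rightarrow> bool option. {i. p i = None} = R}"
  have card_P: "card (?P R) = 2 ^ (CARD('n) - card R)" for R
  proof -
    have "?P R = PiE UNIV (\<lambda>i. if i \<in> R then {None} else {Some False, Some True})"
    proof (intro equalityI subsetI)
      fix p assume "p \<in> ?P R"
      then have "p i = None \<longleftrightarrow> i \<in> R" for i by auto
      moreover have "p i \<in> {None, Some False, Some True}" for i by (cases "p i") auto
      ultimately show "p \<in> PiE UNIV (\<lambda>i. if i \<in> R then {None} else {Some False, Some True})"
        by (auto simp: PiE_UNIV_domain) (metis (full_types) insertE singletonD)+
    next
      fix p assume p: "p \<in> PiE UNIV (\<lambda>i. if i \<in> R then {None} else {Some False, Some True})"
      have "p i = None \<longleftrightarrow> i \<in> R" for i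
        using PiE_mem[OF p, of i] by (auto split: if_splits)
      then show "p \<in> ?P R" by auto
    qed
    then have "card (?P R) = (\<Prod>i\<in>UNIV. if i \<in> R then 1 else 2)"
      by (simp add: card_PiE if_distrib[of card] numeral_2_eq_2 cong: if_cong)
    also have "\<dots> = 2 ^ card (- R)"
      by (simp add: prod.If_cases)
    finally show ?thesis by (simp add: Compl_eq_Diff_UNIV card_Diff_subset)
  qed
  have "{p :: 'n \<Rightarrow> bool option. card {i. p i = None} = k} = (\<Union>R\<in>{R. card R = k}. ?P R)"
    by auto
  also have "card \<dots> = (\<Sum>R\<in>{R :: 'n set. card R = k}. card (?P R))"
    by (rule card_UN_disjoint) auto
  also have "\<dots> = (\<Sum>R\<in>{R :: 'n set. card R = k}. 2 ^ (CARD('n) - k))"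
    by (rule sum.cong) (simp_all add: card_P)
  also have "\<dots> = (CARD('n) choose k) * 2 ^ (CARD('n) - k)"
    using n_subsets[of "UNIV :: 'n set" k] by simp
  finally show ?thesis .
qed

lemma bij_pattern_index:
  "\<exists>J. bij_betw J {..<(CARD('n) choose k) * 2 ^ (CARD('n) - k)} {p :: 'n::finite \<Rightarrow> bool option. card {i. p i = None} = k}"
  by (rule finite_same_card_bij) (simp_all add: card_patterns)

text \<open>The copies in the decomposition are numbered, so the patterns with \<open>k\<close> even
  sites are numbered by an arbitrary bijection.\<close>

definition pattern_at :: "nat \<Rightarrow> nat \<Rightarrow> 'n::finite \<Rightarrow> bool option" where
  "pattern_at k = (SOME J. bij_betw J {..<(CARD('n) choose k) * 2 ^ (CARD('n) - k)}
     {p :: 'n \<Rightarrow> bool option. card {i. p i = None} = k})"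

lemma bij_pattern_at:
  "bij_betw (pattern_at k) {..<(CARD('n) choose k) * 2 ^ (CARD('n) - k)} {p :: 'n::finite \<Rightarrow> bool option. card {i. p i = None} = k}"
  unfolding pattern_at_def by (rule someI_ex[OF bij_pattern_index])

definition copies :: "'n::finite itself \<Rightarrow> (nat \<times> nat) set" where
  "copies _ = {(k, j). k \<le> CARD('n) \<and> even k \<and> j < (CARD('n) choose k) * 2 ^ (CARD('n) - k)}"

definition word_at :: "nat \<times> nat \<Rightarrow> 2 list \<Rightarrow> 'n::{finite,linorder} \<Rightarrow> 2 + bool" where
  "word_at kj is = fill (pattern_at (fst kj) (snd kj)) is"

definition copy_of :: "('n::{finite,linorder} \<Rightarrow> 2 + bool) \<Rightarrow> nat \<times> nat" where
  "copy_of \<sigma> = (let k = card {i. pattern \<sigma> i = None}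
     in (k, the_inv_into {..<(CARD('n) choose k) * 2 ^ (CARD('n) - k)} (pattern_at k) (pattern \<sigma>)))"

lemma card_pattern_at:
  assumes "(k, j) \<in> copies TYPE('n)"
  shows "card {i. (pattern_at k j :: 'n::finite \<Rightarrow> bool option) i = None} = k"
  using assms bij_betwE[OF bij_pattern_at[where 'n = 'n, of k]] by (auto simp: copies_def)

lemma length_free_sites_pattern_at:
  assumes "(k, j) \<in> copies TYPE('n)"
  shows "length (free_sites (pattern_at k j :: 'n::{finite,linorder} \<Rightarrow> bool option)) = k"
  using card_pattern_at[OF assms] by (simp add: length_free_sites)

lemma copy_of_word_at:
  assumes "kj \<in> copies TYPE('n)" "length is = fst kj"
  shows "copy_of (word_at kj is :: 'n::{finite,linorder} \<Rightarrow> 2 + bool) = kj"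
    and "even_letters (word_at kj is :: 'n \<Rightarrow> 2 + bool) = is"
proof -
  obtain k j where kj: "kj = (k, j)" by (cases kj)
  show "copy_of (word_at kj is :: 'n \<Rightarrow> 2 + bool) = kj"
    using assms card_pattern_at[of k j, where 'n = 'n] bij_betw_imp_inj_on[OF bij_pattern_at[where 'n = 'n, of k]]
    by (simp add: copy_of_def word_at_def kj the_inv_into_f_f copies_def)
  show "even_letters (word_at kj is :: 'n \<Rightarrow> 2 + bool) = is"
    using assms length_free_sites_pattern_at[of k j, where 'n = 'n]
    by (simp add: word_at_def kj even_letters_fill)
qed

text \<open>Odd and even sites add up to the number of all sites. If that is even, a word with an
  even number of odd letters also has an even number of even letters, which is why only even
  \<open>k\<close> occur.\<close>

lemma pattern_at_copy_of: "pattern_at (fst (copy_of \<sigma>)) (snd (copy_of \<sigma>)) = pattern \<sigma>"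
  and copy_of_in_copies: "even CARD('n) \<Longrightarrow> \<sigma> \<in> even_words \<Longrightarrow> copy_of \<sigma> \<in> copies TYPE('n)"
  and fst_copy_of: "fst (copy_of \<sigma>) = length (even_letters \<sigma>)"
  for \<sigma> :: "'n::{finite,linorder} \<Rightarrow> 2 + bool"
proof -
  define k where "k = card {i. pattern \<sigma> i = None}"
  define j where "j = the_inv_into {..<(CARD('n) choose k) * 2 ^ (CARD('n) - k)} (pattern_at k) (pattern \<sigma>)"
  have c: "copy_of \<sigma> = (k, j)" by (simp add: copy_of_def k_def j_def Let_def)
  have "pattern \<sigma> \<in> {p. card {i. p i = None} = k}" by (simp add: k_def)
  then have m: "pattern \<sigma> \<in> pattern_at k ` {..<(CARD('n) choose k) * 2 ^ (CARD('n) - k)}"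
    using bij_betw_imp_surj_on[OF bij_pattern_at[where 'n = 'n, of k]] by simp
  note inj = bij_betw_imp_inj_on[OF bij_pattern_at[where 'n = 'n, of k]]
  show "pattern_at (fst (copy_of \<sigma>)) (snd (copy_of \<sigma>)) = pattern \<sigma>"
    unfolding c using f_the_inv_into_f[OF inj m] by (simp add: j_def)
  show "fst (copy_of \<sigma>) = length (even_letters \<sigma>)"
    by (simp add: c length_even_letters k_def)
  show "copy_of \<sigma> \<in> copies TYPE('n)" if "even CARD('n)" "\<sigma> \<in> even_words"
  proof -
    have n: "card (odd_sites \<sigma>) + k = CARD('n)" by (simp add: k_def card_odd_sites)
    have "even (card (odd_sites \<sigma>) + k)" unfolding n by (rule that)
    then have "even k" using that(2) by (simp only: even_words_def mem_Collect_eq even_add)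
    moreover have "k \<le> CARD('n)" using n by simp
    moreover have "j < (CARD('n) choose k) * 2 ^ (CARD('n) - k)"
      using the_inv_into_into[OF inj m order_refl] by (simp add: j_def)
    ultimately show ?thesis by (simp add: c copies_def)
  qed
qed

lemma word_at_copy_of: "word_at (copy_of \<sigma>) (even_letters \<sigma>) = \<sigma>"
  by (simp add: word_at_def pattern_at_copy_of fill_even_letters)

lemma word_at_even:
  assumes "kj \<in> copies TYPE('n)" "even CARD('n)" "length is = fst kj"
  shows "(word_at kj is :: 'n::{finite,linorder} \<Rightarrow> 2 + bool) \<in> even_words"
proof -
  obtain k j where kj: "kj = (k, j)" by (cases kj)
  have "card {i. pattern (word_at kj is :: 'n \<Rightarrow> 2 + bool) i = None} = k"
    using assms(1) card_pattern_at[of k j, where 'n = 'n] by (simp add: word_at_def kj)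
  then have "card (odd_sites (word_at kj is :: 'n \<Rightarrow> 2 + bool)) + k = CARD('n)"
    using card_odd_sites[of "word_at kj is :: 'n \<Rightarrow> 2 + bool"] by simp
  then have "even (card (odd_sites (word_at kj is :: 'n \<Rightarrow> 2 + bool)) + k)"
    using assms(2) by (simp only:)
  then show ?thesis using assms(1) by (simp only: even_add) (simp add: even_words_def kj copies_def)
qed

section \<open>Coordinates on \<open>Z_\<Lambda>\<close> and their intertwining property\<close>

definition ext_coords :: "'n::{finite,linorder} dk \<Rightarrow> nat \<times> nat \<Rightarrow> 2 list \<Rightarrow> complex" where
  "ext_coords x kj is = (if kj \<in> copies TYPE('n) \<and> length is = fst kj then ext_coeff (word_at kj is) x else 0)"

lemma clinear_ext_coords: "clinear ext_coords"
  by (rule clinearI) (auto simp: ext_coords_def fun_eq_iff cscale_fun_def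
      clinear_add[OF clinear_ext_coeff] clinear_scale[OF clinear_ext_coeff] cscale_complex_def)

abbreviation Z_rep :: "'n::finite itself \<Rightarrow> (nat \<times> nat \<Rightarrow> 2 list \<Rightarrow> complex) rep" where
  "Z_rep T \<equiv> rep_Sum (copies T) (\<lambda>(k, j). std_power k)"

lemma rep_act_Z_rep:
  "rep_act (Z_rep T) g f kj is = (if kj \<in> copies T \<and> length is = fst kj
     then \<Sum>js | length js = fst kj. (\<Prod>m<fst kj. of_int (g $ (is ! m) $ (js ! m))) * f kj js else 0)"
  by (cases kj) (auto simp: rep_Sum_def std_power_def)

lemma clinear_rep_act_Z_rep: "clinear (rep_act (Z_rep T) g)"
  by (rule clinearI)
    (auto simp: fun_eq_iff rep_act_Z_rep cscale_fun_def cscale_complex_def distrib_left distrib_right sum.distrib sum_distrib_left mult_ac)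

lemma rep_space_Z_rep:
  "f \<in> rep_space (Z_rep T) \<longleftrightarrow> (\<forall>kj is. \<not> (kj \<in> copies T \<and> length is = fst kj) \<longrightarrow> f kj is = 0)"
  unfolding rep_Sum_def std_power_def
  by (auto simp: fun_eq_iff split: prod.splits)

lemma bij_ext_coords:
  assumes "even CARD('n::{finite,linorder})"
  shows "bij_betw ext_coords (Z_\<Lambda> :: 'n dk set) (rep_space (Z_rep TYPE('n)))"
proof (rule bij_betwI')
  fix x y :: "'n dk" assume xy: "x \<in> Z_\<Lambda>" "y \<in> Z_\<Lambda>"
  show "ext_coords x = ext_coords y \<longleftrightarrow> x = y"
  proof
    assume eq: "ext_coords x = ext_coords y"
    have "ext_coeff \<sigma> x = ext_coeff \<sigma> y" if "\<sigma> \<in> even_words" for \<sigma>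
      using fun_cong[OF fun_cong[OF eq, of "copy_of \<sigma>"], of "even_letters \<sigma>"] copy_of_in_copies[OF assms that]
      by (simp add: ext_coords_def fst_copy_of word_at_copy_of )
    then show "x = y"
      by (subst Z_\<Lambda>_expansion[OF xy(1)], subst Z_\<Lambda>_expansion[OF xy(2)]) (auto intro: sum.cong)
  qed simp
next
  fix x :: "'n dk"
  show "ext_coords x \<in> rep_space (Z_rep TYPE('n))"
    unfolding rep_space_Z_rep by (simp only: ext_coords_def if_False simp_thms) simp
next
  fix f assume f: "f \<in> rep_space (Z_rep TYPE('n))"
  define x :: "'n dk" where "x = (\<Sum>\<sigma>\<in>even_words. f (copy_of \<sigma>) (even_letters \<sigma>) *\<^sub>c (eps False * monomial \<sigma>))"
  have "x \<in> Z_\<Lambda>"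
    unfolding x_def Z_\<Lambda>_eq by (intro cvec.span_sum cvec.span_scale cvec.span_base) auto
  moreover have "ext_coeff \<tau> x = f (copy_of \<tau>) (even_letters \<tau>)" if "\<tau> \<in> even_words" for \<tau> :: "'n \<Rightarrow> _"
  proof -
    have "ext_coeff \<tau> x = (\<Sum>\<sigma>\<in>even_words. if \<sigma> = \<tau> then f (copy_of \<tau>) (even_letters \<tau>) else 0)"
      unfolding x_def clinear_sum[OF clinear_ext_coeff]
      by (rule sum.cong) (auto simp: clinear_scale[OF clinear_ext_coeff] ext_coeff_monomial cscale_complex_def)
    then show ?thesis using that by simp
  qed
  then have "ext_coords x kj is = f kj is" for kj "is"
    using f[unfolded rep_space_Z_rep, rule_format, of kj "is"] word_at_even[OF _ assms, of kj "is"]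
    by (cases "kj \<in> copies TYPE('n) \<and> length is = fst kj") (auto simp: ext_coords_def copy_of_word_at)
  then have "f = ext_coords x" by (intro ext) simp
  ultimately show "\<exists>x\<in>(Z_\<Lambda> :: 'n dk set). f = ext_coords x" by (rule bexI[rotated])
qed

text \<open>Both sides are linear in \<open>x\<close>, so it is enough to compare them on basis
  words. There the coordinates of the image are, up to \<open>c\<close>, a column of
  \<open>word_matrix\<close>, which vanishes off the pattern of the word and is a Kronecker power of
  \<open>g\<close> within it.\<close>

lemma ext_coords_intertwine:
  fixes F :: "'n::{finite,linorder} dk \<Rightarrow> 'n dk"
  assumes n: "even CARD('n)" and lin: "clinear F"
    and F: "\<And>\<tau>. \<tau> \<in> even_words \<Longrightarrow> F (eps False * monomial \<tau>)
      = c *\<^sub>c (\<Sum>\<sigma>\<in>UNIV. word_matrix g \<sigma> \<tau> *\<^sub>c (eps False * monomial \<sigma>))"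
    and x: "x \<in> Z_\<Lambda>"
  shows "ext_coords (F x) = c *\<^sub>c rep_act (Z_rep TYPE('n)) g (ext_coords x)"
proof (rule clinear_eq_on_span)
  show "clinear (\<lambda>x. ext_coords (F x))" by (rule clinear_comp[OF clinear_ext_coords lin])
  show "clinear (\<lambda>x. c *\<^sub>c rep_act (Z_rep TYPE('n)) g (ext_coords (x :: 'n dk)))"
    by (rule clinearI) (simp_all add: clinear_add[OF clinear_ext_coords] clinear_scale[OF clinear_ext_coords]
        clinear_add[OF clinear_rep_act_Z_rep] clinear_scale[OF clinear_rep_act_Z_rep] cscale_add_right cscale_cscale mult.commute)
  show "x \<in> cvec.span ((\<lambda>\<sigma>. eps False * monomial \<sigma>) ` even_words)" using x by (simp add: Z_\<Lambda>_eq)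
  fix b :: "'n dk" assume "b \<in> (\<lambda>\<sigma>. eps False * monomial \<sigma>) ` even_words"
  then obtain \<tau> where b: "b = eps False * monomial \<tau>" and \<tau>: "\<tau> \<in> even_words" by blast
  show "ext_coords (F b) = c *\<^sub>c rep_act (Z_rep TYPE('n)) g (ext_coords b)"
  proof (intro ext)
    fix kj and "is" :: "2 list"
    show "ext_coords (F b) kj is = (c *\<^sub>c rep_act (Z_rep TYPE('n)) g (ext_coords b)) kj is"
    proof (cases "kj \<in> copies TYPE('n) \<and> length is = fst kj")
      case False
      then show ?thesis by (auto simp: ext_coords_def rep_act_Z_rep cscale_fun_def cscale_complex_def)
    next
      case True
      define p where "p = (pattern_at (fst kj) (snd kj) :: 'n \<Rightarrow> bool option)"
      have len: "length (free_sites p) = fst kj"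
        using True length_free_sites_pattern_at[of "fst kj" "snd kj", where 'n = 'n] by (simp add: p_def case_prod_unfold)
      let ?B = "\<lambda>js. word_at kj js :: 'n \<Rightarrow> 2 + bool"
      have L: "ext_coords (F b) kj is = c * word_matrix g (?B is) \<tau>"
      proof -
        have "ext_coeff (?B is) (F b) = c * (\<Sum>\<sigma>\<in>UNIV. word_matrix g \<sigma> \<tau> * (if ?B is = \<sigma> then 1 else 0))"
          unfolding b F[OF \<tau>] clinear_scale[OF clinear_ext_coeff] clinear_sum[OF clinear_ext_coeff] ext_coeff_monomial
          by (simp only: cscale_complex_def)
        also have "(\<Sum>\<sigma>\<in>UNIV. word_matrix g \<sigma> \<tau> * (if ?B is = \<sigma> then 1 else 0)) = word_matrix g (?B is) \<tau>"
          by (simp add: if_distrib[of "(*) _"] cong: if_cong)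
        finally have "ext_coeff (?B is) (F b) = c * word_matrix g (?B is) \<tau>" .
        then show ?thesis using True by (simp add: ext_coords_def)
      qed
      have R: "rep_act (Z_rep TYPE('n)) g (ext_coords b) kj is
        = (\<Sum>js | length js = fst kj. (\<Prod>m<fst kj. of_int (g $ (is ! m) $ (js ! m))) * (if ?B js = \<tau> then 1 else 0))"
        unfolding rep_act_Z_rep using True
        by (auto simp: ext_coords_def b ext_coeff_monomial intro!: sum.cong)
      have "word_matrix g (?B is) \<tau> = (\<Sum>js | length js = fst kj. (\<Prod>m<fst kj. of_int (g $ (is ! m) $ (js ! m))) * (if ?B js = \<tau> then 1 else 0))"
      proof (cases "p = pattern \<tau>")
        case False
        then have "?B js \<noteq> \<tau>" for js by (auto simp: word_at_def p_def)
        moreover have "word_matrix g (?B is) \<tau> = 0"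
          using False by (intro word_matrix_pattern) (simp add: word_at_def p_def)
        ultimately show ?thesis by simp
      next
        case p: True
        have lt: "length (even_letters \<tau>) = fst kj" using len by (simp add: p even_letters_def)
        have B: "?B (even_letters \<tau>) = \<tau>" using p by (simp add: word_at_def p_def fill_even_letters)
        have "?B js = \<tau> \<longleftrightarrow> js = even_letters \<tau>" if "length js = fst kj" for js
          using B copy_of_word_at(2)[of kj js, where 'n = 'n] True that by auto
        then have "(\<Sum>js | length js = fst kj. (\<Prod>m<fst kj. of_int (g $ (is ! m) $ (js ! m))) * (if ?B js = \<tau> then 1 else 0))
          = (\<Sum>js | length js = fst kj. if js = even_letters \<tau> then (\<Prod>m<fst kj. of_int (g $ (is ! m) $ (js ! m))) else (0::complex))"
          by (intro sum.cong) auto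
        also have "\<dots> = (\<Prod>m<fst kj. of_int (g $ (is ! m) $ (even_letters \<tau> ! m)))"
          using lt finite_lists_length_eq[of "UNIV :: 2 set" "fst kj"] by simp
        also have "\<dots> = word_matrix g (?B is) (?B (even_letters \<tau>))"
          using word_matrix_fill[of "is" p "even_letters \<tau>" g] True lt len by (simp add: word_at_def p_def)
        finally show ?thesis by (simp add: B)
      qed
      then show ?thesis by (simp add: L R cscale_fun_def cscale_complex_def)
    qed
  qed
qed

text \<open>\<open>word_matrix\<close> preserves the pattern and hence the number of odd letters, so
  an even word goes to a combination of even words.\<close>

lemma Z_\<Lambda>_stable:
  fixes F :: "'n::{finite,linorder} dk \<Rightarrow> 'n dk"
  assumes n: "even CARD('n)" and lin: "clinear F"
    and F: "\<And>\<tau>. \<tau> \<in> even_words \<Longrightarrow> F (eps False * monomial \<tau>)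
      = c *\<^sub>c (\<Sum>\<sigma>\<in>UNIV. word_matrix g \<sigma> \<tau> *\<^sub>c (eps False * monomial \<sigma>))"
  shows "F ` Z_\<Lambda> \<subseteq> Z_\<Lambda>"
proof -
  have base: "F (eps False * monomial \<tau>) \<in> Z_\<Lambda>" if \<tau>: "\<tau> \<in> even_words" for \<tau>
  proof -
    have "word_matrix g \<sigma> \<tau> *\<^sub>c (eps False * monomial \<sigma>) \<in> Z_\<Lambda>" for \<sigma>
    proof (cases "pattern \<sigma> = pattern \<tau>")
      case True
      then have "card (odd_sites \<sigma>) = card (odd_sites \<tau>)"
        using card_odd_sites[of \<sigma>] card_odd_sites[of \<tau>] by simp
      then show ?thesis using \<tau> unfolding Z_\<Lambda>_eq
        by (intro cvec.span_scale cvec.span_base) (auto simp: even_words_def)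
    next
      case False
      then show ?thesis by (simp add: word_matrix_pattern Z_\<Lambda>_eq cvec.span_zero)
    qed
    then show ?thesis unfolding F[OF \<tau>] Z_\<Lambda>_eq
      by (intro cvec.span_scale[OF cvec.span_sum])
  qed
  have "F x \<in> Z_\<Lambda>" if "x \<in> Z_\<Lambda>" for x
    using that[unfolded Z_\<Lambda>_eq]
  proof (induction rule: cvec.span_induct_alt)
    case base show ?case by (simp add: clinear_0[OF lin] Z_\<Lambda>_eq cvec.span_zero)
  next
    case (step d b y)
    then have "F b \<in> Z_\<Lambda>" using base by auto
    then show ?case using step
      by (simp add: clinear_add[OF lin] clinear_scale[OF lin] Z_\<Lambda>_eq cvec.span_add cvec.span_scale)
  qed
  then show ?thesis by blast
qed

lemma subspace_center: "cvec.subspace (center :: 'a::calgebra set)"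
  by (rule cvec.subspaceI) (auto simp: center_def distrib_left distrib_right cscale_mult_left cscale_mult_right)

lemma Z_\<Lambda>_decomposes:
  assumes "even CARD('n::{finite,linorder})"
  shows "proj_decomposes_as (Z_\<Lambda> :: 'n dk set) (Z_rep TYPE('n))"
  unfolding proj_decomposes_as_def
proof (intro conjI exI ballI)
  show "cvec.subspace (Z_\<Lambda> :: 'n dk set)" by (simp add: Z_\<Lambda>_eq)
  show "(Z_\<Lambda> :: 'n dk set) \<subseteq> center"
    unfolding Z_\<Lambda>_eq
    by (rule cvec.span_minimal[OF _ subspace_center]) (auto simp: even_words_def eps_monomial_center)
  show "S_LM ` (Z_\<Lambda> :: 'n dk set) \<subseteq> Z_\<Lambda>"
    by (rule Z_\<Lambda>_stable[OF assms clinear_S_LM S_LM_word_matrix])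
  show "T_LM ` (Z_\<Lambda> :: 'n dk set) \<subseteq> Z_\<Lambda>"
    by (rule Z_\<Lambda>_stable[OF assms clinear_T_LM T_LM_word_matrix])
  show "clinear (ext_coords :: 'n dk \<Rightarrow> _)" by (rule clinear_ext_coords)
  show "bij_betw ext_coords (Z_\<Lambda> :: 'n dk set) (rep_space (Z_rep TYPE('n)))" by (rule bij_ext_coords[OF assms])
  show "top_value TYPE('n) / 2 \<noteq> 0" using cointegral_pbw(3)[where 'n = 'n] by simp
  show "(1::complex) \<noteq> 0" by simp
  fix x :: "'n dk" assume x: "x \<in> Z_\<Lambda>"
  show "ext_coords (S_LM x) = (top_value TYPE('n) / 2) *\<^sub>c rep_act (Z_rep TYPE('n)) sl2_s (ext_coords x)"
    by (rule ext_coords_intertwine[OF assms clinear_S_LM S_LM_word_matrix x])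
  show "ext_coords (T_LM x) = 1 *\<^sub>c rep_act (Z_rep TYPE('n)) sl2_t (ext_coords x)"
    by (rule ext_coords_intertwine[OF assms clinear_T_LM T_LM_word_matrix x])
qed

section \<open>Decomposition of the Higman ideal\<close>

definition adjoint :: "'n dk \<Rightarrow> ('n dk, 'n dk) tensor \<Rightarrow> 'n dk" where
  "adjoint x = tlift (\<lambda>a b. antipode b * x * a)"

definition hact :: "'n dk \<Rightarrow> 'n dk \<Rightarrow> 'n dk" where
  "hact y x = adjoint x (comult y)"

lemma cbilinear_adjoint: "cbilinear (\<lambda>a b. antipode b * x * (a :: 'n dk))"
  by (rule cbilinearI)
    (simp_all add: clinear_add[OF antipode_antihom(1)] clinear_scale[OF antipode_antihom(1)]
      distrib_left distrib_right cscale_mult_left cscale_mult_right)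

lemma adjoint_tens: "adjoint x (c \<otimes>\<^sub>c d) = antipode d * x * c"
  unfolding adjoint_def by (rule tlift_tens[OF cbilinear_adjoint])

lemma clinear_adjoint: "clinear (adjoint x)"
  unfolding adjoint_def by (rule clinear_tlift[OF cbilinear_adjoint])

lemma adjoint_linear:
  "adjoint (x + y) t = adjoint x t + adjoint y t" "adjoint (c *\<^sub>c x) t = c *\<^sub>c adjoint x t"
  by (induction t rule: tensor_induct)
    (simp_all add: adjoint_tens clinear_add[OF clinear_adjoint] distrib_left distrib_right
      cscale_mult_left cscale_mult_right cscale_add_right add_ac)

lemma adjoint_mult: "adjoint x (s * t) = adjoint (adjoint x s) t"
proof (induction s rule: tensor_induct)
  case (tens c d)
  show ?case
    by (induction t rule: tensor_induct)
      (simp_all add: adjoint_tens antipode_antihom mult.assoc distrib_left clinear_add[OF clinear_adjoint])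
next
  case (add s s')
  then show ?case by (simp add: distrib_right clinear_add[OF clinear_adjoint] adjoint_linear)
qed

lemma clinear_hact: "clinear (hact y)" "clinear (\<lambda>y. hact y x)"
  by (rule clinearI; simp add: hact_def adjoint_linear clinear_add[OF comult_hom(1)] clinear_scale[OF comult_hom(1)]
      clinear_add[OF clinear_adjoint] clinear_scale[OF clinear_adjoint])+

text \<open>The coproduct is multiplicative and the antipode reverses products, so this is a right
  action. A product such as the integral can therefore be applied one factor after another.\<close>

lemma hact_mult: "hact (y * z) x = hact z (hact y x)"
  by (simp add: hact_def comult_hom adjoint_mult)

lemma hact_one: "hact 1 x = x"
  by (simp add: hact_def comult_hom one_tensor_def adjoint_tens antipode_antihom)

lemma hact_gen:
  "hact K x = K * (x * K)" "hact Kb x = Kb * (x * Kb)"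
  "hact (\<xi> i) x = x * \<xi> i - K * (\<xi> i * (x * K))" "hact (\<xi>b i) x = x * \<xi>b i - Kb * (\<xi>b i * (x * Kb))"
  by (simp_all add: hact_def comult_hom adjoint_tens antipode_antihom mult.assoc
      clinear_add[OF clinear_adjoint])

text \<open>\<open>K\<close> is its own inverse, so the balancing element enters as a right
  multiplication by \<open>K\<close>, separate from the adjoint action.\<close>

lemma higman_map_hact: "higman_map x = hact integral_elt x * K"
proof -
  have K: "alg_inverse K = (K :: 'a dk)" by (rule alg_inverse_eqI) (simp_all add: dk_relations)
  have c: "clinear (\<lambda>y :: 'a dk. y * K)" by (rule clinearI) (simp_all add: distrib_right cscale_mult_left)
  have bil: "cbilinear (\<lambda>a b. antipode b * x * a * (K :: 'a dk))"
    using cbilinearD[OF cbilinear_adjoint[of x]]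
    by (intro cbilinearI) (simp_all add: distrib_right cscale_mult_left)
  have "tlift (\<lambda>a b. antipode b * x * a * K) t = adjoint x t * K" for t
    by (induction t rule: tensor_induct)
      (simp_all only: tlift_tens[OF bil] adjoint_tens clinear_add[OF clinear_tlift[OF bil]]
        clinear_add[OF clinear_adjoint] distrib_right)
  then show ?thesis by (simp add: higman_map_def hact_def K)
qed

lemma clinear_higman_map: "clinear higman_map"
  unfolding higman_map_hact
  by (rule clinearI) (simp_all add: clinear_add[OF clinear_hact(1)] clinear_scale[OF clinear_hact(1)]
      distrib_right cscale_mult_left)

section \<open>The adjoint action of the integral, site by site\<close>

definition hig_scalar :: "bool \<Rightarrow> bool \<Rightarrow> 2 + bool \<Rightarrow> complex" where
  "hig_scalar h a l = (if l = Inl 2 \<and> \<not> a then 4 else if l = Inl 1 \<and> h then if a then 4 else - 4 else 0)"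

definition hig_letter :: "bool \<Rightarrow> bool \<Rightarrow> 'n \<Rightarrow> 'n dk" where
  "hig_letter h a i = (if h then if a then 1 else 1 - \<xi> i * \<xi>b i else letter i (Inl 1))"

text \<open>\<open>Z\<close> stands for the remaining letters. Its signs against the generators are
  those of \<open>l\<close>, so that \<open>letter i l * Z\<close> is even in total, and the last
  hypothesis places \<open>Z\<close> in the block \<open>h\<close>. The sixteen cases of block,
  power of \<open>K\<close> and letter yield the values of \<open>hig_scalar\<close> and
  \<open>hig_letter\<close>; odd letters are always annihilated.\<close>

lemma hact_site:
  fixes Z :: "'n dk"
  assumes "Z * K = parity_sign l *\<^sub>c (K * Z)" "Z * Kb = parity_sign l *\<^sub>c (Kb * Z)"
    and "Z * \<xi> i = parity_sign l *\<^sub>c (\<xi> i * Z)" "Z * \<xi>b i = parity_sign l *\<^sub>c (\<xi>b i * Z)"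
    and L: "Kb * Z = (if h then - 1 else 1) *\<^sub>c (K * Z)"
  shows "hact (letter i (Inl 1)) (K ^ of_bool a * (letter i l * Z))
    = hig_scalar h a l *\<^sub>c (K ^ of_bool a * (hig_letter h a i * Z))"
proof -
  define s where "s = parity_sign l"
  have move: "Z * (K * w) = s *\<^sub>c (K * (Z * w))" "Z * (Kb * w) = s *\<^sub>c (Kb * (Z * w))"
    "Z * (\<xi> i * w) = s *\<^sub>c (\<xi> i * (Z * w))" "Z * (\<xi>b i * w) = s *\<^sub>c (\<xi>b i * (Z * w))" for w
    using assms(1-4) by (simp_all add: s_def mult.assoc[symmetric] cscale_mult_left)
  have neg_four: "(-4::complex) *\<^sub>c z = - (z + (z + (z + z)))" for z :: "'n dk"
    by (simp flip: cscale_four)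
  \<comment> \<open>In a right action the left factor \<open>\<xi> i\<close> of the product acts
    before \<open>\<xi>b i\<close>.\<close>
  have inl1: "hact (letter i (Inl 1)) x = - hact (\<xi>b i) (hact (\<xi> i) x)" for x
    by (simp add: hact_mult clinear_neg[OF clinear_hact(2)])
  note simps = hact_gen left_diff_distrib right_diff_distrib distrib_left distrib_right dk_site assms(1-4)[folded s_def] move
     hig_scalar_def hig_letter_def cscale_mult_left cscale_mult_right cscale_one s_def parity_sign_def L
  show ?thesis
    unfolding inl1
    by (cases h; cases a; cases l rule: letter_cases; simp add: simps; simp add: cscale_four neg_four algebra_simps)
qed

lemma hig_letter_commute:
  assumes "Z * \<xi> i = \<xi> i * Z" "Z * \<xi>b i = \<xi>b i * Z"
  shows "Z * hig_letter h a i = hig_letter h a i * Z"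
proof -
  have "Z * (\<xi> i * \<xi>b i) = \<xi> i * \<xi>b i * Z" by (rule commute_mult[OF assms])
  then show ?thesis
    by (simp add: hig_letter_def right_diff_distrib left_diff_distrib)
qed

lemma hig_letter_group:
  "hig_letter h a i * K = K * hig_letter h a i" "hig_letter h a i * Kb = Kb * hig_letter h a i"
  by (simp_all add: hig_letter_def right_diff_distrib left_diff_distrib dk_site)

lemma hig_letter_other_site:
  assumes "i \<noteq> j"
  shows "hig_letter h a i * letter j l = letter j l * hig_letter h a i"
    "hig_letter h a i * \<xi> j = \<xi> j * hig_letter h a i" "hig_letter h a i * \<xi>b j = \<xi>b j * hig_letter h a i"
proof -
  show 1: "hig_letter h a i * \<xi> j = \<xi> j * hig_letter h a i" "hig_letter h a i * \<xi>b j = \<xi>b j * hig_letter h a i"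
    using assms by (auto simp: hig_letter_def right_diff_distrib left_diff_distrib mult.assoc dk_other_site[of i j])
  then show "hig_letter h a i * letter j l = letter j l * hig_letter h a i"
    using commute_mult[OF 1] by (cases l rule: letter_cases) simp_all
qed

text \<open>While the first site is processed, the rest of the word and \<open>Z\<close> are
  spectators. The resulting \<open>hig_letter\<close> commutes with them, moves behind the remaining
  word and is absorbed into \<open>Z\<close>, so the induction has to run over all
  \<open>Z\<close>.\<close>

lemma hact_word:
  fixes Z :: "'n dk"
  assumes "distinct xs" "prod_list (map parity_sign (map \<sigma> xs)) = 1"
    and "Z * K = K * Z" "Z * Kb = Kb * Z"
    and "\<And>i. i \<in> set xs \<Longrightarrow> Z * \<xi> i = \<xi> i * Z" "\<And>i. i \<in> set xs \<Longrightarrow> Z * \<xi>b i = \<xi>b i * Z"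
    and "Kb * Z = (if h then - 1 else 1) *\<^sub>c (K * Z)"
  shows "hact (word xs (\<lambda>_. Inl 1)) (K ^ of_bool a * (word xs \<sigma> * Z))
    = (\<Prod>l\<leftarrow>map \<sigma> xs. hig_scalar h a l) *\<^sub>c (K ^ of_bool a * (Z * prod_list (map (hig_letter h a) xs)))"
  using assms(1-7)
proof (induction xs arbitrary: Z)
  case Nil
  then show ?case by (simp add: hact_one cscale_one)
next
  case (Cons i xs)
  let ?s = "parity_sign (\<sigma> i)" and ?W = "word xs \<sigma>"
  have s: "prod_list (map parity_sign (map \<sigma> xs)) = ?s"
  proof -
    have "?s * (?s * prod_list (map parity_sign (map \<sigma> xs))) = ?s" using Cons.prems(2) by simp
    then show ?thesis by (simp only: mult.assoc[symmetric] parity_sign_square mult_1_left)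
  qed
  have ii: "i \<notin> set xs" using Cons.prems by auto
  have sq: "?s *\<^sub>c ?s *\<^sub>c z = z" for z :: "'n dk" by (simp add: cscale_cscale cscale_one)
  have W: "y * ?W = ?s *\<^sub>c (?W * y)" if "\<And>j. j \<in> set xs \<Longrightarrow> y * letter j (\<sigma> j) = parity_sign (\<sigma> j) *\<^sub>c (letter j (\<sigma> j) * y)" for y
    unfolding s[symmetric] by (rule move_past_word[OF that])
  have WZ: "?W * Z * y = ?s *\<^sub>c (y * (?W * Z))" if "y * ?W = ?s *\<^sub>c (?W * y)" "Z * y = y * Z" for y
  proof -
    have "y * (?W * Z) = ?s *\<^sub>c (?W * (Z * y))"
      by (simp only: mult.assoc[symmetric] that cscale_mult_left)
    then show ?thesis by (simp add: sq mult.assoc)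
  qed
  have zi: "Z * \<xi> i = \<xi> i * Z" "Z * \<xi>b i = \<xi>b i * Z" using Cons.prems(5,6) by simp_all
  have step: "hact (letter i (Inl 1)) (K ^ of_bool a * (letter i (\<sigma> i) * (?W * Z)))
    = hig_scalar h a (\<sigma> i) *\<^sub>c (K ^ of_bool a * (hig_letter h a i * (?W * Z)))"
  proof (rule hact_site)
    show "?W * Z * K = ?s *\<^sub>c (K * (?W * Z))" "?W * Z * Kb = ?s *\<^sub>c (Kb * (?W * Z))"
      by (rule WZ[OF W]; rule letter_group Cons.prems)+
    show "?W * Z * \<xi> i = ?s *\<^sub>c (\<xi> i * (?W * Z))"
      by (rule WZ[OF W zi(1)]) (use ii in \<open>auto intro!: letter_other_site\<close>)
    show "?W * Z * \<xi>b i = ?s *\<^sub>c (\<xi>b i * (?W * Z))"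
      by (rule WZ[OF W zi(2)]) (use ii in \<open>auto intro!: letter_other_site\<close>)
    have "Kb * (?W * Z) = ?s *\<^sub>c (?W * (Kb * Z))" "K * (?W * Z) = ?s *\<^sub>c (?W * (K * Z))"
      by (simp_all only: mult.assoc[symmetric] W letter_group cscale_mult_left)
    then show "Kb * (?W * Z) = (if h then - 1 else 1) *\<^sub>c (K * (?W * Z))"
      by (simp add: Cons.prems(7) cscale_mult_right cscale_cscale)
  qed
  have w: "hig_letter h a i * (?W * Z) = ?W * (Z * hig_letter h a i)"
  proof -
    have "hig_letter h a i * ?W = ?W * hig_letter h a i"
      by (rule prod_list_map_commute, rule hig_letter_other_site) (use ii in auto)
    then show ?thesis
      by (simp only: mult.assoc[symmetric]) (simp only: mult.assoc hig_letter_commute[OF zi])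
  qed
  show ?case
  proof (cases "hig_scalar h a (\<sigma> i) = 0")
    case True
    then show ?thesis
      using step by (simp add: hact_mult clinear_0[OF clinear_hact(1)] mult.assoc del: letter.simps)
  next
    case False
    \<comment> \<open>A nonzero scalar forces an even letter, so the remaining word is still even
      and the induction hypothesis applies to it.\<close>
    then have "?s = 1" by (auto simp: hig_scalar_def parity_sign_def split: if_splits)
    then have "hact (word xs (\<lambda>_. Inl 1)) (K ^ of_bool a * (?W * (Z * hig_letter h a i)))
      = (\<Prod>l\<leftarrow>map \<sigma> xs. hig_scalar h a l) *\<^sub>c (K ^ of_bool a * (Z * hig_letter h a i * prod_list (map (hig_letter h a) xs)))"
    proof (intro Cons.IH)
      have c: "Z * hig_letter h a i * y = y * (Z * hig_letter h a i)"
        if "Z * y = y * Z" "hig_letter h a i * y = y * hig_letter h a i" for y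
        using commute_mult[of y Z "hig_letter h a i"] that by simp
      show "Z * hig_letter h a i * K = K * (Z * hig_letter h a i)" "Z * hig_letter h a i * Kb = Kb * (Z * hig_letter h a i)"
        by (rule c; rule Cons.prems hig_letter_group)+
      show "Z * hig_letter h a i * \<xi> j = \<xi> j * (Z * hig_letter h a i)" "Z * hig_letter h a i * \<xi>b j = \<xi>b j * (Z * hig_letter h a i)"
        if "j \<in> set xs" for j
        using that ii Cons.prems(5,6) by (auto intro!: c hig_letter_other_site)
      show "Kb * (Z * hig_letter h a i) = (if h then - 1 else 1) *\<^sub>c (K * (Z * hig_letter h a i))"
        by (simp only: mult.assoc[symmetric] Cons.prems(7) cscale_mult_left)
    qed (use Cons.prems s in auto)
    then show ?thesis
      using step w
      by (simp add: hact_mult clinear_scale[OF clinear_hact(1)] cscale_cscale mult.assoc del: letter.simps)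
  qed
qed

text \<open>The group sum of the integral acts first and multiplies a word by 4 or 0 according to
  its parity. Together with the factor \<open>c / 2\<close>, where \<open>c\<close> is the sign of
  reordering the top word, this gives the constant \<open>2 * c\<close>.\<close>

lemma higman_map_eps:
  obtains C where "C \<noteq> 0"
    "\<And>h a \<sigma>. \<sigma> \<in> even_words \<Longrightarrow> higman_map (eps h * (K ^ of_bool a * monomial \<sigma>) :: 'n::{finite,linorder} dk)
      = (C * (\<Prod>l\<leftarrow>map \<sigma> sites. hig_scalar h a l)) *\<^sub>c (K ^ of_bool a * (eps h * prod_list (map (hig_letter h a) sites)) * K)"
    "\<And>h a \<sigma>. \<sigma> \<notin> even_words \<Longrightarrow> higman_map (eps h * (K ^ of_bool a * monomial \<sigma>) :: 'n dk) = 0"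
proof -
  let ?m = "monomial (\<lambda>_. Inl 1) :: 'n dk"
  have lo: "letters_of UNIV UNIV = (\<lambda>_ :: 'n. Inl 1)" by (simp add: letters_of_def fun_eq_iff)
  obtain c where c: "c * c = 1" "\<xi>_word UNIV * \<xi>b_word UNIV = c *\<^sub>c ?m"
    by (rule words_eq_monomial[of "UNIV :: 'n set" UNIV, unfolded lo])
  have I: "integral_elt = (c / 2) *\<^sub>c ((1 + K + Kb + K * Kb) * ?m)"
    by (simp add: integral_elt_def mult.assoc c(2) cscale_mult_right cscale_cscale del: letter.simps)
  have group: "hact (1 + K + Kb + K * Kb) x = (if \<sigma> \<in> even_words then 4 else 0) *\<^sub>c x"
    if x: "x = eps h * (K ^ of_bool a * monomial \<sigma>)" for x :: "'n dk" and h a \<sigma>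
  proof -
    let ?s = "prod_list (map parity_sign (map \<sigma> sites))"
    have s: "?s = (if \<sigma> \<in> even_words then 1 else - 1)"
      unfolding prod_parity_sign by (simp add: even_words_def)
    have KK: "K * (monomial \<sigma> * K) = ?s *\<^sub>c monomial \<sigma>" "Kb * (monomial \<sigma> * Kb) = ?s *\<^sub>c monomial \<sigma>"
      by (simp_all only: mult.assoc[symmetric] group_word cscale_mult_left) (simp_all add: mult.assoc dk_relations)
    have 1: "hact K x = ?s *\<^sub>c x" "hact Kb x = ?s *\<^sub>c x"
    proof -
      have "hact K x = eps h * (K ^ of_bool a * (K * (monomial \<sigma> * K)))"
        by (cases a) (simp_all only: x hact_gen mult.assoc eps_left_commute[of h K] of_bool_eq power_0 power_one_right mult_1_left)
      then show "hact K x = ?s *\<^sub>c x" by (simp only: KK x cscale_mult_right)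
      have "hact Kb x = eps h * (K ^ of_bool a * (Kb * (monomial \<sigma> * Kb)))"
        by (cases a) (simp_all only: x hact_gen mult.assoc eps_left_commute[of h Kb] of_bool_eq power_0 power_one_right mult_1_left dk_relations_ord2(9) eps_left_commute[of h K])
      then show "hact Kb x = ?s *\<^sub>c x" by (simp only: KK x cscale_mult_right)
    qed
    show ?thesis
      by (simp only: clinear_add[OF clinear_hact(2)] hact_mult hact_one 1 clinear_scale[OF clinear_hact(1)])
        (simp only: s, simp add: cscale_four cscale_one add.assoc)
  qed
  have hig: "higman_map x = (if \<sigma> \<in> even_words then 2 * c else 0) *\<^sub>c (hact ?m x * K)"
    if x: "x = eps h * (K ^ of_bool a * monomial \<sigma>)" for x :: "'n dk" and h a \<sigma>
    unfolding higman_map_hact I clinear_scale[OF clinear_hact(2)] hact_mult group[OF x] clinear_scale[OF clinear_hact(1)]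
    by (simp add: cscale_mult_left cscale_cscale)
  show ?thesis
  proof (rule that[of "2 * c"])
    show "2 * c \<noteq> 0" using c(1) by auto
    fix h a and \<sigma> :: "'n \<Rightarrow> 2 + bool"
    show "higman_map (eps h * (K ^ of_bool a * monomial \<sigma>) :: 'n dk) = 0" if "\<sigma> \<notin> even_words"
      unfolding hig[OF refl] using that by simp
    assume e: "\<sigma> \<in> even_words"
    have "eps h * (K ^ of_bool a * monomial \<sigma>) = K ^ of_bool a * (monomial \<sigma> * (eps h :: 'n dk))"
      unfolding eps_left_commute by (simp only: eps_commute)
    moreover have "hact ?m (K ^ of_bool a * (monomial \<sigma> * eps h)) = (\<Prod>l\<leftarrow>map \<sigma> sites. hig_scalar h a l) *\<^sub>c
        (K ^ of_bool a * (eps h * prod_list (map (hig_letter h a) sites)))"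
    proof (rule hact_word)
      show "prod_list (map parity_sign (map \<sigma> sites)) = 1"
        unfolding prod_parity_sign using e by (simp add: even_words_def)
    qed (simp_all only: eps_commute eps_group sites)
    ultimately show "higman_map (eps h * (K ^ of_bool a * monomial \<sigma>) :: 'n dk)
      = (2 * c * (\<Prod>l\<leftarrow>map \<sigma> sites. hig_scalar h a l)) *\<^sub>c (K ^ of_bool a * (eps h * prod_list (map (hig_letter h a) sites)) * K)"
      unfolding hig[OF refl] using e by (simp add: cscale_mult_left cscale_cscale)
  qed
qed

lemma hig_elements:
  "K ^ of_bool False * (eps False * prod_list (map (hig_letter False False) sites)) * K = (Hig1 :: 'n::{finite,linorder} dk)"
  "K ^ of_bool False * (eps True * prod_list (map (hig_letter True False) sites)) * K = (Hig3 :: 'n dk)"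
  "K ^ of_bool True * (eps True * prod_list (map (hig_letter True True) sites)) * K = (eps True :: 'n dk)"
proof -
  have k: "prod_list (map (hig_letter h a) sites) * K = K * prod_list (map (hig_letter h a) (sites :: 'n list))" for h a
    by (rule prod_list_map_commute[symmetric]) (rule hig_letter_group[symmetric])
  have l: "hig_letter False False = (\<lambda>i. letter i (Inl 1))" "hig_letter True False = (\<lambda>i. 1 - \<xi> i * \<xi>b i)"
    "hig_letter True True = (\<lambda>i. 1)"
    by (simp_all add: fun_eq_iff hig_letter_def)
  show "K ^ of_bool False * (eps False * prod_list (map (hig_letter False False) sites)) * K = (Hig1 :: 'n dk)"
    by (simp only: mult.assoc k eps_left_commute of_bool_eq power_0 mult_1_left) (simp only: l Hig1_def mult.assoc)
  show "K ^ of_bool False * (eps True * prod_list (map (hig_letter True False) sites)) * K = (Hig3 :: 'n dk)"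
    by (simp only: mult.assoc k eps_left_commute of_bool_eq power_0 mult_1_left) (simp only: l Hig3_def mult.assoc)
  show "K ^ of_bool True * (eps True * prod_list (map (hig_letter True True) sites)) * K = (eps True :: 'n dk)"
    by (simp only: l prod_list_map_one) (simp add: mult.assoc eps_commute dk_relations_ord2)
qed

lemma Hig_eq: "Hig = cvec.span {Hig1, eps True, Hig3 :: 'n::{finite,linorder} dk}"
proof -
  let ?S = "cvec.span {Hig1, eps True, Hig3 :: 'n dk}"
  obtain C where C: "C \<noteq> 0"
    "\<And>h a \<sigma>. \<sigma> \<in> even_words \<Longrightarrow> higman_map (eps h * (K ^ of_bool a * monomial \<sigma>) :: 'n dk)
      = (C * (\<Prod>l\<leftarrow>map \<sigma> sites. hig_scalar h a l)) *\<^sub>c (K ^ of_bool a * (eps h * prod_list (map (hig_letter h a) sites)) * K)"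
    "\<And>h a \<sigma>. \<sigma> \<notin> even_words \<Longrightarrow> higman_map (eps h * (K ^ of_bool a * monomial \<sigma>) :: 'n dk) = 0"
    by (rule higman_map_eps) blast
  have sub: "cvec.subspace (Hig :: 'n dk set)"
    unfolding Hig_def
    by (rule cvec.subspaceI) (auto simp: clinear_add[OF clinear_higman_map, symmetric] clinear_scale[OF clinear_higman_map, symmetric]
        intro: range_eqI[of _ _ 0] simp: clinear_0[OF clinear_higman_map])
  have const: "prod_list (map f (map (\<lambda>_. l) xs)) = f l ^ length xs" for f :: "2 + bool \<Rightarrow> complex" and l and xs :: "'n list"
    by (induction xs) auto
  have ev: "(\<lambda>_ :: 'n. Inl b) \<in> even_words" for b by (simp add: even_words_def)
  have mem: "x \<in> Hig" if "higman_map y = c *\<^sub>c x" "c \<noteq> 0" for x y :: "'n dk" and c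
  proof -
    have "(1 / c) *\<^sub>c higman_map y \<in> Hig"
      by (rule cvec.subspace_scale[OF sub]) (simp add: Hig_def)
    then show ?thesis using that by (simp add: cscale_cscale cscale_one)
  qed
  have "Hig1 \<in> (Hig :: 'n dk set)"
    by (rule mem, rule C(2)[where h = False and a = False and \<sigma> = "\<lambda>_. Inl 2", unfolded hig_elements, OF ev])
      (simp_all only: const C(1), simp_all add: hig_scalar_def C(1))
  moreover have "Hig3 \<in> (Hig :: 'n dk set)"
    by (rule mem, rule C(2)[where h = True and a = False and \<sigma> = "\<lambda>_. Inl 2", unfolded hig_elements, OF ev])
      (simp_all only: const C(1), simp_all add: hig_scalar_def C(1))
  moreover have "eps True \<in> (Hig :: 'n dk set)"
    by (rule mem, rule C(2)[where h = True and a = True and \<sigma> = "\<lambda>_. Inl 1", unfolded hig_elements, OF ev])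
      (simp_all only: const C(1), simp_all add: hig_scalar_def C(1))
  ultimately have "?S \<subseteq> Hig" by (intro cvec.span_minimal[OF _ sub]) auto
  moreover have "Hig \<subseteq> ?S"
  proof -
    have eps: "higman_map (eps h * (K ^ of_bool a * monomial \<sigma>)) \<in> ?S" for h a and \<sigma> :: "'n \<Rightarrow> 2 + bool"
    proof (cases "\<sigma> \<in> even_words")
      case False
      show ?thesis unfolding C(3)[OF False] by (rule cvec.span_zero)
    next
      case True
      show ?thesis
      proof (cases "h \<or> \<not> a")
        case ha: True
        then have "K ^ of_bool a * (eps h * prod_list (map (hig_letter h a) sites)) * K \<in> ?S"
          using hig_elements[where 'n = 'n] by (cases h; cases a) (auto intro: cvec.span_base simp del: of_bool_eq power_0)
        then show ?thesis unfolding C(2)[OF True] by (rule cvec.span_scale)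
      next
        case False
        \<comment> \<open>Here \<open>h\<close> is False and \<open>a\<close> is True, so every
          scalar is 0; exhibiting one site rules out the empty product, which would be 1.\<close>
        have "hd sites \<in> set (sites :: 'n list)" by simp
        then have "0 \<in> set (map (hig_scalar h a) (map \<sigma> sites))"
          using False by (auto simp: hig_scalar_def image_iff)
        then have "(\<Prod>l\<leftarrow>map \<sigma> sites. hig_scalar h a l) = 0" by (simp only: prod_list_zero_iff)
        then show ?thesis unfolding C(2)[OF True] by (simp add: cvec.span_zero)
      qed
    qed
    have x: "higman_map x \<in> ?S" for x
    proof -
      have "x \<in> cvec.span (range (\<lambda>(p, q, \<sigma>). pbw p q \<sigma> :: 'n dk))" by (simp add: span_pbw)
      then show ?thesis
      proof (induction rule: cvec.span_induct_alt)
        case base show ?case by (simp add: clinear_0[OF clinear_higman_map] cvec.span_zero)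
      next
        case (step c b y)
        then obtain p q and \<sigma> :: "'n \<Rightarrow> 2 + bool" where b: "b = pbw p q \<sigma>" by auto
        \<comment> \<open>Within a block \<open>Kb\<close> is \<open>K\<close> up to sign, so the
          group part reduces to a power of \<open>K\<close> whose exponent is the sum of the two
          exponents modulo 2.\<close>
        have e: "eps h * b = (if q \<and> h then - 1 else 1) *\<^sub>c (eps h * (K ^ of_bool (p \<noteq> q) * monomial \<sigma>))" for h
        proof -
          have "eps h * (Kb * z) = (if h then - 1 else 1) *\<^sub>c (eps h * (K * z))" for z :: "'n dk"
            by (simp only: mult.assoc[symmetric] eps_commute[of h Kb] eps_commute[of h K] eps_group(1) cscale_mult_left)
          then show ?thesis
            by (cases p; cases q; cases h) (simp_all add: b pbw_def mult.assoc cscale_one eps_left_commute[of _ K] cscale_mult_right dk_relations_ord2(1))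
        qed
        have "b = eps False * b + eps True * b"
          by (simp only: distrib_right[symmetric] eps_sum mult_1_left)
        then have "higman_map b = higman_map (eps False * b) + higman_map (eps True * b)"
          by (metis clinear_add[OF clinear_higman_map])
        then have "higman_map b \<in> ?S"
          by (simp only: e clinear_scale[OF clinear_higman_map]) (intro cvec.span_add cvec.span_scale eps)
        then show ?case using step
          by (simp only: clinear_add[OF clinear_higman_map] clinear_scale[OF clinear_higman_map]) (intro cvec.span_add cvec.span_scale)
      qed
    qed
    then show ?thesis unfolding Hig_def by blast
  qed
  ultimately show ?thesis by blast
qed

lemma span_three: "x \<in> cvec.span {a, b, c} \<longleftrightarrow> (\<exists>u v w. x = u *\<^sub>c a + v *\<^sub>c b + w *\<^sub>c (c :: 'a::cvector))"
proof
  assume "x \<in> cvec.span {a, b, c}"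
  then obtain u v w where "x - u *\<^sub>c a - v *\<^sub>c b - w *\<^sub>c c = 0"
    by (auto simp: cvec.span_breakdown_eq)
  then show "\<exists>u v w. x = u *\<^sub>c a + v *\<^sub>c b + w *\<^sub>c c"
    by (intro exI[of _ u] exI[of _ v] exI[of _ w]) (simp add: algebra_simps)
next
  have "u *\<^sub>c a + v *\<^sub>c b + w *\<^sub>c c \<in> cvec.span {a, b, c}" for u v w
    by (intro cvec.span_add cvec.span_scale) (auto intro: cvec.span_base)
  then show "\<exists>u v w. x = u *\<^sub>c a + v *\<^sub>c b + w *\<^sub>c c \<Longrightarrow> x \<in> cvec.span {a, b, c}" by blast
qed

section \<open>Coordinates on the Higman ideal\<close>

lemma Hig1_pbw: "Hig1 = (1/2) *\<^sub>c pbw True False (\<lambda>_. Inl 1) + (1/2) *\<^sub>c pbw False True (\<lambda>_. Inl 1)"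
  by (simp add: Hig1_def eps_def pbw_def distrib_left distrib_right cscale_mult_left cscale_mult_right
      cscale_add_right cscale_one mult.assoc dk_relations_ord2)

lemma eps_True_pbw: "eps True = (1/2) *\<^sub>c pbw False False (\<lambda>_. Inl 2) - (1/2) *\<^sub>c pbw True True (\<lambda>_. Inl 2)"
proof -
  have "monomial (\<lambda>_. Inl 2) = (1 :: 'a dk)" by (rule word_one)
  then show ?thesis
    unfolding pbw_def by (simp add: eps_def cvec.scale_right_diff_distrib cscale_one del: letter.simps)
qed

lemma Hig3_pbw:
  "Hig3 = (\<Sum>\<sigma>\<in>UNIV. (word_matrix sl2_t \<sigma> (\<lambda>_. Inl 2) / 2) *\<^sub>c (pbw True False \<sigma> - pbw False True \<sigma>))"
proof -
  have "K * eps True = (1/2) *\<^sub>c (K - Kb :: 'a dk)"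
    by (simp add: eps_def cscale_mult_right right_diff_distrib dk_relations_ord2 cscale_one)
  moreover have "chirality = (\<Sum>\<sigma>\<in>UNIV. word_matrix sl2_t \<sigma> (\<lambda>_ :: 'a. Inl 2) *\<^sub>c monomial \<sigma>)"
    using prod_letter_matrix[OF T_letter_matrix, of "\<lambda>_ :: 'a. Inl 2"] by (simp del: letter.simps)
  ultimately show ?thesis
    unfolding Hig3_def pbw_def
    by (simp add: sum_distrib_left cscale_mult_left cscale_mult_right left_diff_distrib cscale_cscale
        cvec.scale_sum_right del: letter.simps)
qed

text \<open>\<open>a\<close>, \<open>b\<close>, \<open>c\<close> are the coordinates along
  \<open>Hig1\<close>, \<open>eps True\<close>, \<open>Hig3\<close>. The group parts
  \<open>K\<close> and \<open>Kb\<close> enter \<open>Hig1\<close> symmetrically and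
  \<open>Hig3\<close> antisymmetrically, so the sum in \<open>a\<close> removes \<open>Hig3\<close>,
  and the difference in \<open>c\<close> adds up its two halves. Three permuted coordinates split
  into their sum, which is invariant, and their differences, which carry the two-dimensional
  part.\<close>

definition hig_coords :: "'n::{finite,linorder} dk \<Rightarrow> complex \<times> (complex^2)" where
  "hig_coords x = (let a = pbw_coeff True False (\<lambda>_. Inl 1) x + pbw_coeff False True (\<lambda>_. Inl 1) x;
       b = 2 * pbw_coeff False False (\<lambda>_. Inl 2) x;
       c = pbw_coeff True False (\<lambda>_. Inl 2) x - pbw_coeff False True (\<lambda>_. Inl 2) x
     in (a + b + c, vector [a - c, b - c]))"

lemma clinear_hig_coords: "clinear hig_coords"
  by (rule clinearI)
    (simp_all add: hig_coords_def Let_def clinear_add[OF clinear_pbw_coeff] clinear_scale[OF clinear_pbw_coeff]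
      cscale_prod_def cscale_vec_def vec_eq_iff forall_2 vector_2 cscale_complex_def algebra_simps)

lemma hig_coords_basis:
  "hig_coords (u *\<^sub>c Hig1 + v *\<^sub>c eps True + w *\<^sub>c (Hig3 :: 'n::{finite,linorder} dk)) = (u + v + w, vector [u - w, v - w])"
proof -
  note lin = clinear_add[OF clinear_pbw_coeff] clinear_scale[OF clinear_pbw_coeff] clinear_diff[OF clinear_pbw_coeff]
  have ne: "(\<lambda>_ :: 'n. Inl 1 :: 2 + bool) \<noteq> (\<lambda>_. Inl 2)" by (simp add: fun_eq_iff)
  have "word_matrix sl2_t (\<lambda>_ :: 'n. Inl 2) (\<lambda>_. Inl 2) = 1"
    by (simp add: word_matrix_def letter_matrix_def sl2_t_def vector_2)
  then have H3: "pbw_coeff p q \<sigma> (Hig3 :: 'n dk) = (if p = q then 0 else (if p then 1 else - 1) * word_matrix sl2_t \<sigma> (\<lambda>_. Inl 2) / 2)" for p q \<sigma>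
    unfolding Hig3_pbw clinear_sum[OF clinear_pbw_coeff]
    by (cases p; cases q) (simp_all add: lin pbw_coeff_pbw cscale_complex_def if_distrib[of "\<lambda>z. _ * z"] if_distrib[of uminus] cong: if_cong)
  show ?thesis
    using ne ne[symmetric] \<open>word_matrix sl2_t (\<lambda>_ :: 'n. Inl 2) (\<lambda>_. Inl 2) = 1\<close>
    by (simp add: hig_coords_def Let_def lin Hig1_pbw eps_True_pbw H3 pbw_coeff_pbw cscale_complex_def)
qed

text \<open>Each of the six invertible matrices modulo 2 has a unique lift to the group generated by
  the images of \<open>s\<close> and \<open>t\<close> below, a copy of the symmetric group on three letters.\<close>

definition perm_matrix :: "bool \<Rightarrow> bool \<Rightarrow> bool \<Rightarrow> bool \<Rightarrow> complex^2^2" where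
  "perm_matrix a b c d = (
     if \<not> b \<and> \<not> c then vector [vector [1, 0], vector [0, 1]]
     else if \<not> c then vector [vector [1, -1], vector [0, -1]]
     else if \<not> b then vector [vector [-1, 0], vector [-1, 1]]
     else if \<not> a \<and> \<not> d then vector [vector [0, 1], vector [1, 0]]
     else if \<not> a then vector [vector [0, -1], vector [1, -1]]
     else vector [vector [-1, 1], vector [-1, 0]])"

definition N1_rep :: "(complex^2) rep" where
  "N1_rep = (UNIV, \<lambda>g v. perm_matrix (odd (g$1$1)) (odd (g$1$2)) (odd (g$2$1)) (odd (g$2$2)) *v v)"

text \<open>Arithmetic modulo 2 on Booleans, with \<open>\<and>\<close> as product and
  \<open>\<noteq>\<close> as sum. The hypotheses say that both determinants are odd, which leaves
  six matrices on each side.\<close>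

lemma perm_matrix_mult:
  assumes "(a \<and> d) \<noteq> (b \<and> c)" "(a' \<and> d') \<noteq> (b' \<and> c')"
  shows "perm_matrix ((a \<and> a') \<noteq> (b \<and> c')) ((a \<and> b') \<noteq> (b \<and> d')) ((c \<and> a') \<noteq> (d \<and> c')) ((c \<and> b') \<noteq> (d \<and> d'))
    = perm_matrix a b c d ** perm_matrix a' b' c' d'"
  using assms
  by (cases a; cases b; cases c; cases d; simp;
      cases a'; cases b'; cases c'; cases d';
      simp add: perm_matrix_def vec_eq_iff forall_2 matrix_matrix_mult_def sum_2 vector_2)

lemma N1_rep_act: "rep_act N1_rep g v = perm_matrix (odd (g$1$1)) (odd (g$1$2)) (odd (g$2$1)) (odd (g$2$2)) *v v"
  by (simp add: N1_rep_def)

lemma N1_rep_s_t: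
  "rep_act N1_rep sl2_s v = vector [v $ 2, v $ 1]"
  "rep_act N1_rep sl2_t v = vector [v $ 1 - v $ 2, - v $ 2]"
  by (simp_all add: N1_rep_act sl2_s_def sl2_t_def perm_matrix_def vec_eq_iff forall_2
      matrix_vector_mult_def sum_2 vector_2)

lemma SL2Z_s_t: "sl2_s \<in> SL2Z" "sl2_t \<in> SL2Z"
  by (simp_all add: SL2Z_def sl2_s_def sl2_t_def det_2 vector_2)

lemma is_rep_N1: "is_rep N1_rep"
  unfolding is_rep_def
proof (intro conjI ballI allI)
  have sp: "rep_space N1_rep = UNIV" by (simp add: N1_rep_def)
  show "cvec.subspace (rep_space N1_rep)" by (simp add: sp)
  show "rep_act N1_rep g v \<in> rep_space N1_rep" for g v by (simp add: sp)
  show "rep_act N1_rep g (u + v) = rep_act N1_rep g u + rep_act N1_rep g v" for g u v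
    by (simp add: N1_rep_act matrix_vector_right_distrib)
  show "rep_act N1_rep g (c *\<^sub>c v) = c *\<^sub>c rep_act N1_rep g v" for g c v
    by (simp add: N1_rep_act vec_eq_iff matrix_vector_mult_def cscale_vec_def cscale_complex_def sum_distrib_left mult_ac)
  show "rep_act N1_rep (mat 1) v = v" for v
    by (simp add: N1_rep_act mat_def perm_matrix_def vec_eq_iff forall_2 matrix_vector_mult_def sum_2 vector_2)
  fix g h v assume gh: "g \<in> SL2Z" "h \<in> SL2Z"
  have odd_det: "(odd (g$1$1) \<and> odd (g$2$2)) \<noteq> (odd (g$1$2) \<and> odd (g$2$1))" if "g \<in> SL2Z" for g
  proof -
    have "odd (g$1$1 * g$2$2 - g$1$2 * g$2$1)" using that by (simp add: SL2Z_def det_2)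
    then show ?thesis by auto
  qed
  have p: "odd ((g ** h) $ i $ j) \<longleftrightarrow> (odd (g$i$1) \<and> odd (h$1$j)) \<noteq> (odd (g$i$2) \<and> odd (h$2$j))" for i j
    by (auto simp: matrix_matrix_mult_def sum_2)
  show "rep_act N1_rep (g ** h) v = rep_act N1_rep g (rep_act N1_rep h v)"
    unfolding N1_rep_act p perm_matrix_mult[OF odd_det[OF gh(1)] odd_det[OF gh(2)]]
    by (simp add: matrix_vector_mul_assoc)
qed

section \<open>Dimension and irreducibility of the two-dimensional representation\<close>

lemma dim_complex2: "cvec.dim (UNIV :: (complex^2) set) = 2"
proof -
  let ?e = "\<lambda>i. axis i (1 :: complex) :: complex^2"
  have lin: "clinear (\<lambda>v. v $ i)" for i :: 2 by (rule clinearI) (simp_all add: cscale_vec_def)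
  have dual: "?e j $ i = (if i = j then 1 else 0)" for i j by (simp add: axis_def)
  note ind = dual_family_independent[of "\<lambda>i v. v $ i" ?e, OF lin dual]
  have "v = (\<Sum>i\<in>UNIV. (v $ i) *\<^sub>c ?e i)" for v :: "complex^2"
    by (simp add: vec_eq_iff forall_2 sum_2 cscale_vec_def cscale_complex_def axis_def)
  then have "v \<in> cvec.span (range ?e)" for v :: "complex^2"
    by (metis (no_types, lifting) cvec.span_base cvec.span_scale cvec.span_sum rangeI)
  then have "cvec.span (range ?e) = cvec.span UNIV" by auto
  then have "cvec.dim (UNIV :: (complex^2) set) = card (range ?e)"
    by (rule cvec.dim_eq_card[OF _ ind(2)])
  also have "\<dots> = 2" by (simp add: card_image[OF ind(1)])
  finally show ?thesis .
qed

text \<open>A nonzero invariant subspace contains a vector with nonzero second entry, if necessary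
  after a swap by \<open>s\<close>. The operator 1 - t sends it to a nonzero multiple of (1, 2), and
  the swapped vector (2, 1) is independent of that.\<close>

lemma is_N1_rep: "is_N1 N1_rep"
  unfolding is_N1_def irreducible_rep_def
proof (intro conjI allI impI)
  have sp: "rep_space N1_rep = UNIV" by (simp add: N1_rep_def)
  show "is_rep N1_rep" by (rule is_rep_N1)
  have "axis 1 1 \<noteq> (0 :: complex^2)" by simp
  then show "rep_space N1_rep \<noteq> {0}" unfolding sp by blast
  show "cvec.dim (rep_space N1_rep) = 2" unfolding sp by (rule dim_complex2)
  show "factors_mod 2 N1_rep"
    unfolding factors_mod_def
  proof (intro ballI impI)
    fix g h :: "int^2^2" and v :: "complex^2"
    assume "\<forall>i j. g $ i $ j mod 2 = h $ i $ j mod 2"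
    then have "odd (g $ i $ j) \<longleftrightarrow> odd (h $ i $ j)" for i j by (simp add: odd_iff_mod_2_eq_one)
    then show "rep_act N1_rep g v = rep_act N1_rep h v" by (simp add: N1_rep_act)
  qed
  fix U assume U: "cvec.subspace U \<and> U \<subseteq> rep_space N1_rep \<and> (\<forall>g\<in>SL2Z. \<forall>v\<in>U. rep_act N1_rep g v \<in> U)"
  show "U = {0} \<or> U = rep_space N1_rep"
  proof (cases "U = {0}")
    case False
    have sub: "cvec.subspace U" using U by blast
    have s: "vector [v $ 2, v $ 1] \<in> U" and t: "vector [v $ 1 - v $ 2, - v $ 2] \<in> U" if "v \<in> U" for v
      using U that SL2Z_s_t N1_rep_s_t by metis+
    obtain v where v: "v \<in> U" "v \<noteq> 0"
      using False cvec.subspace_0[OF sub] by blast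
    have "\<exists>w\<in>U. w $ 2 \<noteq> 0"
      using v s[OF v(1)] by (auto simp: vec_eq_iff forall_2 vector_2 intro: bexI[of _ "vector [v $ 2, v $ 1]"])
    then obtain w where w: "w \<in> U" "w $ 2 \<noteq> 0" by blast
    define x :: "complex^2" where "x = (1 / w $ 2) *\<^sub>c (w - vector [w $ 1 - w $ 2, - w $ 2])"
    have x: "x \<in> U"
      unfolding x_def by (intro cvec.subspace_scale[OF sub] cvec.subspace_diff[OF sub] w t)
    have x12: "x $ 1 = 1" "x $ 2 = 2"
      using w by (simp_all add: x_def cscale_vec_def cscale_complex_def vector_2 field_simps)
    note y = s[OF x, unfolded x12]
    have "z \<in> U" for z :: "complex^2"
    proof -
      \<comment> \<open>Cramer's rule for the vectors (1, 2) and (2, 1), whose determinant is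
        -3.\<close>
      have "z = ((2 * z $ 2 - z $ 1) / 3) *\<^sub>c x + ((2 * z $ 1 - z $ 2) / 3) *\<^sub>c vector [2, 1]"
        by (simp add: vec_eq_iff forall_2 cscale_vec_def cscale_complex_def vector_2 x12 field_simps)
      then show ?thesis
        using cvec.subspace_add[OF sub cvec.subspace_scale[OF sub x] cvec.subspace_scale[OF sub y]] by metis
    qed
    then show ?thesis unfolding sp by blast
  qed simp
qed

section \<open>The Higman ideal as a projective representation\<close>

lemma Hig_decomposes: "proj_decomposes_as (Hig :: 'n::{finite,linorder} dk set) (triv_rep \<oplus>\<^sub>r N1_rep)"
  unfolding proj_decomposes_as_def
proof (intro conjI exI ballI)
  let ?t = "top_value TYPE('n) / 2"
  have mem: "x \<in> Hig \<longleftrightarrow> (\<exists>u v w. x = u *\<^sub>c Hig1 + v *\<^sub>c eps True + w *\<^sub>c Hig3)" for x :: "'n dk"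
    unfolding Hig_eq span_three ..
  have S: "S_LM (u *\<^sub>c Hig1 + v *\<^sub>c eps True + w *\<^sub>c Hig3) = ?t *\<^sub>c (v *\<^sub>c Hig1 + u *\<^sub>c eps True + w *\<^sub>c (Hig3 :: 'n dk))" for u v w
    by (simp add: clinear_add[OF clinear_S_LM] clinear_scale[OF clinear_S_LM] S_LM_Hig cscale_add_right cscale_cscale
        mult.commute add_ac)
  have T: "T_LM (u *\<^sub>c Hig1 + v *\<^sub>c eps True + w *\<^sub>c Hig3) = u *\<^sub>c Hig1 + w *\<^sub>c eps True + v *\<^sub>c (Hig3 :: 'n dk)" for u v w
    by (simp add: clinear_add[OF clinear_T_LM] clinear_scale[OF clinear_T_LM] T_LM_Hig add_ac)
  have act: "rep_act (triv_rep \<oplus>\<^sub>r N1_rep) g (z, v) = (z, rep_act N1_rep g v)" for g z v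
    by (simp add: rep_sum_def triv_rep_def)
  show sub: "cvec.subspace (Hig :: 'n dk set)" unfolding Hig_eq by (rule cvec.subspace_span)
  show "(Hig :: 'n dk set) \<subseteq> center"
    unfolding Hig_eq by (rule cvec.span_minimal[OF _ subspace_center]) (auto simp: Hig1_center Hig3_center eps_center)
  show "S_LM ` (Hig :: 'n dk set) \<subseteq> Hig"
  proof safe
    fix x :: "'n dk" assume "x \<in> Hig"
    then obtain u v w where "x = u *\<^sub>c Hig1 + v *\<^sub>c eps True + w *\<^sub>c Hig3" unfolding mem by blast
    moreover have "v *\<^sub>c Hig1 + u *\<^sub>c eps True + w *\<^sub>c (Hig3 :: 'n dk) \<in> Hig" unfolding mem by blast
    ultimately show "S_LM x \<in> Hig" using cvec.subspace_scale[OF sub] S by simp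
  qed
  show "T_LM ` (Hig :: 'n dk set) \<subseteq> Hig"
  proof safe
    fix x :: "'n dk" assume "x \<in> Hig"
    then obtain u v w where x: "x = u *\<^sub>c Hig1 + v *\<^sub>c eps True + w *\<^sub>c Hig3" unfolding mem by blast
    show "T_LM x \<in> Hig" unfolding x T mem by blast
  qed
  show "clinear (hig_coords :: 'n dk \<Rightarrow> _)" by (rule clinear_hig_coords)
  show "bij_betw hig_coords (Hig :: 'n dk set) (rep_space (triv_rep \<oplus>\<^sub>r N1_rep))"
  proof (rule bij_betwI')
    fix x y :: "'n dk" assume "x \<in> Hig" "y \<in> Hig"
    then obtain u v w u' v' w' where x: "x = u *\<^sub>c Hig1 + v *\<^sub>c eps True + w *\<^sub>c Hig3"
      and y: "y = u' *\<^sub>c Hig1 + v' *\<^sub>c eps True + w' *\<^sub>c Hig3" unfolding mem by blast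
    show "hig_coords x = hig_coords y \<longleftrightarrow> x = y"
    proof
      assume "hig_coords x = hig_coords y"
      then have e: "u + v + w = u' + v' + w'" "u - w = u' - w'" "v - w = v' - w'"
        by (auto simp: x y hig_coords_basis vec_eq_iff forall_2 vector_2)
      \<comment> \<open>The sum of the three coordinates minus the two differences is three times
        the last coordinate. Solving this relation for the last coordinate also gives the preimage
        used for surjectivity.\<close>
      have "3 * w = 3 * w'" using e by algebra
      then have "w = w'" by simp
      then show "x = y" using e by (simp add: x y)
    qed simp
  next
    fix x :: "'n dk"
    show "hig_coords x \<in> rep_space (triv_rep \<oplus>\<^sub>r N1_rep)"
      by (cases "hig_coords x") (simp add: rep_sum_def triv_rep_def N1_rep_def)
  next
    fix p assume "p \<in> rep_space (triv_rep \<oplus>\<^sub>r N1_rep)"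
    obtain z q where p: "p = (z, q)" by (cases p)
    let ?w = "(z - q $ 1 - q $ 2) / 3"
    let ?x = "(q $ 1 + ?w) *\<^sub>c Hig1 + (q $ 2 + ?w) *\<^sub>c eps True + ?w *\<^sub>c (Hig3 :: 'n dk)"
    have "p = hig_coords ?x"
      unfolding p hig_coords_basis by (simp add: vec_eq_iff forall_2 vector_2 field_simps)
    moreover have "?x \<in> Hig" unfolding mem by blast
    ultimately show "\<exists>x\<in>(Hig :: 'n dk set). p = hig_coords x" by blast
  qed
  show "?t \<noteq> 0" using cointegral_pbw(3)[where 'n = 'n] by simp
  show "(1::complex) \<noteq> 0" by simp
  fix x :: "'n dk" assume "x \<in> Hig"
  then obtain u v w where x: "x = u *\<^sub>c Hig1 + v *\<^sub>c eps True + w *\<^sub>c Hig3" unfolding mem by blast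
  show "hig_coords (S_LM x) = ?t *\<^sub>c rep_act (triv_rep \<oplus>\<^sub>r N1_rep) sl2_s (hig_coords x)"
    unfolding x S clinear_scale[OF clinear_hig_coords] hig_coords_basis act N1_rep_s_t
    by (simp add: vector_2 add_ac)
  show "hig_coords (T_LM x) = 1 *\<^sub>c rep_act (triv_rep \<oplus>\<^sub>r N1_rep) sl2_t (hig_coords x)"
    unfolding x T hig_coords_basis act N1_rep_s_t cscale_one
    by (simp add: vector_2 add_ac)
qed

theorem theorem7p3p11:
  assumes "CARD('n::{finite,linorder}) \<ge> 2" and "even CARD('n)"
  shows "(\<exists>N\<^sub>1 :: (complex^2) rep. is_N1 N\<^sub>1 \<and>
           proj_decomposes_as (Hig :: 'n dk set) (triv_rep \<oplus>\<^sub>r N\<^sub>1))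
       \<and> proj_decomposes_as (Z_\<Lambda> :: 'n dk set)
           (rep_Sum {(k, j). k \<le> CARD('n) \<and> even k \<and> j < (CARD('n) choose k) * 2 ^ (CARD('n) - k)}
             (\<lambda>(k, j). std_power k))"
  using is_N1_rep Hig_decomposes Z_\<Lambda>_decomposes[OF assms(2)] unfolding copies_def by blast

end
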